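(* Let $\mathcal{C}=\mathrm{O}^{\epsilon}(n,q)$ with $q$ odd, $\epsilon\in\{+,-,\circ\}$, or $\mathcal{C}=\mathrm{U}(n,q)$, and let $\mathcal{S}$ be the corresponding special group ($\mathrm{SO}^{\epsilon}(n,q)$ or $\mathrm{SU}(n,q)$). Let $x\in\mathcal{S}$, and let $f_1^{m_1},\dots,f_k^{m_k}$ be the generalized elementary divisors of $x$, with $f_i\in\Phi$ not necessarily distinct. If $\mathcal{C}$ is orthogonal, then the conjugacy class of $x$ in $\mathcal{C}$ splits into two distinct classes in $\mathcal{S}$ if, and only if, $x$ has no elementary divisors $(t\pm1)^m$ with $m$ odd. If $\mathcal{C}$ is unitary, then the conjugacy class of $x$ in $\mathcal{C}$ splits into $r$ distinct classes in $\mathcal{S}$, where $$r=\gcd(m_1,\dots,m_k,q+1).$$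
   Context: $F=\mathbb{F}_{q^2}$, $\overline\lambda=\lambda^q$ in the unitary case; $F=\mathbb{F}_q$, $\overline\lambda=\lambda$ in the orthogonal case. $\mathrm{O}^\epsilon(n,q)$ is the isometry group of a non-singular quadratic form on $\mathbb{F}_q^n$ (plus/minus type for $\epsilon=\pm$, $n$ even; $\epsilon=\circ$, $n$ odd), $\mathrm{U}(n,q)$ that of a non-degenerate hermitian form on $\mathbb{F}_{q^2}^n$; the special groups are the subgroups of elements of determinant 1. For monic $f$ of degree $d$ with $f(0)\ne0$, $f^*(t)=\overline{f(0)}^{-1}t^d\overline f(t^{-1})$. $\Phi_1$: monic irreducible $f=f^*$ of degree 1; $\Phi_2$: $f=gg^*$ with $g\neq g^*$ monic irreducible; $\Phi_3$: monic irreducible $f=f^*$ of degree $>1$; $\Phi=\Phi_1\cup\Phi_2\cup\Phi_3$. The elementary divisors of $x$ are the prime-power polynomials of its decomposition of $V$ into cyclic $F[t]$-modules. For $x\in\mathcal{C}$, $f^m$ with $f\in\Phi$ is a generalized elementary divisor of $x$ if either $f\in\Phi_1\cup\Phi_3$ and $f^m$ is an elementary divisor of $x$, or $f=gg^*\in\Phi_2$ and $g^m$ is an elementary divisor of $x$ (then so is $(g^* )^m$, with the same multiplicity); each is listed with its multiplicity. *)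

theory Defs
  imports
    "HOL-Analysis.Determinants"
    "HOL-Computational_Algebra.Polynomial_Factorial"
    "HOL-Library.Multiset"
begin

subsection \<open>Quadratic and hermitian forms, isometry groups\<close>

definition polar :: "('a::field^'n \<Rightarrow> 'a) \<Rightarrow> 'a^'n \<Rightarrow> 'a^'n \<Rightarrow> 'a" where
  "polar Q u v = Q (u + v) - Q u - Q v"

definition quadratic_form :: "('a::field^'n \<Rightarrow> 'a) \<Rightarrow> bool" where
  "quadratic_form Q \<longleftrightarrow>
     (\<forall>a v. Q (a *s v) = a\<^sup>2 * Q v) \<and>
     (\<forall>u. Vector_Spaces.linear (*s) (*) (\<lambda>v. polar Q u v)) \<and>
     (\<forall>v. Vector_Spaces.linear (*s) (*) (\<lambda>u. polar Q u v))"

text \<open>In odd characteristic \<open>polar Q v v = 2 * Q v\<close>, so the condition below says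
  exactly that the polar form is non-degenerate.\<close>

definition nonsingular_quadratic_form :: "('a::field^'n \<Rightarrow> 'a) \<Rightarrow> bool" where
  "nonsingular_quadratic_form Q \<longleftrightarrow>
     quadratic_form Q \<and> (\<forall>v. v \<noteq> 0 \<and> (\<forall>w. polar Q v w = 0) \<longrightarrow> Q v \<noteq> 0)"

definition witt_index :: "('a::field^'n \<Rightarrow> 'a) \<Rightarrow> nat" where
  "witt_index Q = Max {vec.dim W | W. vec.subspace W \<and> (\<forall>w\<in>W. Q w = 0)}"

datatype form_type = Plus | Minus | Circ

fun has_type :: "('a::field^'n \<Rightarrow> 'a) \<Rightarrow> form_type \<Rightarrow> bool" where
  "has_type Q Plus \<longleftrightarrow> even CARD('n) \<and> 2 * witt_index Q = CARD('n)"
| "has_type Q Minus \<longleftrightarrow> even CARD('n) \<and> 2 * witt_index Q + 2 = CARD('n)"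
| "has_type Q Circ \<longleftrightarrow> odd CARD('n)"

definition nondegenerate_hermitian_form ::
    "('a::field \<Rightarrow> 'a) \<Rightarrow> ('a^'n \<Rightarrow> 'a^'n \<Rightarrow> 'a) \<Rightarrow> bool" where
  "nondegenerate_hermitian_form bar h \<longleftrightarrow>
     (\<forall>v. Vector_Spaces.linear (*s) (*) (\<lambda>u. h u v)) \<and>
     (\<forall>u v. h v u = bar (h u v)) \<and>
     (\<forall>v. (\<forall>w. h v w = 0) \<longrightarrow> v = 0)"

definition orthogonal_group :: "('a::field^'n \<Rightarrow> 'a) \<Rightarrow> ('a^'n^'n) set" where
  "orthogonal_group Q = {g. invertible g \<and> (\<forall>v. Q (g *v v) = Q v)}"

definition unitary_group :: "('a::field^'n \<Rightarrow> 'a^'n \<Rightarrow> 'a) \<Rightarrow> ('a^'n^'n) set" where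
  "unitary_group h = {g. invertible g \<and> (\<forall>u v. h (g *v u) (g *v v) = h u v)}"

definition special_subgroup :: "('a::field^'n^'n) set \<Rightarrow> ('a^'n^'n) set" where
  "special_subgroup C = {g \<in> C. det g = 1}"


subsection \<open>Conjugacy classes and their splitting\<close>

definition conj_class :: "('a::field^'n^'n) set \<Rightarrow> 'a^'n^'n \<Rightarrow> ('a^'n^'n) set" where
  "conj_class G x = {g ** x ** matrix_inv g | g. g \<in> G}"

definition class_splits_into ::
    "('a::field^'n^'n) set \<Rightarrow> ('a^'n^'n) set \<Rightarrow> 'a^'n^'n \<Rightarrow> nat \<Rightarrow> bool" where
  "class_splits_into C S x r \<longleftrightarrow> card {conj_class S y | y. y \<in> conj_class C x} = r"


subsection \<open>Elementary divisors\<close>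

text \<open>The action of \<open>F[t]\<close> on column vectors in which \<open>t\<close> acts as \<open>x\<close>.\<close>

definition poly_act :: "'a::field^'n^'n \<Rightarrow> 'a poly \<Rightarrow> 'a^'n \<Rightarrow> 'a^'n" where
  "poly_act x f v = (\<Sum>i\<le>degree f. coeff f i *s (((*v) x ^^ i) v))"

definition cyclic_submodule :: "'a::field^'n^'n \<Rightarrow> 'a^'n \<Rightarrow> ('a^'n) set" where
  "cyclic_submodule x v = range (\<lambda>f. poly_act x f v)"

definition monic_irreducible :: "'a::field poly \<Rightarrow> bool" where
  "monic_irreducible f \<longleftrightarrow> lead_coeff f = 1 \<and> irreducible f"

text \<open>A list of pairs \<open>(v, d)\<close> describes an expression of the whole space as the internal
  direct sum of the cyclic submodules generated by the vectors \<open>v\<close>, where the annihilator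
  of \<open>v\<close> is the ideal generated by \<open>d\<close>, a positive power of a monic irreducible polynomial.\<close>

definition primary_cyclic_decomposition ::
    "'a::field^'n^'n \<Rightarrow> (('a^'n) \<times> 'a poly) list \<Rightarrow> bool" where
  "primary_cyclic_decomposition x vds \<longleftrightarrow>
     (\<forall>(v, d)\<in>set vds.
        (\<exists>p m. monic_irreducible p \<and> m > 0 \<and> d = p ^ m) \<and>
        (\<forall>f. poly_act x f v = 0 \<longleftrightarrow> d dvd f)) \<and>
     (\<forall>w. \<exists>!ws. list_all2 (\<lambda>u (v, d). u \<in> cyclic_submodule x v) ws vds \<and> w = sum_list ws)"

text \<open>The multiset of elementary divisors does not depend on the decomposition chosen.\<close>

definition elementary_divisors :: "'a::field^'n^'n \<Rightarrow> 'a poly multiset" where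
  "elementary_divisors x =
     mset (map snd (SOME vds. primary_cyclic_decomposition x vds))"


subsection \<open>Generalized elementary divisors\<close>

text \<open>\<open>reflect_poly f\<close> is \<open>t ^ degree f * f (1/t)\<close>; only meaningful for \<open>coeff f 0 \<noteq> 0\<close>.\<close>

definition dual_poly :: "('a::field \<Rightarrow> 'a) \<Rightarrow> 'a poly \<Rightarrow> 'a poly" where
  "dual_poly bar f = smult (inverse (bar (coeff f 0))) (map_poly bar (reflect_poly f))"

definition Phi1 :: "('a::field \<Rightarrow> 'a) \<Rightarrow> 'a poly set" where
  "Phi1 bar = {f. monic_irreducible f \<and> coeff f 0 \<noteq> 0 \<and> f = dual_poly bar f \<and> degree f = 1}"

definition Phi2_factor :: "('a::field \<Rightarrow> 'a) \<Rightarrow> 'a poly \<Rightarrow> 'a poly \<Rightarrow> bool" where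
  "Phi2_factor bar f g \<longleftrightarrow> monic_irreducible g \<and> coeff g 0 \<noteq> 0 \<and>
     g \<noteq> dual_poly bar g \<and> f = g * dual_poly bar g"

definition Phi2 :: "('a::field \<Rightarrow> 'a) \<Rightarrow> 'a poly set" where
  "Phi2 bar = {f. \<exists>g. Phi2_factor bar f g}"

definition Phi3 :: "('a::field \<Rightarrow> 'a) \<Rightarrow> 'a poly set" where
  "Phi3 bar = {f. monic_irreducible f \<and> coeff f 0 \<noteq> 0 \<and> f = dual_poly bar f \<and> degree f > 1}"

text \<open>The multiplicity of \<open>f ^ m\<close> as a generalized elementary divisor; it is 0 if
  \<open>f ^ m\<close> is not one. For \<open>f = g * dual_poly bar g\<close> in \<open>Phi2\<close>, the polynomial \<open>g\<close> is
  determined up to exchanging it with its dual, and for isometries both choices give the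
  same multiplicity.\<close>

definition gen_elementary_divisor_mult ::
    "('a::field \<Rightarrow> 'a) \<Rightarrow> 'a^'n^'n \<Rightarrow> 'a poly \<Rightarrow> nat \<Rightarrow> nat" where
  "gen_elementary_divisor_mult bar x f m =
     (if f \<in> Phi1 bar \<union> Phi3 bar then count (elementary_divisors x) (f ^ m)
      else if f \<in> Phi2 bar then count (elementary_divisors x) ((SOME g. Phi2_factor bar f g) ^ m)
      else 0)"

text \<open>The powers \<open>f i ^ m i\<close> for \<open>i = 1, \<dots>, k\<close> are the generalized elementary divisors
  of \<open>x\<close>, each listed with its multiplicity.\<close>

definition gen_elementary_divisors ::
    "('a::field \<Rightarrow> 'a) \<Rightarrow> 'a^'n^'n \<Rightarrow> nat \<Rightarrow> (nat \<Rightarrow> 'a poly) \<Rightarrow> (nat \<Rightarrow> nat) \<Rightarrow> bool" where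
  "gen_elementary_divisors bar x k f m \<longleftrightarrow>
     (\<forall>p e. card {i \<in> {1..k}. f i = p \<and> m i = e} = gen_elementary_divisor_mult bar x p e)"

end

theory Submission
  imports Defs "HOL-Library.FuncSet"
begin

text \<open>
  The group \<open>C\<close> permutes the \<open>S\<close>-classes inside the \<open>C\<close>-class of \<open>x\<close> transitively and \<open>S\<close> is the kernel of
  the determinant, so the number of these classes is \<open>|det C| / |det Z|\<close>, where \<open>Z\<close> is the centralizer of
  \<open>x\<close> in \<open>C\<close>; and \<open>det C\<close> is the case \<open>x = 1\<close> of \<open>det Z\<close>.

  Upper bound for \<open>det Z\<close>: by a Cayley transform, the determinant of a unitary \<open>g \<in> Z\<close> is
  \<open>det y / bar (det y)\<close> for some invertible \<open>y\<close> commuting with \<open>x\<close>. If \<open>R\<close> divides all exponents of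
  elementary divisors of \<open>x\<close>, then the subquotients \<open>ker p(x) \<inter> im p(x)^i\<close> come in blocks of \<open>R\<close> equal ones,
  so \<open>det y\<close> is an \<open>R\<close>-th power. In the orthogonal case the transform replaces \<open>g\<close> by an involution
  with the same determinant; on the part of the space where \<open>x\<^sup>2 - 1\<close> is invertible the
  skew-adjoint map \<open>x - x\<^sup>-\<^sup>1\<close> makes its determinant 1, and on the rest the argument above with \<open>R = 2\<close>
  applies.

  Lower bound: for an elementary divisor \<open>p ^ m\<close> there is a cyclic summand \<open>F[t]/(p ^ m)\<close> that is
  either non-degenerate or paired with a cyclic summand for the dual polynomial. A polynomial in
  \<open>x\<close> acting on it has determinant \<open>N(s) ^ m\<close>, and the norm from \<open>F[t]/(p)\<close> to \<open>F\<close> is onto.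
\<close>

section \<open>The ring of square matrices\<close>

text \<open>A Cayley transform fails at the eigenvalue 1 of \<open>g\<close>. In a finite ring some
  power of \<open>g - 1\<close> is idempotent, and it projects onto the part of the space where
  \<open>g - 1\<close> is invertible, along the part where it is nilpotent (Fitting). This splitting
  is orthogonal and \<open>g\<close> has determinant 1 on the second part, so the transform is made
  on the first part only. It is a polynomial in \<open>g\<close>, so it commutes with
  \<open>x\<close>: only the \<open>F[t]\<close>-module of \<open>x\<close> matters for its
  determinant, and the structure of the centralizer as a product of classical groups never enters.

  The number r arises as a quotient of two orders. The elements \<open>z ^ r / bar (z ^ r)\<close>
  are the \<open>(q - 1) r\<close>-th powers, a group of order \<open>(q + 1) / r\<close> if r
  divides q + 1; for \<open>x = 1\<close> the order is q + 1.

  The field \<open>F[t]/(p)\<close> appears only as a simple module of \<open>x\<close>, its norm as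
  a determinant. That this norm is onto is shown by a count as in the theorem of Chevalley and
  Warning, so no field extension is constructed.\<close>

text \<open>Multiplication on \<open>'a ^ 'n ^ 'n\<close> is componentwise, hence this copy of the type for the ring
  structure.\<close>

typedef ('a, 'n) sqmat = "UNIV :: ('a ^ 'n ^ 'n::finite) set"
  morphisms mat_of of_mat by simp

setup_lifting type_definition_sqmat

instantiation sqmat :: (field, finite) ring_1
begin

lift_definition zero_sqmat :: "('a, 'b) sqmat" is 0 .
lift_definition one_sqmat :: "('a, 'b) sqmat" is "mat 1" .
lift_definition plus_sqmat :: "('a, 'b) sqmat \<Rightarrow> ('a, 'b) sqmat \<Rightarrow> ('a, 'b) sqmat" is "(+)" .
lift_definition minus_sqmat :: "('a, 'b) sqmat \<Rightarrow> ('a, 'b) sqmat \<Rightarrow> ('a, 'b) sqmat" is "(-)" .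
lift_definition uminus_sqmat :: "('a, 'b) sqmat \<Rightarrow> ('a, 'b) sqmat" is "uminus" .
lift_definition times_sqmat :: "('a, 'b) sqmat \<Rightarrow> ('a, 'b) sqmat \<Rightarrow> ('a, 'b) sqmat" is "(**)" .

instance
proof
  fix a b c :: "('a, 'b) sqmat"
  show "a * b * c = a * (b * c)" by transfer (simp add: matrix_mul_assoc)
  show "(a + b) * c = a * c + b * c" by transfer (simp add: matrix_matrix_mult_def vec_eq_iff sum.distrib algebra_simps)
  show "a * (b + c) = a * b + a * c" by transfer (simp add: matrix_matrix_mult_def vec_eq_iff sum.distrib algebra_simps)
  show "(0::('a, 'b) sqmat) \<noteq> 1"
    by transfer (auto simp: vec_eq_iff mat_def)
qed (transfer, simp)+

end

lift_definition act :: "('a::field, 'n::finite) sqmat \<Rightarrow> 'a ^ 'n \<Rightarrow> 'a ^ 'n" (infixr "\<cdot>" 75) is "(*v)" .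
lift_definition dt :: "('a::field, 'n::finite) sqmat \<Rightarrow> 'a" is det .
lift_definition sc :: "'a::field \<Rightarrow> ('a, 'n::finite) sqmat" is mat .

lemma act_mult [simp]: "(a * b) \<cdot> v = a \<cdot> b \<cdot> v"
  by transfer (simp add: matrix_vector_mul_assoc)

lemma act_add_left [simp]: "(a + b) \<cdot> v = a \<cdot> v + b \<cdot> v"
  by transfer (simp add: matrix_vector_mult_add_rdistrib)

lemma act_diff_left [simp]: "(a - b) \<cdot> v = a \<cdot> v - b \<cdot> v"
  by transfer (simp add: matrix_vector_mult_diff_rdistrib)

lemma act_add [simp]: "a \<cdot> (v + w) = a \<cdot> v + a \<cdot> w"
  by transfer (simp add: matrix_vector_right_distrib)

lemma act_diff [simp]: "a \<cdot> (v - w) = a \<cdot> v - a \<cdot> w"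
  by transfer (simp add: matrix_vector_mult_diff_distrib)

lemma act_scale [simp]: "a \<cdot> (c *s v) = c *s (a \<cdot> v)"
  by transfer (simp add: vec.scale)

lemma act_one [simp]: "1 \<cdot> v = v"
  by transfer simp

lemma act_zero_left [simp]: "0 \<cdot> v = 0"
  by transfer simp

lemma act_zero [simp]: "a \<cdot> 0 = 0"
  by transfer simp

lemma act_uminus_left [simp]: "(- a) \<cdot> v = - (a \<cdot> v)"
  using act_diff_left[of 0 a v] by simp

lemma act_uminus [simp]: "a \<cdot> (- v) = - (a \<cdot> v)"
  using act_diff[of a 0 v] by simp

lemma act_sc [simp]: "sc c \<cdot> v = c *s v"
  by transfer (simp add: matrix_vector_mult_def mat_def vec_eq_iff if_distrib if_distribR
      cong: if_cong)

lemma sqmat_eqI: "(\<And>v. a \<cdot> v = b \<cdot> v) \<Longrightarrow> a = b"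
  by transfer (simp add: matrix_eq)

lemma linear_act: "Vector_Spaces.linear (*s) (*s) (\<lambda>v. a \<cdot> v)"
  by transfer (rule matrix_vector_mul_linear_gen)

lemma linear_obtains_sqmat:
  fixes f :: "'a::field ^ 'n \<Rightarrow> 'a ^ 'n::finite"
  assumes "Vector_Spaces.linear (*s) (*s) f"
  obtains a where "\<And>v. a \<cdot> v = f v"
proof
  show "of_mat (matrix f) \<cdot> v = f v" for v
    using assms by (simp add: act.rep_eq of_mat_inverse matrix_works)
qed

lemma sc_0 [simp]: "sc 0 = 0" and sc_1 [simp]: "sc 1 = 1"
  and sc_add: "sc (c + d) = sc c + sc d" and sc_mult: "sc (c * d) = sc c * sc d"
  and sc_uminus: "sc (- c) = - sc c"
  by (auto intro!: sqmat_eqI simp: vec_eq_iff algebra_simps)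

lemma sc_commute: "sc c * a = a * sc c"
  by (auto intro!: sqmat_eqI)

lemma dt_mult [simp]: "dt (a * b) = dt a * dt b"
  by transfer (rule det_mul)

lemma dt_one [simp]: "dt 1 = 1"
  by transfer simp

lemma dt_power [simp]: "dt (a ^ k) = dt a ^ k"
  by (induction k) auto

lemma mult_eq_1_commute: "a * b = 1 \<Longrightarrow> b * a = (1 :: ('a::field, 'n::finite) sqmat)"
  by transfer (simp add: matrix_left_right_inverse)

lemma dt_nonzero_iff: "dt a \<noteq> 0 \<longleftrightarrow> (\<exists>b. a * b = 1)"
  by transfer (simp add: invertible_right_inverse flip: invertible_det_nz)

lemma dt_nonzeroE:
  assumes "dt a \<noteq> 0"
  obtains b where "a * b = 1" "b * a = 1"
  using assms dt_nonzero_iff mult_eq_1_commute by blast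

lemma dt_nonzeroI: "a * b = 1 \<Longrightarrow> dt a \<noteq> 0" "b * a = 1 \<Longrightarrow> dt a \<noteq> 0"
  using dt_nonzero_iff mult_eq_1_commute by blast+

lemma inj_dt_nonzero:
  assumes "inj (\<lambda>v. a \<cdot> v)"
  shows "dt a \<noteq> 0"
  using assms unfolding inj_def
  by transfer (metis inj_def det_nz_iff_inj_gen matrix_of_matrix_vector_mul matrix_vector_mul_linear_gen)

lemma dt_conj:
  assumes "g * h = 1"
  shows "dt (h * a * g) = dt a"
proof -
  have "dt g * dt h = 1"
    using assms by (metis dt_mult dt_one)
  then show ?thesis
    by (simp add: mult.commute mult.left_commute)
qed

instance sqmat :: ("{finite, field}", finite) finite
proof
  have "finite (range (of_mat :: 'a ^ 'b ^ 'b \<Rightarrow> _))"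
    by simp
  moreover have "range of_mat = (UNIV :: ('a, 'b) sqmat set)"
    by (metis UNIV_eq_I mat_of_inverse rangeI)
  ultimately show "finite (UNIV :: ('a, 'b) sqmat set)"
    by simp
qed


section \<open>Determinants on subspaces\<close>

definition is_proj :: "('a::field, 'n::finite) sqmat \<Rightarrow> ('a ^ 'n) set \<Rightarrow> bool" where
  "is_proj P W \<longleftrightarrow> (\<forall>v. P \<cdot> v \<in> W) \<and> (\<forall>w\<in>W. P \<cdot> w = w)"

definition invar :: "('a::field, 'n::finite) sqmat \<Rightarrow> ('a ^ 'n) set \<Rightarrow> bool" where
  "invar a W \<longleftrightarrow> (\<forall>w\<in>W. a \<cdot> w \<in> W)"

text \<open>The determinant of \<open>a\<close> on the \<open>a\<close>-invariant subspace \<open>W\<close>; for these, the choice of the projection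
  does not matter.\<close>

definition subdet :: "('a::field, 'n::finite) sqmat \<Rightarrow> ('a ^ 'n) set \<Rightarrow> 'a" where
  "subdet a W = dt (1 + (a - 1) * (SOME P. is_proj P W))"

lemma ex_proj:
  assumes "vec.subspace W"
  shows "\<exists>P. is_proj P W"
proof -
  have "inj_on (\<lambda>v. v) W" "Vector_Spaces.linear (*s) (*s) (\<lambda>v::'a^'b. v)"
    using vec.linear_ident by auto
  from vec.linear_exists_left_inverse_on[OF this(2) assms this(1)]
  obtain g where g: "g ` UNIV \<subseteq> W" "Vector_Spaces.linear (*s) (*s) g" "\<forall>v\<in>W. g v = v"
    by blast
  obtain P where "\<And>v. P \<cdot> v = g v"
    using linear_obtains_sqmat[OF g(2)] by blast
  then show ?thesis
    using g unfolding is_proj_def by (intro exI[of _ P]) auto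
qed

lemma invarD: "invar a W \<Longrightarrow> w \<in> W \<Longrightarrow> a \<cdot> w \<in> W"
  by (simp add: invar_def)

lemma invar_diff_one:
  assumes "invar a W" "vec.subspace W"
  shows "invar (a - 1) W"
  using assms by (simp add: invar_def vec.subspace_diff)

text \<open>Two projections onto the same subspace are conjugate under \<open>u = 1 + (P' - P)\<close>,
  which fixes that subspace pointwise.\<close>

lemma dt_proj_unique:
  assumes P: "is_proj P W" and P': "is_proj P' W" and n: "invar n W"
  shows "dt (1 + n * P) = dt (1 + n * P')"
proof -
  have [simp]: "P \<cdot> P' \<cdot> v = P' \<cdot> v" "P' \<cdot> P \<cdot> v = P \<cdot> v" "P \<cdot> P \<cdot> v = P \<cdot> v" "P' \<cdot> P' \<cdot> v = P' \<cdot> v"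
    "P \<cdot> n \<cdot> P \<cdot> v = n \<cdot> P \<cdot> v" "P' \<cdot> n \<cdot> P \<cdot> v = n \<cdot> P \<cdot> v" 
    "P \<cdot> n \<cdot> P' \<cdot> v = n \<cdot> P' \<cdot> v" "P' \<cdot> n \<cdot> P' \<cdot> v = n \<cdot> P' \<cdot> v" for v
    using P P' n by (simp_all add: is_proj_def invar_def)
  define u w where "u = 1 + (P' - P)" and "w = 1 - (P' - P)"
  have "u * w = 1"
    unfolding u_def w_def by (rule sqmat_eqI) simp
  have "w * (1 + n * P) * u = 1 + n * P'"
    unfolding u_def w_def by (rule sqmat_eqI) simp
  then show ?thesis
    using dt_conj[OF \<open>u * w = 1\<close>] by metis
qed

lemma subdet_eq:
  assumes "is_proj P W" "invar a W" "vec.subspace W"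
  shows "subdet a W = dt (1 + (a - 1) * P)"
  unfolding subdet_def
  using dt_proj_unique[OF someI[of "\<lambda>P. is_proj P W"] assms(1) invar_diff_one] assms by blast

lemma subdet_UNIV: "subdet a UNIV = dt a"
proof -
  have "is_proj 1 (UNIV :: ('a^'b) set)"
    by (simp add: is_proj_def)
  then show ?thesis
    by (subst subdet_eq) (auto simp: invar_def)
qed

lemma subdet_trivial:
  assumes "vec.subspace W" "\<And>w. w \<in> W \<Longrightarrow> a \<cdot> w = w"
  shows "subdet a W = 1"
proof -
  obtain P where P: "is_proj P W"
    using ex_proj assms by blast
  have "1 + (a - 1) * P = 1"
    using P assms(2) by (auto intro!: sqmat_eqI simp: is_proj_def)
  then show ?thesis
    using subdet_eq[OF P _ assms(1)] assms(2) by (simp add: invar_def)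
qed

lemma subdet_mult:
  assumes W: "vec.subspace W" and a: "invar a W" and b: "invar b W"
  shows "subdet (a * b) W = subdet a W * subdet b W"
proof -
  obtain P where P: "is_proj P W"
    using ex_proj W by blast
  have ab: "invar (a * b) W"
    using a b by (auto simp: invar_def)
  have [simp]: "P \<cdot> P \<cdot> v = P \<cdot> v" "P \<cdot> b \<cdot> P \<cdot> v = b \<cdot> P \<cdot> v" for v
    using P b by (simp_all add: is_proj_def invar_def)
  have "1 + (a * b - 1) * P = (1 + (a - 1) * P) * (1 + (b - 1) * P)"
    by (rule sqmat_eqI) simp
  then show ?thesis
    using subdet_eq[OF P ab W] subdet_eq[OF P a W] subdet_eq[OF P b W] by simp
qed

lemma invar_one [simp]: "invar 1 W"
  by (simp add: invar_def)

lemma invar_mult: "invar a W \<Longrightarrow> invar b W \<Longrightarrow> invar (a * b) W"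
  by (simp add: invar_def)

lemma invar_power: "invar a W \<Longrightarrow> invar (a ^ k) W"
  by (induction k) (auto intro: invar_mult)

lemma subdet_power:
  assumes W: "vec.subspace W" and a: "invar a W"
  shows "subdet (a ^ k) W = subdet a W ^ k"
  using assms by (induction k) (auto simp: subdet_trivial subdet_mult invar_power)

text \<open>The image of a basis of \<open>W\<close> is independent, so the values of
  \<open>T\<close> on it extend to an injective, hence invertible map. This lets determinants on
  \<open>W\<close> and on \<open>T W\<close> be compared by conjugation.\<close>

lemma ex_iso_extension:
  fixes T :: "('a::field, 'n::finite) sqmat"
  assumes W: "vec.subspace W" and T: "inj_on (\<lambda>v. T \<cdot> v) W"
  obtains G H where "G * H = 1" "H * G = 1" "\<And>w. w \<in> W \<Longrightarrow> G \<cdot> w = T \<cdot> w"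
proof -
  obtain B where B: "B \<subseteq> W" "vec.independent B" "W \<subseteq> vec.span B"
    using vec.maximal_independent_subset by blast
  then have span: "vec.span B = W"
    using W by (simp add: vec.span_subspace)
  have "vec.independent ((\<lambda>v. T \<cdot> v) ` B)"
    using T span B(2) vec.linear_independent_injective_image[OF linear_act] by blast
  moreover have "inj_on (\<lambda>v. T \<cdot> v) B"
    using T B inj_on_subset by blast
  ultimately obtain g where g: "Vector_Spaces.linear (*s) (*s) g" "inj g" "\<forall>x\<in>B. g x = T \<cdot> x"
    using vec.linear_independent_extend_inj[OF B(2)] by meson
  obtain G where G: "\<And>v. G \<cdot> v = g v"
    using linear_obtains_sqmat[OF g(1)] by blast
  have "dt G \<noteq> 0"
    using g(2) by (intro inj_dt_nonzero) (simp add: G)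
  then obtain H where "G * H = 1" "H * G = 1"
    using dt_nonzeroE by blast
  moreover have "G \<cdot> w = T \<cdot> w" if "w \<in> W" for w
    using vec.linear_eq_on[OF g(1) linear_act, of w B T] g(3) that G span by simp
  ultimately show thesis
    using that by blast
qed

text \<open>In characteristic p, \<open>(1 + n) ^ p = 1 + p n = 1\<close>, so the determinant is a
  p-th root of unity; by injectivity of the Frobenius map, 1 is the only one.\<close>

lemma dt_one_plus_square_zero:
  fixes n :: "('a::{field, finite}, 'n::finite) sqmat"
  assumes "n * n = 0"
  shows "dt (1 + n) = 1"
proof -
  have p: "prime CHAR('a)"
    using finite_imp_CHAR_pos[OF finite] prime_CHAR_semidom by blast
  have "(1 + n) ^ k = 1 + of_nat k * n" for k
  proof (induction k)
    case (Suc k)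
    have "n * (of_nat k * n) = 0"
      using assms by (metis mult.assoc mult_of_nat_commute mult_zero_right)
    then show ?case
      using Suc by (simp add: algebra_simps)
  qed simp
  moreover have "of_nat CHAR('a) = (0 :: ('a, 'n) sqmat)"
  proof -
    have "of_nat k = sc (of_nat k)" for k
      by (induction k) (auto simp: sc_add)
    then show ?thesis by (metis of_nat_CHAR sc_0)
  qed
  ultimately have "dt (1 + n) ^ CHAR('a) = 1"
    by (metis add.right_neutral dt_one dt_power mult_zero_left)
  moreover have "(dt (1 + n) - 1 + 1) ^ CHAR('a) = (dt (1 + n) - 1) ^ CHAR('a) + 1 ^ CHAR('a)"
    by (rule freshmans_dream[OF p refl])
  ultimately have "(dt (1 + n) - 1) ^ CHAR('a) = 0"
    by simp
  then show ?thesis by simp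
qed

lemma subspace_ker: "vec.subspace {v. T \<cdot> v = 0}"
  by (auto simp: vec.subspace_def)

lemma subspace_image_act: "vec.subspace W \<Longrightarrow> vec.subspace ((\<lambda>v. T \<cdot> v) ` W)"
  using vec.linear_subspace_image[OF linear_act] by blast

lemma commutesD: "a * b = b * a \<Longrightarrow> a \<cdot> b \<cdot> v = b \<cdot> a \<cdot> v"
  by (metis act_mult)

text \<open>Multiplicativity of the determinant in the exact sequence 0 -> W \<inter> ker T -> W ->
  T W -> 0. The image \<open>T W\<close> stands for the quotient; since \<open>a\<close> commutes
  with \<open>T\<close>, it acts on both in the same way.\<close>

lemma subdet_ker_image:
  fixes a T :: "('a::{field, finite}, 'n::finite) sqmat"
  assumes W: "vec.subspace W" and a: "invar a W" and comm: "a * T = T * a"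
  shows "subdet a W = subdet a (W \<inter> {v. T \<cdot> v = 0}) * subdet a ((\<lambda>v. T \<cdot> v) ` W)"
proof -
  define K where "K = W \<inter> {v. T \<cdot> v = 0}"
  define M where "M = (\<lambda>v. T \<cdot> v) ` W"
  have K: "vec.subspace K" and M: "vec.subspace M"
    unfolding K_def M_def using W subspace_ker subspace_image_act
    by (auto intro: vec.subspace_inter)
  have aK: "invar a K" and aM: "invar a M"
  proof -
    have "T \<cdot> a \<cdot> w = 0" if "T \<cdot> w = 0" for w
      using that by (simp flip: commutesD[OF comm])
    then show "invar a K"
      using a by (simp add: K_def invar_def)
    have "a \<cdot> T \<cdot> w \<in> M" if "w \<in> W" for w
      using a that by (simp add: M_def invar_def commutesD[OF comm])
    then show "invar a M"
      by (auto simp: invar_def M_def)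
  qed
  obtain Pk Pw where Pk: "is_proj Pk K" and Pw: "is_proj Pw W"
    using ex_proj K W by meson
  \<comment> \<open>Projection onto a complement \<open>L\<close> of \<open>K\<close> in
    \<open>W\<close>.\<close>
  define Pl where "Pl = Pw - Pk * Pw"
  define L where "L = range (\<lambda>v. Pl \<cdot> v)"
  define n where "n = a - 1"
  have nK: "invar n K" and nW: "invar n W" and nM: "invar n M"
    unfolding n_def using aK a aM K W M by (auto intro: invar_diff_one)
  have KW: "K \<subseteq> W"
    by (auto simp: K_def)
  have PkV: "Pk \<cdot> v \<in> K" "Pk \<cdot> v \<in> W" for v
    using Pk KW by (auto simp: is_proj_def)
  have PwV: "Pw \<cdot> v \<in> W" for v
    using Pw by (auto simp: is_proj_def)
  have PlW: "Pl \<cdot> v \<in> W" for v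
    using PkV PwV W by (simp add: Pl_def vec.subspace_diff)
  have idem: "Pk \<cdot> Pk \<cdot> v = Pk \<cdot> v" "Pw \<cdot> Pk \<cdot> v = Pk \<cdot> v" "Pw \<cdot> Pw \<cdot> v = Pw \<cdot> v" for v
    using Pk Pw PkV PwV by (auto simp: is_proj_def)
  have kl: "Pk \<cdot> Pl \<cdot> v = 0" "Pl \<cdot> Pk \<cdot> v = 0" "Pl \<cdot> Pl \<cdot> v = Pl \<cdot> v" for v
    by (simp_all add: Pl_def idem)
  \<comment> \<open>Still a projection onto \<open>K\<close>, but now \<open>Pw\<close> is the sum
    of the two orthogonal idempotents \<open>Pk'\<close> and \<open>Pl\<close>.\<close>
  define Pk' where "Pk' = Pk * Pw"
  have Pk': "is_proj Pk' K"
    using Pk Pw KW by (auto simp: is_proj_def Pk'_def)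
  have k'l: "Pk' \<cdot> Pl \<cdot> v = 0" "Pl \<cdot> Pk' \<cdot> v = 0" "Pk' \<cdot> Pk' \<cdot> v = Pk' \<cdot> v" for v
    using kl by (auto simp: Pk'_def idem Pl_def)
  have PwS: "Pw = Pk' + Pl"
    by (simp add: Pk'_def Pl_def)
  have nPk: "n \<cdot> Pk' \<cdot> v = Pk' \<cdot> n \<cdot> Pk' \<cdot> v" for v
    using nK Pk' by (simp add: is_proj_def invar_def)
  have nPl: "n \<cdot> Pl \<cdot> v = Pk' \<cdot> n \<cdot> Pl \<cdot> v + Pl \<cdot> n \<cdot> Pl \<cdot> v" for v
  proof -
    have "n \<cdot> Pl \<cdot> v \<in> W"
      using nW PlW by (simp add: invar_def)
    then show ?thesis
      using Pw by (metis PwS act_add_left is_proj_def)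
  qed
  \<comment> \<open>Block triangular factorization with respect to \<open>K\<close> and
    \<open>L\<close>: the block on \<open>L\<close>, a unipotent factor from \<open>L\<close> to
    \<open>K\<close>, the block on \<open>K\<close>.\<close>
  have fact: "1 + n * Pw = (1 + Pl * n * Pl) * (1 + Pk' * n * Pl) * (1 + n * Pk')"
    unfolding PwS
  proof (rule sqmat_eqI)
    fix v
    have 1: "Pl \<cdot> n \<cdot> Pk' \<cdot> v = 0" "Pk' \<cdot> n \<cdot> Pk' \<cdot> v = n \<cdot> Pk' \<cdot> v"
      by (metis nPk k'l(2)) (simp add: nPk[symmetric])
    have 2: "Pl \<cdot> n \<cdot> Pk' \<cdot> w = 0" for w
      by (metis nPk k'l(2))
    have 3: "Pl \<cdot> n \<cdot> Pl \<cdot> n \<cdot> Pk' \<cdot> v = 0"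
      by (simp add: 2)
    show "(1 + n * (Pk' + Pl)) \<cdot> v = ((1 + Pl * n * Pl) * (1 + Pk' * n * Pl) * (1 + n * Pk')) \<cdot> v"
      using nPl[of v] by (simp add: 1 2 3 k'l add.commute)
  qed
  have "dt (1 + Pk' * n * Pl) = 1"
    by (intro dt_one_plus_square_zero sqmat_eqI) (simp add: k'l)
  then have det1: "dt (1 + n * Pw) = dt (1 + Pl * n * Pl) * dt (1 + n * Pk')"
    by (simp add: fact)
  have L: "vec.subspace L"
    unfolding L_def by (intro subspace_image_act) simp
  have PlL: "Pl \<cdot> w = w" if "w \<in> L" for w
    using that by (auto simp: L_def kl)
  have Tk: "T \<cdot> Pk' \<cdot> v = 0" for v
    using Pk' by (auto simp: is_proj_def K_def)
  have injT: "inj_on (\<lambda>v. T \<cdot> v) L"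
  proof (rule inj_onI)
    fix v w assume vw: "v \<in> L" "w \<in> L" "T \<cdot> v = T \<cdot> w"
    then have "v - w \<in> L"
      using L by (simp add: vec.subspace_diff)
    moreover have "v - w \<in> W"
      using \<open>v - w \<in> L\<close> PlW by (auto simp: L_def)
    ultimately have "v - w \<in> K"
      using vw by (simp add: K_def)
    then have "Pk \<cdot> (v - w) = v - w"
      using Pk unfolding is_proj_def by blast
    then have "v - w = 0"
      using \<open>v - w \<in> L\<close> kl(1) by (metis PlL)
    then show "v = w" by simp
  qed
  obtain G H where GH: "G * H = 1" "H * G = 1" "\<And>w. w \<in> L \<Longrightarrow> G \<cdot> w = T \<cdot> w"
    using ex_iso_extension[OF L injT] by blast
  have GPl: "G \<cdot> Pl \<cdot> v = T \<cdot> Pl \<cdot> v" for v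
    using GH(3) by (simp add: L_def)
  have HG: "H \<cdot> G \<cdot> v = v" "G \<cdot> H \<cdot> v = v" for v
    using GH by (metis act_mult act_one)+
  define Q where "Q = G * Pl * H"
  have Q: "is_proj Q M"
    unfolding is_proj_def
  proof (intro conjI allI ballI)
    show "Q \<cdot> v \<in> M" for v
      using PlW by (simp add: Q_def M_def GPl)
    fix w assume "w \<in> M"
    then obtain w' where w': "w' \<in> W" "w = T \<cdot> w'"
      by (auto simp: M_def)
    have "w' = Pk' \<cdot> w' + Pl \<cdot> w'"
      using w' Pw by (metis PwS act_add_left is_proj_def)
    then have "w = T \<cdot> Pk' \<cdot> w' + T \<cdot> Pl \<cdot> w'"
      using w' by (metis act_add)
    then have "w = T \<cdot> Pl \<cdot> w'"
      by (simp add: Tk)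
    then have "w = G \<cdot> Pl \<cdot> w'"
      by (simp add: GPl)
    then show "Q \<cdot> w = w"
      by (simp add: Q_def HG kl)
  qed
  have nT: "n * T = T * n"
    using comm by (simp add: n_def algebra_simps)
  have "H * (1 + n * Q) * G = 1 + Pl * n * Pl"
  proof (rule sqmat_eqI)
    fix v
    have "H \<cdot> n \<cdot> G \<cdot> Pl \<cdot> v = H \<cdot> T \<cdot> n \<cdot> Pl \<cdot> v"
      by (simp add: GPl commutesD[OF nT])
    also have "\<dots> = H \<cdot> T \<cdot> Pl \<cdot> n \<cdot> Pl \<cdot> v"
      by (subst nPl) (simp add: Tk)
    also have "\<dots> = Pl \<cdot> n \<cdot> Pl \<cdot> v"
      by (simp add: HG flip: GPl)
    finally show "(H * (1 + n * Q) * G) \<cdot> v = (1 + Pl * n * Pl) \<cdot> v"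
      by (simp add: Q_def HG)
  qed
  then have "dt (1 + Pl * n * Pl) = dt (1 + n * Q)"
    using dt_conj[OF GH(1)] by metis
  then show ?thesis
    using det1 subdet_eq[OF Pw a W] subdet_eq[OF Pk' aK K] subdet_eq[OF Q aM M]
    unfolding n_def K_def M_def by simp
qed

section \<open>Polynomials in a matrix\<close>

text \<open>Horner evaluation at an element of a non-commutative ring, where \<open>poly\<close>
  does not apply.\<close>

definition pe :: "('a::field, 'n::finite) sqmat \<Rightarrow> 'a poly \<Rightarrow> ('a, 'n) sqmat" where
  "pe x f = fold_coeffs (\<lambda>c a. sc c + x * a) f 0"

lemma pe_0 [simp]: "pe x 0 = 0"
  by (simp add: pe_def)

lemma pe_pCons [simp]: "pe x (pCons c f) = sc c + x * pe x f"
  by (cases "c = 0 \<and> f = 0") (auto simp: pe_def)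

lemma pe_1 [simp]: "pe x 1 = 1"
  using pe_pCons[of x 1 0] by (simp only: one_pCons[symmetric]) simp

lemma pe_add: "pe x (f + g) = pe x f + pe x g"
proof (induction f arbitrary: g)
  case (pCons c f)
  obtain b h where g: "g = pCons b h"
    by (cases g)
  show ?case
    unfolding g add_pCons pe_pCons pCons.IH sc_add distrib_left by simp
qed simp

lemma pe_smult: "pe x (smult c f) = sc c * pe x f"
proof (induction f)
  case (pCons b f)
  have "x * (sc c * pe x f) = sc c * (x * pe x f)"
    by (metis mult.assoc sc_commute)
  then show ?case
    by (simp add: pCons sc_mult distrib_left)
qed simp

lemma pe_uminus: "pe x (- f) = - pe x f"
  using pe_smult[of x "-1" f] by (simp add: sc_uminus[of 1])

lemma pe_diff: "pe x (f - g) = pe x f - pe x g"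
  using pe_add[of x f "- g"] by (simp add: pe_uminus)

lemma pe_mult: "pe x (f * g) = pe x f * pe x g"
  by (induction f) (simp_all add: pe_add pe_smult distrib_right mult.assoc)

lemma pe_power: "pe x (f ^ k) = pe x f ^ k"
  by (induction k) (auto simp: pe_mult)

lemma pe_monom: "pe x (monom c k) = sc c * x ^ k"
proof (induction k)
  case (Suc k)
  have "x * (sc c * x ^ k) = sc c * (x * x ^ k)"
    by (metis mult.assoc sc_commute)
  then show ?case
    using Suc by (simp add: monom_Suc)
qed (simp add: monom_0)

lemma pe_sum: "pe x (\<Sum>i\<in>I. f i) = (\<Sum>i\<in>I. pe x (f i))"
  by (induction I rule: infinite_finite_induct) (auto simp: pe_add)

lemma pe_commute: "a * x = x * a \<Longrightarrow> a * pe x f = pe x f * a"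
proof (induction f)
  case (pCons c f)
  have "a * (x * pe x f) = x * pe x f * a"
    using pCons by (metis mult.assoc)
  then show ?case
    by (simp add: distrib_left distrib_right sc_commute[symmetric])
qed simp

lemma pe_commute_pe: "pe x f * pe x g = pe x g * pe x f"
  by (metis mult.commute pe_mult)

lemma pe_eq_sum: "pe x f = (\<Sum>i\<le>degree f. sc (coeff f i) * x ^ i)"
proof -
  have "pe x f = pe x (\<Sum>i\<le>degree f. monom (coeff f i) i)"
    by (simp add: poly_as_sum_of_monoms)
  then show ?thesis
    by (simp add: pe_sum pe_monom)
qed

lemma invar_pe: "vec.subspace W \<Longrightarrow> invar x W \<Longrightarrow> invar (pe x f) W"
  by (induction f) (auto simp: invar_def vec.subspace_0 vec.subspace_add vec.subspace_scale)

lemma pe_act_commute: "pe x f \<cdot> pe x g \<cdot> v = pe x g \<cdot> pe x f \<cdot> v"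
  by (metis act_mult pe_commute_pe)

text \<open>By division with remainder, a nonzero element of least degree in the ideal of
  \<open>p\<close> and \<open>g\<close> divides both. It is a unit, since otherwise it would be an
  associate of \<open>p\<close>, and \<open>p\<close> would divide \<open>g\<close>.\<close>

lemma ex_bezout:
  fixes p g :: "'a::field poly"
  assumes "irreducible p" "\<not> p dvd g"
  shows "\<exists>s t. s * p + t * g = 1"
proof -
  define P where "P d \<longleftrightarrow> d \<noteq> 0 \<and> (\<exists>s t. d = s * p + t * g)" for d
  have "P p"
  proof -
    have "p = 1 * p + 0 * g" "p \<noteq> 0"
      using assms(1) by auto
    then show ?thesis
      unfolding P_def by blast
  qed
  then obtain d where d: "P d" and min: "\<And>d'. P d' \<Longrightarrow> degree d \<le> degree d'"
    using ex_has_least_nat[of P p degree] by blast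
  obtain s t where st: "d = s * p + t * g" and d0: "d \<noteq> 0"
    using d by (auto simp: P_def)
  have dvd: "d dvd f" if f: "f = s' * p + t' * g" for f s' t'
  proof (rule ccontr)
    assume "\<not> d dvd f"
    then have "f mod d \<noteq> 0"
      by (simp add: dvd_eq_mod_eq_0)
    moreover have "f mod d = (s' - f div d * s) * p + (t' - f div d * t) * g"
      using f st by (simp add: minus_div_mult_eq_mod[symmetric] algebra_simps)
    ultimately have "degree d \<le> degree (f mod d)"
      using min by (auto simp: P_def)
    then show False
      using degree_mod_less[OF d0, of f] \<open>f mod d \<noteq> 0\<close> by auto
  qed
  have "d dvd p" "d dvd g"
    using dvd[of p 1 0] dvd[of g 0 1] by auto
  then have "d dvd 1"
    using assms by (metis dvd_trans irreducible_altdef)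
  then obtain c where "1 = d * c"
    by (auto elim: dvdE)
  then have "(c * s) * p + (c * t) * g = 1"
    using st by (simp add: algebra_simps)
  then show ?thesis by blast
qed

lemma monic_irreducible_dvd_eq:
  assumes "monic_irreducible p" "monic_irreducible r" "p dvd r"
  shows "p = r"
proof -
  obtain c where c: "r = p * c"
    using assms(3) by (auto elim: dvdE)
  have "\<not> p dvd 1"
    using assms(1) by (auto simp: monic_irreducible_def irreducible_def)
  then have "c dvd 1"
    using irreducibleD[of r p c] c assms(2) by (auto simp: monic_irreducible_def)
  then obtain k where k: "c = [:k:]"
    by (metis is_unit_poly_iff)
  have "lead_coeff r = lead_coeff p * k"
    by (simp add: c k lead_coeff_mult)
  then have "k = 1"
    using assms by (simp add: monic_irreducible_def)
  then show ?thesis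
    by (simp add: c k one_pCons)
qed

lemma prime_elem_monic_irreducible: "monic_irreducible p \<Longrightarrow> prime_elem p"
  by (simp add: monic_irreducible_def field_poly_irreducible_imp_prime)

lemma degree_monic_irreducible: "monic_irreducible p \<Longrightarrow> degree p > 0"
  unfolding monic_irreducible_def
  by (metis gr0I irreducible_not_unit is_unit_iff_degree not_irreducible_zero)

lemma ex_bezout_power:
  fixes p g :: "'a::field poly"
  assumes "irreducible p" "\<not> p dvd g"
  shows "\<exists>s t. s * p ^ i + t * g = 1"
proof (induction i)
  case (Suc i)
  then obtain s' t' where "s' * p ^ i + t' * g = 1" by blast
  moreover obtain s t where "s * p + t * g = 1"
    using ex_bezout[OF assms] by blast
  ultimately have "(s' * p ^ i + t' * g) * (s * p + t * g) = 1"
    by simp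
  then have "(s' * s) * p ^ Suc i + (t' * (s * p + t * g) + s' * p ^ i * t) * g = 1"
    by (simp add: algebra_simps)
  then show ?case by blast
next
  case 0
  have "1 * p ^ 0 + 0 * g = 1" by simp
  then show ?case by blast
qed

lemma ex_bezout_powers:
  fixes p r :: "'a::field poly"
  assumes "monic_irreducible p" "monic_irreducible r" "p \<noteq> r"
  shows "\<exists>s t. s * p ^ i + t * r ^ j = 1"
proof (rule ex_bezout_power)
  show "\<not> p dvd r ^ j"
    using assms monic_irreducible_dvd_eq prime_elem_monic_irreducible prime_elem_dvd_power by metis
qed (use assms in \<open>simp add: monic_irreducible_def\<close>)

text \<open>Pigeonhole in a finite ring. Annihilating polynomials, idempotent powers and inverses
  that are powers all come from it.\<close>

lemma ex_power_eq:
  fixes T :: "('a::{field, finite}, 'n::finite) sqmat"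
  obtains i j :: nat where "i < j" "T ^ i = T ^ j"
proof -
  have "\<not> inj (\<lambda>k::nat. T ^ k)"
    using finite_imageD[of "\<lambda>k::nat. T ^ k" UNIV] infinite_UNIV_nat finite by blast
  then show thesis
    using that unfolding inj_def by (metis linorder_neqE_nat)
qed

lemma ex_annihilator:
  fixes x :: "('a::{field, finite}, 'n::finite) sqmat"
  shows "\<exists>f. f \<noteq> 0 \<and> pe x f = 0"
proof -
  obtain i j where ij: "i < j" "x ^ i = x ^ j"
    by (rule ex_power_eq)
  have "monom (1::'a) i - monom 1 j \<noteq> 0"
    using ij by (simp add: poly_eq_iff) (metis one_neq_zero)
  moreover have "pe x (monom 1 i - monom 1 j) = 0"
    using ij by (simp add: pe_diff pe_monom)
  ultimately show ?thesis by blast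
qed

text \<open>Take a polynomial of least degree that kills some nonzero vector of \<open>W\<close>. If
  it is \<open>a * b\<close>, then either \<open>b\<close> kills this vector or \<open>a\<close>
  kills its nonzero image under \<open>b\<close>, so one factor has the full degree.\<close>

lemma ex_irreducible_ker:
  fixes x :: "('a::{field, finite}, 'n::finite) sqmat"
  assumes W: "vec.subspace W" "invar x W" and w: "w \<in> W" "w \<noteq> 0"
  obtains p w' where "monic_irreducible p" "w' \<in> W" "w' \<noteq> 0" "pe x p \<cdot> w' = 0"
proof -
  define P where "P f \<longleftrightarrow> f \<noteq> 0 \<and> (\<exists>w'\<in>W. w' \<noteq> 0 \<and> pe x f \<cdot> w' = 0)" for f
  obtain f0 where "f0 \<noteq> 0" "pe x f0 = 0"
    using ex_annihilator by blast
  then have "P f0"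
    using w by (auto simp: P_def)
  then obtain f where f: "P f" and min: "\<And>g. P g \<Longrightarrow> degree f \<le> degree g"
    using ex_has_least_nat[of P f0 degree] by blast
  obtain w' where w': "w' \<in> W" "w' \<noteq> 0" "pe x f \<cdot> w' = 0" and f0: "f \<noteq> 0"
    using f by (auto simp: P_def)
  have irr: "irreducible f"
  proof (rule irreducibleI)
    show "\<not> f dvd 1"
    proof
      assume "f dvd 1"
      then obtain c where "1 = c * f"
        by (metis dvdE mult.commute)
      then have "1 = pe x c * pe x f"
        by (metis pe_1 pe_mult)
      then have "w' = pe x c \<cdot> pe x f \<cdot> w'"
        by (metis act_mult act_one)
      then show False using w' by simp
    qed
    fix a b assume ab: "f = a * b"
    then have nz: "a \<noteq> 0" "b \<noteq> 0" and deg: "degree f = degree a + degree b"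
      using f0 by (auto simp: degree_mult_eq)
    show "a dvd 1 \<or> b dvd 1"
    proof (cases "pe x b \<cdot> w' = 0")
      case True
      then have "P b"
        using nz w' by (auto simp: P_def)
      then have "degree a = 0"
        using min deg by fastforce
      then show ?thesis
        using nz is_unit_iff_degree by blast
    next
      case False
      moreover have "pe x b \<cdot> w' \<in> W"
        using invar_pe W w' invarD by blast
      moreover have "pe x a \<cdot> pe x b \<cdot> w' = 0"
        using w' by (simp add: ab pe_mult)
      ultimately have "P a"
        using nz by (auto simp: P_def)
      then have "degree b = 0"
        using min deg by fastforce
      then show ?thesis
        using nz is_unit_iff_degree by blast
    qed
  qed (use f0 in auto)
  define p where "p = smult (inverse (lead_coeff f)) f"
  have "monic_irreducible p"
  proof -
    have "p = [:inverse (lead_coeff f):] * f" "is_unit [:inverse (lead_coeff f):]"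
      using f0 by (simp_all add: p_def is_unit_triv)
    then have "irreducible p"
      using irr by (metis irreducible_mult_unit_left)
    then show ?thesis
      using f0 by (simp add: p_def monic_irreducible_def)
  qed
  moreover have "pe x p \<cdot> w' = 0"
    using w' by (simp add: p_def pe_smult)
  ultimately show thesis
    using that w' by blast
qed


section \<open>Determinants in the centralizer of a matrix\<close>

lemma invar_image:
  assumes "invar a W" "a * T = T * a"
  shows "invar a ((\<lambda>v. T \<cdot> v) ` W)"
proof -
  have "a \<cdot> T \<cdot> w \<in> (\<lambda>v. T \<cdot> v) ` W" if "w \<in> W" for w
    using assms(1) that by (simp add: invar_def commutesD[OF assms(2)])
  then show ?thesis
    by (auto simp: invar_def)
qed

lemma power_commute: "a * T = T * a \<Longrightarrow> a * T ^ i = T ^ i * (a :: 'b::monoid_mult)"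
  by (metis power_commuting_commutes)

text \<open>By hypothesis the vectors of \<open>W\<close> killed by \<open>T\<close> lie in each of
  the first \<open>R\<close> images \<open>T ^ i W\<close>. So \<open>T\<close> has the same kernel
  on all of these, and each step to the next image splits off the same determinant.\<close>

lemma subdet_ker_power:
  fixes a T :: "('a::{field, finite}, 'n::finite) sqmat"
  assumes W: "vec.subspace W" and a: "invar a W" and T: "invar T W" and comm: "a * T = T * a"
    and ker: "\<And>i. i < R \<Longrightarrow> W \<inter> {v. T \<cdot> v = 0} \<subseteq> (\<lambda>v. (T ^ i) \<cdot> v) ` W"
  shows "subdet a W = subdet a (W \<inter> {v. T \<cdot> v = 0}) ^ R * subdet a ((\<lambda>v. (T ^ R) \<cdot> v) ` W)"
  using ker
proof (induction R)
  case (Suc R)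
  let ?W = "(\<lambda>v. (T ^ R) \<cdot> v) ` W"
  have "?W \<subseteq> W"
    using invar_power[OF T] by (auto simp: invar_def)
  then have "?W \<inter> {v. T \<cdot> v = 0} = W \<inter> {v. T \<cdot> v = 0}"
    using Suc.prems[of R] by auto
  moreover have "(\<lambda>v. T \<cdot> v) ` ?W = (\<lambda>v. (T ^ Suc R) \<cdot> v) ` W"
    by (simp add: image_image)
  moreover have "subdet a ?W = subdet a (?W \<inter> {v. T \<cdot> v = 0}) * subdet a ((\<lambda>v. T \<cdot> v) ` ?W)"
    using W a comm by (intro subdet_ker_image subspace_image_act invar_image power_commute)
  ultimately show ?case
    using Suc by simp
qed simp

text \<open>The last hypothesis says that \<open>x\<close> has no elementary divisor
  \<open>p ^ e\<close> on \<open>W\<close> unless \<open>R\<close> divides \<open>e\<close>. Passing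
  to \<open>p(x) ^ R W\<close> splits off \<open>R\<close> equal determinants and lowers the
  exponents for \<open>p\<close> by \<open>R\<close>. The clause on \<open>k\<close> holds because
  \<open>z\<close> is a product of determinants of \<open>y\<close> on invariant subspaces; for
  \<open>R = k = 2\<close> it yields determinant 1 for involutions.\<close>

lemma subdet_is_power:
  fixes x y :: "('a::{field, finite}, 'n::finite) sqmat"
  assumes xy: "y * x = x * y" and "R > 0"
    and "vec.subspace W" "invar x W" "invar y W"
    and "\<And>p e w. monic_irreducible p \<Longrightarrow> \<not> R dvd e \<Longrightarrow> pe x p \<cdot> w = 0 \<Longrightarrow>
      w \<in> (\<lambda>v. (pe x p ^ (e - 1)) \<cdot> v) ` W \<Longrightarrow> w \<in> (\<lambda>v. (pe x p ^ e) \<cdot> v) ` W"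
  shows "\<exists>z. subdet y W = z ^ R \<and> (\<forall>k. y ^ k = 1 \<longrightarrow> z ^ k = 1)"
  using assms(3-)
proof (induction "card W" arbitrary: W rule: less_induct)
  case (less W)
  note W = less.prems(1-3) and cond = less.prems(4)
  show ?case
  proof (cases "\<exists>w\<in>W. w \<noteq> 0")
    case False
    then have "subdet y W = 1"
      using W by (intro subdet_trivial) auto
    then show ?thesis
      by (intro exI[of _ 1]) auto
  next
    case True
    then obtain p u where p: "monic_irreducible p" and u: "u \<in> W" "u \<noteq> 0" "pe x p \<cdot> u = 0"
      using ex_irreducible_ker W by metis
    define T where "T = pe x p"
    have yT: "y * T = T * y" and xT: "x * T = T * x"
      unfolding T_def using pe_commute xy by metis+
    have TW: "invar T W"
      using W invar_pe unfolding T_def by blast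
    define W' where "W' = (\<lambda>v. (T ^ R) \<cdot> v) ` W"
    have sub: "W' \<subseteq> W"
      using invar_power[OF TW] by (auto simp: W'_def invar_def)
    have W': "vec.subspace W'" "invar x W'" "invar y W'"
      unfolding W'_def using W xT yT
      by (auto intro!: subspace_image_act invar_image power_commute)
    have ker: "W \<inter> {v. T \<cdot> v = 0} \<subseteq> (\<lambda>v. (T ^ i) \<cdot> v) ` W" if "i < R" for i
      using that
    proof (induction i)
      case (Suc i)
      have "\<not> R dvd Suc i"
        using Suc.prems by (auto dest: dvd_imp_le)
      then show ?case
        using Suc cond[OF p, of "Suc i"] unfolding T_def by auto
    qed auto
    have step: "subdet y W = subdet y (W \<inter> {v. T \<cdot> v = 0}) ^ R * subdet y W'"
      unfolding W'_def using ker by (intro subdet_ker_power W yT TW) auto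
    have TRu: "(T ^ R) \<cdot> u = 0"
      using \<open>R > 0\<close> u by (cases R) (auto simp: T_def power_Suc2 simp del: power_Suc)
    have "card W' < card W"
    proof -
      have "W' \<noteq> W"
      proof
        assume "W' = W"
        then have "inj_on (\<lambda>v. (T ^ R) \<cdot> v) W"
          unfolding W'_def by (intro eq_card_imp_inj_on) auto
        then have "u = 0"
          using TRu u(1) vec.subspace_0[OF W(1)] by (metis act_zero inj_onD)
        then show False using u by simp
      qed
      then show ?thesis
        using sub by (intro psubset_card_mono) auto
    qed
    moreover have "w \<in> (\<lambda>v. (pe x r ^ e) \<cdot> v) ` W'"
      if r: "monic_irreducible r" and e: "\<not> R dvd e" and w0: "pe x r \<cdot> w = 0"
        and w: "w \<in> (\<lambda>v. (pe x r ^ (e - 1)) \<cdot> v) ` W'" for r e w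
    proof (cases "r = p")
      case True
      have "e > 0" using e by (cases e) auto
      obtain w' where w': "w' \<in> W" "w = (T ^ (e - 1)) \<cdot> (T ^ R) \<cdot> w'"
        using w True by (auto simp: W'_def T_def)
      then have "w = (T ^ (e + R - 1)) \<cdot> w'"
        using \<open>e > 0\<close> by (simp flip: act_mult power_add)
      then have "w \<in> (\<lambda>v. (pe x p ^ (e + R)) \<cdot> v) ` W"
        using cond[OF p, of "e + R" w] e w0 w' True by (auto simp: T_def)
      then show ?thesis
        by (auto simp: True W'_def T_def power_add)
    next
      case False
      then obtain s t where st: "s * p ^ R + t * r ^ 1 = 1"
        using ex_bezout_powers p r by metis
      have "w \<in> (\<lambda>v. (pe x r ^ (e - 1)) \<cdot> v) ` W"
        using w sub by auto
      then obtain w' where w': "w' \<in> W" "w = (pe x r ^ e) \<cdot> w'"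
        using cond[OF r e w0] by blast
      \<comment> \<open>On the kernel of \<open>r(x)\<close> the map \<open>p(x) ^ R\<close> is
        inverted by \<open>s(x)\<close>, so divisibility by \<open>r(x) ^ e\<close> in
        \<open>W\<close> carries over to \<open>W'\<close>.\<close>
      have "pe x (s * p ^ R + t * r ^ 1) \<cdot> w = w"
        by (simp only: st pe_1 act_one)
      then have "w = pe x s \<cdot> (T ^ R) \<cdot> w"
        by (simp add: pe_add pe_mult pe_power w0 T_def)
      also have "\<dots> = pe x (s * p ^ R * r ^ e) \<cdot> w'"
        by (simp add: w' pe_mult pe_power T_def)
      also have "\<dots> = pe x (r ^ e * p ^ R * s) \<cdot> w'"
        by (simp add: mult_ac)
      also have "\<dots> = (pe x r ^ e) \<cdot> (T ^ R) \<cdot> pe x s \<cdot> w'"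
        by (simp add: pe_mult pe_power T_def)
      finally show ?thesis
        using w' W invar_pe[of W x s] by (auto simp: W'_def invar_def)
    qed
    ultimately obtain z where z: "subdet y W' = z ^ R" "\<And>k. y ^ k = 1 \<Longrightarrow> z ^ k = 1"
      using less.hyps W' by meson
    define z' where "z' = subdet y (W \<inter> {v. T \<cdot> v = 0})"
    have K: "vec.subspace (W \<inter> {v. T \<cdot> v = 0})" "invar y (W \<inter> {v. T \<cdot> v = 0})"
    proof -
      show "vec.subspace (W \<inter> {v. T \<cdot> v = 0})"
        using W subspace_ker by (auto intro: vec.subspace_inter)
      have "T \<cdot> y \<cdot> w = 0" if "T \<cdot> w = 0" for w
        using that by (simp flip: commutesD[OF yT])
      then show "invar y (W \<inter> {v. T \<cdot> v = 0})"
        using W by (simp add: invar_def)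
    qed
    have "z' ^ k = 1" if "y ^ k = 1" for k
      using subdet_power[OF K, of k] that K by (simp add: z'_def subdet_trivial)
    then have "subdet y W = (z' * z) ^ R" "\<forall>k. y ^ k = 1 \<longrightarrow> (z' * z) ^ k = 1"
      using step z by (auto simp: z'_def power_mult_distrib)
    then show ?thesis by blast
  qed
qed

section \<open>Power sums and power maps in finite fields\<close>

lemma finite_field_power_card_minus_one:
  fixes c :: "'a::{field, finite}"
  assumes "c \<noteq> 0"
  shows "c ^ (CARD('a) - 1) = 1"
proof -
  have "(\<Prod>y\<in>UNIV-{0}. c * y) = (\<Prod>y\<in>UNIV-{0}. y)"
    by (rule prod.reindex_bij_witness[of _ "\<lambda>y. y / c" "\<lambda>y. c * y"]) (use assms in auto)
  then have "c ^ card (UNIV - {0::'a}) * \<Prod>(UNIV-{0}) = \<Prod>(UNIV-{0::'a})"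
    by (simp add: prod.distrib)
  then show ?thesis
    by (simp add: card_Diff_singleton prod_zero_iff)
qed

lemma finite_field_power_card:
  fixes c :: "'a::{field, finite}"
  shows "c ^ CARD('a) = c"
proof (cases "c = 0")
  case False
  have "c * c ^ (CARD('a) - 1) = c ^ CARD('a)"
    by (simp flip: power_Suc)
  then show ?thesis
    using finite_field_power_card_minus_one[OF False] by simp
qed simp

lemma card_power_eq_le:
  fixes b :: "'a::{field, finite}"
  assumes "n > 0"
  shows "card {c. c ^ n = b} \<le> n"
proof -
  define f where "f = monom 1 n - [:b:]"
  have deg: "degree f = n"
    unfolding f_def using assms by (subst diff_conv_add_uminus, subst degree_add_eq_left)
      (auto simp: degree_monom_eq)
  then have "f \<noteq> 0"
    using assms by auto
  then have "card {c. poly f c = 0} \<le> n"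
    using card_poly_roots_bound[of f] deg by simp
  then show ?thesis
    by (simp add: f_def poly_monom)
qed

lemma one_less_card_field: "1 < CARD('a::{field, finite})"
proof -
  have "card {0, 1::'a} \<le> CARD('a)"
    by (intro card_mono) auto
  then show ?thesis by simp
qed

text \<open>The fibres of \<open>y \<mapsto> y ^ b\<close> have at most \<open>b\<close> elements,
  so its image has at least \<open>a\<close>; but it lies among the at most \<open>a\<close> roots
  of \<open>c ^ a = 1\<close>. This does without a generator of the multiplicative group.\<close>

lemma power_map_finite_field:
  fixes a b :: nat
  assumes ab: "a * b = CARD('a::{field, finite}) - 1"
  shows "card {c::'a. c ^ a = 1} = a" "{c::'a. c ^ a = 1} = (\<lambda>y. y ^ b) ` (UNIV - {0})"
proof -
  let ?U = "UNIV - {0::'a}"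
  have cU: "card ?U = a * b"
    by (simp add: ab card_Diff_singleton)
  then have pos: "a > 0" "b > 0"
    using one_less_card_field[where ?'a = 'a] ab by (auto intro!: Nat.gr0I)
  have sub: "(\<lambda>y. y ^ b) ` ?U \<subseteq> {c. c ^ a = 1}"
  proof safe
    fix y :: 'a assume "y \<noteq> 0"
    then show "(y ^ b) ^ a = 1"
      using finite_field_power_card_minus_one[of y] ab by (simp add: mult.commute flip: power_mult)
  qed
  have "card ?U \<le> card ((\<lambda>y. y ^ b) ` ?U) * b"
  proof -
    have "card ?U = (\<Sum>c\<in>(\<lambda>y. y ^ b) ` ?U. card {y \<in> ?U. y ^ b = c})"
      using sum.image_gen[of ?U "\<lambda>_. 1::nat" "\<lambda>y. y ^ b"] by simp
    also have "\<dots> \<le> (\<Sum>c\<in>(\<lambda>y. y ^ b) ` ?U. b)"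
    proof (rule sum_mono)
      fix c
      have "card {y \<in> ?U. y ^ b = c} \<le> card {y. y ^ b = c}"
        by (intro card_mono) auto
      also have "\<dots> \<le> b"
        using card_power_eq_le pos by blast
      finally show "card {y \<in> ?U. y ^ b = c} \<le> b" .
    qed
    finally show ?thesis by simp
  qed
  then have "a \<le> card ((\<lambda>y. y ^ b) ` ?U)"
    using cU pos by simp
  moreover have "card ((\<lambda>y. y ^ b) ` ?U) \<le> card {c::'a. c ^ a = 1}"
    using sub by (intro card_mono) auto
  moreover have "card {c::'a. c ^ a = 1} \<le> a"
    using card_power_eq_le pos by blast
  ultimately show "card {c::'a. c ^ a = 1} = a" "{c::'a. c ^ a = 1} = (\<lambda>y. y ^ b) ` ?U"
    using sub card_subset_eq[OF _ sub] by auto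
qed

text \<open>Replacing \<open>c\<close> by \<open>g * c\<close> multiplies the sum by
  \<open>g ^ n\<close>, and some nonzero \<open>g\<close> has \<open>g ^ n \<noteq> 1\<close>, as
  there are at most \<open>n\<close> roots of unity of order dividing \<open>n\<close>. For
  \<open>n = 0\<close>, with \<open>0 ^ 0 = 1\<close>, the sum is the order of the field, which is 0
  in it.\<close>

lemma sum_power_finite_field:
  assumes "n < CARD('a::{field, finite}) - 1"
  shows "(\<Sum>c\<in>UNIV. (c::'a) ^ n) = 0"
proof (cases "n = 0")
  case True
  have "CHAR('a) dvd CARD('a)"
  proof -
    have "(\<Sum>c\<in>UNIV. (c::'a) + 1) = (\<Sum>c\<in>UNIV. c)"
      by (rule sum.reindex_bij_witness[of _ "\<lambda>c. c - 1" "\<lambda>c. c + 1"]) auto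
    then have "of_nat CARD('a) = (0::'a)"
      by (simp add: sum.distrib)
    then show ?thesis
      by (simp add: of_nat_eq_0_iff_char_dvd)
  qed
  then show ?thesis
    using True by (simp add: of_nat_eq_0_iff_char_dvd)
next
  case False
  have "\<exists>g::'a. g \<noteq> 0 \<and> g ^ n \<noteq> 1"
  proof (rule ccontr)
    assume "\<not> ?thesis"
    then have "UNIV - {0} \<subseteq> {c::'a. c ^ n = 1}"
      by auto
    then have "card (UNIV - {0::'a}) \<le> card {c::'a. c ^ n = 1}"
      by (intro card_mono) auto
    also have "\<dots> \<le> n"
      using card_power_eq_le False by blast
    finally show False
      using assms by (simp add: card_Diff_singleton)
  qed
  then obtain g :: 'a where g: "g \<noteq> 0" "g ^ n \<noteq> 1" by blast
  have "(\<Sum>c\<in>UNIV. (g * c) ^ n) = (\<Sum>c\<in>UNIV. c ^ n)"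
    by (rule sum.reindex_bij_witness[of _ "\<lambda>c. c / g" "\<lambda>c. g * c"]) (use g in auto)
  then have "(g ^ n - 1) * (\<Sum>c\<in>UNIV. c ^ n) = 0"
    by (simp only: power_mult_distrib sum_distrib_left[symmetric] left_diff_distrib) simp
  then show ?thesis
    using g by simp
qed

text \<open>\<open>poly_fun d N\<close> consists of the polynomial functions in \<open>d\<close> variables of total degree
  at most \<open>N\<close>.\<close>

inductive poly_fun :: "nat \<Rightarrow> nat \<Rightarrow> ((nat \<Rightarrow> 'a::field) \<Rightarrow> 'a) \<Rightarrow> bool" for d where
  const: "poly_fun d N (\<lambda>_. c)"
| var: "poly_fun d N f \<Longrightarrow> i < d \<Longrightarrow> poly_fun d (Suc N) (\<lambda>s. s i * f s)"
| add: "poly_fun d N f \<Longrightarrow> poly_fun d N g \<Longrightarrow> poly_fun d N (\<lambda>s. f s + g s)"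

lemma poly_fun_mono: "poly_fun d N f \<Longrightarrow> N \<le> M \<Longrightarrow> poly_fun d M f"
proof (induction arbitrary: M rule: poly_fun.induct)
  case (var N f i)
  then show ?case
    by (cases M) (auto intro: poly_fun.var)
qed (auto intro: poly_fun.intros)

lemma poly_fun_scale: "poly_fun d N f \<Longrightarrow> poly_fun d N (\<lambda>s. c * f s)"
proof (induction rule: poly_fun.induct)
  case (var N f i)
  then have "poly_fun d (Suc N) (\<lambda>s. s i * (c * f s))"
    by (intro poly_fun.var)
  then show ?case
    by (simp add: mult_ac)
qed (auto intro: poly_fun.intros simp: distrib_left)

lemma poly_fun_mult: "poly_fun d N f \<Longrightarrow> poly_fun d M g \<Longrightarrow> poly_fun d (N + M) (\<lambda>s. f s * g s)"
proof (induction rule: poly_fun.induct)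
  case (const N c)
  then show ?case
    by (intro poly_fun_scale) (rule poly_fun_mono, auto)
next
  case (var N f i)
  then have "poly_fun d (Suc (N + M)) (\<lambda>s. s i * (f s * g s))"
    by (intro poly_fun.var)
  then show ?case
    by (simp add: mult_ac)
qed (auto intro: poly_fun.intros simp: distrib_right)

lemma poly_fun_power: "poly_fun d N f \<Longrightarrow> poly_fun d (k * N) (\<lambda>s. f s ^ k)"
  by (induction k) (auto intro: poly_fun.const poly_fun_mult)

lemma poly_fun_sum: "(\<And>i. i \<in> I \<Longrightarrow> poly_fun d N (f i)) \<Longrightarrow> poly_fun d N (\<lambda>s. \<Sum>i\<in>I. f i s)"
  by (induction I rule: infinite_finite_induct) (auto intro: poly_fun.intros)

lemma poly_fun_prod:
  "(\<And>i. i \<in> I \<Longrightarrow> poly_fun d (N i) (f i)) \<Longrightarrow> poly_fun d (\<Sum>i\<in>I. N i) (\<lambda>s. \<Prod>i\<in>I. f i s)"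
  by (induction I rule: infinite_finite_induct) (auto intro: poly_fun.intros poly_fun_mult)

text \<open>The monomial carries the induction: the rule \<open>var\<close> moves a variable from
  \<open>f\<close> into the exponents \<open>n\<close>. In the constant case the degree bound leaves
  some exponent below \<open>CARD('a) - 1\<close>, and the sum over that variable vanishes.\<close>

lemma sum_poly_fun_monomial:
  fixes f :: "(nat \<Rightarrow> 'a::{field, finite}) \<Rightarrow> 'a"
  assumes "poly_fun d N f" "N + (\<Sum>i<d. n i) < d * (CARD('a) - 1)"
  shows "(\<Sum>s\<in>PiE {..<d} (\<lambda>_. UNIV). f s * (\<Prod>i<d. s i ^ n i)) = 0"
  using assms
proof (induction arbitrary: n rule: poly_fun.induct)
  case (const N c)
  have "\<exists>j<d. n j < CARD('a) - 1"
  proof (rule ccontr)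
    assume "\<not> ?thesis"
    then have "(\<Sum>i<d. CARD('a) - 1) \<le> (\<Sum>i<d. n i)"
      by (intro sum_mono) auto
    then show False
      using const by simp
  qed
  then obtain j where j: "j < d" "n j < CARD('a) - 1" by blast
  have "(\<Sum>s\<in>PiE {..<d} (\<lambda>_. UNIV :: 'a set). \<Prod>i<d. s i ^ n i) = (\<Prod>i<d. \<Sum>c\<in>UNIV. c ^ n i)"
    by (rule prod_sum_PiE[symmetric]) auto
  also have "\<dots> = 0"
    using j sum_power_finite_field[OF j(2)] by (intro prod_zero) auto
  finally show ?case
    by (simp flip: sum_distrib_left)
next
  case (var N f i)
  have "(\<Sum>k<d. (n(i := Suc (n i))) k) = Suc (\<Sum>k<d. n k)"
    using var.hyps by (simp add: sum.remove[of "{..<d}" i])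
  then have "(\<Sum>s\<in>PiE {..<d} (\<lambda>_. UNIV). f s * (\<Prod>k<d. s k ^ (n(i := Suc (n i))) k)) = 0"
    using var.prems by (intro var.IH) auto
  moreover have "(\<Prod>k<d. s k ^ (n(i := Suc (n i))) k) = s i * (\<Prod>k<d. s k ^ n k)" for s :: "nat \<Rightarrow> 'a"
    using var.hyps by (simp add: prod.remove[of "{..<d}" i] mult.assoc)
  ultimately show ?case
    by (simp add: mult_ac)
next
  case (add N f g)
  then show ?case
    by (simp add: distrib_right sum.distrib)
qed

text \<open>The vanishing lemma in Ax's proof of the Chevalley-Warning theorem.\<close>

lemma sum_poly_fun:
  fixes f :: "(nat \<Rightarrow> 'a::{field, finite}) \<Rightarrow> 'a"
  assumes "poly_fun d N f" "N < d * (CARD('a) - 1)"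
  shows "(\<Sum>s\<in>PiE {..<d} (\<lambda>_. UNIV). f s) = 0"
  using sum_poly_fun_monomial[OF assms(1), of "\<lambda>_. 0"] assms(2) by simp


section \<open>Cyclic modules\<close>

definition cyc :: "('a::field, 'n::finite) sqmat \<Rightarrow> 'a ^ 'n \<Rightarrow> ('a ^ 'n) set" where
  "cyc x v = range (\<lambda>f. pe x f \<cdot> v)"

lemma cycI [intro]: "pe x f \<cdot> v \<in> cyc x v"
  by (simp add: cyc_def)

lemma cyc_self [intro]: "v \<in> cyc x v"
  using cycI[of x 1 v] by simp

lemma subspace_cyc: "vec.subspace (cyc x v)"
  unfolding vec.subspace_def
proof (intro conjI allI ballI)
  show "0 \<in> cyc x v"
    using cycI[of x 0 v] by simp
  show "u + w \<in> cyc x v" if "u \<in> cyc x v" "w \<in> cyc x v" for u w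
    using that unfolding cyc_def by (auto simp flip: act_add_left pe_add)
  show "c *s u \<in> cyc x v" if "u \<in> cyc x v" for c u
  proof -
    obtain f where "u = pe x f \<cdot> v"
      using \<open>u \<in> cyc x v\<close> by (auto simp: cyc_def)
    then show ?thesis
      using cycI[of x "smult c f" v] by (simp add: pe_smult)
  qed
qed

lemma pe_cyc: "w \<in> cyc x v \<Longrightarrow> pe x f \<cdot> w \<in> cyc x v"
  by (auto simp: cyc_def simp flip: act_mult pe_mult)

lemma invar_pe_cyc: "invar (pe x f) (cyc x v)"
  by (simp add: invar_def pe_cyc)

definition is_ann :: "('a::field, 'n::finite) sqmat \<Rightarrow> 'a ^ 'n \<Rightarrow> 'a poly \<Rightarrow> bool" where
  "is_ann x v d \<longleftrightarrow> (\<forall>f. pe x f \<cdot> v = 0 \<longleftrightarrow> d dvd f)"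

text \<open>\<open>F[t]/(p ^ m)\<close> has a smallest nonzero ideal, its socle, generated by
  \<open>p ^ (m - 1)\<close>; every nonzero element has a multiple equal to this generator.\<close>

lemma ex_mult_eq_power:
  assumes p: "monic_irreducible p" and "\<not> p ^ m dvd f"
  shows "\<exists>g s. g * f = p ^ (m - 1) + s * p ^ m"
  using assms(2)
proof (induction m arbitrary: f)
  case (Suc m)
  show ?case
  proof (cases "p dvd f")
    case True
    then obtain f' where f': "f = p * f'"
      by (auto elim: dvdE)
    then have nd: "\<not> p ^ m dvd f'"
      using Suc.prems by (auto simp: mult_dvd_mono)
    then obtain m' where m': "m = Suc m'"
      by (cases m) auto
    obtain g s where "g * f' = p ^ (m - 1) + s * p ^ m"
      using Suc.IH[OF nd] by blast
    then have "g * f = p ^ (Suc m - 1) + s * p ^ Suc m"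
    proof -
      have "g * f = p * (g * f')"
        by (simp add: f')
      also have "\<dots> = p * (p ^ (m - 1) + s * p ^ m)"
        using \<open>g * f' = _\<close> by (rule arg_cong)
      finally show ?thesis
        by (simp add: m' algebra_simps)
    qed
    then show ?thesis by blast
  next
    case False
    moreover have "irreducible p"
      using p by (simp add: monic_irreducible_def)
    ultimately obtain s t where st: "s * p + t * f = 1"
      using ex_bezout by blast
    have "(t * p ^ m) * f = p ^ (Suc m - 1) + (- s) * p ^ Suc m"
      using arg_cong[OF st, of "\<lambda>h. p ^ m * h"] by (simp add: algebra_simps)
    then show ?thesis by blast
  qed
qed simp

lemma is_ann_power:
  assumes p: "monic_irreducible p" and m: "m > 0"
    and 0: "(pe x p ^ m) \<cdot> v = 0" and 1: "(pe x p ^ (m - 1)) \<cdot> v \<noteq> 0"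
  shows "is_ann x v (p ^ m)"
  unfolding is_ann_def
proof (intro allI iffI)
  fix f
  show "pe x f \<cdot> v = 0" if "p ^ m dvd f"
  proof -
    obtain c where "f = c * p ^ m"
      using \<open>p ^ m dvd f\<close> by (metis dvdE mult.commute)
    then show ?thesis
      using 0 by (simp add: pe_mult pe_power)
  qed
  assume f: "pe x f \<cdot> v = 0"
  show "p ^ m dvd f"
  proof (rule ccontr)
    assume "\<not> p ^ m dvd f"
    then obtain g s where "g * f = p ^ (m - 1) + s * p ^ m"
      using ex_mult_eq_power[OF p] by blast
    moreover have "pe x (g * f) \<cdot> v = 0"
      using f by (simp add: pe_mult)
    ultimately have "(pe x p ^ (m - 1)) \<cdot> v + pe x s \<cdot> (pe x p ^ m) \<cdot> v = 0"
      by (simp add: pe_add pe_mult pe_power)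
    then show False
      using 0 1 by simp
  qed
qed

lemma is_ann_irreducible:
  assumes "monic_irreducible p" "pe x p \<cdot> v = 0" "v \<noteq> 0"
  shows "is_ann x v p"
  using is_ann_power[of p 1 x v] assms by simp

text \<open>Representatives of \<open>F[t]\<close> modulo a polynomial of degree \<open>d\<close>,
  given by coefficients so that they can be counted and put into polynomial functions.\<close>

definition low_poly :: "nat \<Rightarrow> (nat \<Rightarrow> 'a::field) \<Rightarrow> 'a poly" where
  "low_poly d s = (\<Sum>i<d. monom (s i) i)"

lemma coeff_low_poly: "coeff (low_poly d s) i = (if i < d then s i else 0)"
  by (simp add: low_poly_def coeff_sum)

lemma degree_low_poly: "d > 0 \<Longrightarrow> degree (low_poly d s) < d"
  by (metis coeff_low_poly degree_0 leading_coeff_0_iff)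

lemma low_poly_eq_0_iff: "s \<in> PiE {..<d} (\<lambda>_. UNIV) \<Longrightarrow> low_poly d s = 0 \<longleftrightarrow> (\<forall>i<d. s i = 0)"
  by (auto simp: poly_eq_iff coeff_low_poly)

lemma pe_low_poly: "pe x (low_poly d s) = (\<Sum>i<d. sc (s i) * x ^ i)"
  by (simp add: low_poly_def pe_sum pe_monom)

lemma inj_low_poly: "inj_on (low_poly d) (PiE {..<d} (\<lambda>_. UNIV))"
proof (rule inj_onI)
  fix s t :: "nat \<Rightarrow> 'a"
  assume st: "s \<in> PiE {..<d} (\<lambda>_. UNIV)" "t \<in> PiE {..<d} (\<lambda>_. UNIV)" "low_poly d s = low_poly d t"
  show "s = t"
  proof (rule PiE_ext[OF st(1,2)])
    fix i assume "i \<in> {..<d}"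
    then show "s i = t i"
      using st(3) by (metis coeff_low_poly lessThan_iff)
  qed
qed

lemma is_ann_inj:
  assumes ann: "is_ann x v D"
  shows "inj_on (\<lambda>s. pe x (low_poly (degree D) s) \<cdot> v) (PiE {..<degree D} (\<lambda>_. UNIV))"
proof (rule inj_onI)
  fix s t
  assume st: "s \<in> PiE {..<degree D} (\<lambda>_. UNIV)" "t \<in> PiE {..<degree D} (\<lambda>_. UNIV)"
    "pe x (low_poly (degree D) s) \<cdot> v = pe x (low_poly (degree D) t) \<cdot> v"
  define f where "f = low_poly (degree D) s - low_poly (degree D) t"
  have "D dvd f"
    using ann st(3) by (simp add: is_ann_def[THEN iffD1, rule_format, symmetric] f_def pe_diff)
  have "f = 0"
  proof (cases "degree D = 0")
    case True
    then show ?thesis by (simp add: f_def low_poly_def)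
  next
    case False
    then have "degree f < degree D"
      unfolding f_def by (intro degree_diff_less degree_low_poly) auto
    then show ?thesis
      using \<open>D dvd f\<close> by (metis dvd_imp_degree_le not_less)
  qed
  then have "low_poly (degree D) s = low_poly (degree D) t"
    by (simp add: f_def)
  then show "s = t"
    using inj_low_poly st by (auto dest: inj_onD)
qed

lemma pe_mod_act:
  assumes "is_ann x v D"
  shows "pe x (f mod D) \<cdot> v = pe x f \<cdot> v"
proof -
  have "pe x (D * (f div D)) \<cdot> v = 0"
    using assms by (simp add: is_ann_def)
  moreover have "f mod D = f - D * (f div D)"
    by (simp add: minus_mult_div_eq_mod)
  ultimately show ?thesis
    by (simp add: pe_diff del: minus_mult_div_eq_mod)
qed

lemma low_poly_coeff: "degree f < d \<Longrightarrow> low_poly d (restrict (coeff f) {..<d}) = f"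
  by (auto simp: poly_eq_iff coeff_low_poly coeff_eq_0)

lemma cyc_eq_low_poly:
  assumes ann: "is_ann x v D" and "D \<noteq> 0"
  shows "cyc x v = (\<lambda>s. pe x (low_poly (degree D) s) \<cdot> v) ` (PiE {..<degree D} (\<lambda>_. UNIV))"
proof (intro equalityI subsetI)
  fix w assume "w \<in> cyc x v"
  then obtain f where f: "w = pe x f \<cdot> v"
    by (auto simp: cyc_def)
  define g where "g = f mod D"
  have g: "w = pe x g \<cdot> v"
    unfolding f g_def pe_mod_act[OF ann] ..
  have "g = 0 \<or> degree g < degree D"
    using degree_mod_less[OF assms(2)] by (auto simp: g_def)
  then have "low_poly (degree D) (restrict (coeff g) {..<degree D}) = g"
  proof
    assume "degree g < degree D"
    then show ?thesis by (rule low_poly_coeff)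
  qed (simp add: poly_eq_iff coeff_low_poly)
  then show "w \<in> (\<lambda>s. pe x (low_poly (degree D) s) \<cdot> v) ` (PiE {..<degree D} (\<lambda>_. UNIV))"
    using g by (intro image_eqI[where x = "restrict (coeff g) {..<degree D}"]) auto
qed auto

lemma is_ann_degree_le:
  fixes x :: "('a::{field, finite}, 'n::finite) sqmat"
  assumes "is_ann x v D"
  shows "degree D \<le> CARD('n)"
proof -
  have "card (PiE {..<degree D} (\<lambda>_. UNIV :: 'a set)) \<le> CARD('a ^ 'n)"
    using is_ann_inj[OF assms] by (intro card_inj_on_le) auto
  then have "CARD('a) ^ degree D \<le> CARD('a) ^ CARD('n)"
    by (simp add: card_PiE)
  then show ?thesis
    using one_less_card_field power_le_imp_le_exp by blast
qed

text \<open>After transport to a coordinate subspace of dimension \<open>d\<close>, the matrix has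
  \<open>d\<close> columns linear in the coefficients \<open>s\<close>, and unit vectors elsewhere.
  So the degree is \<open>d\<close>, however large the matrix; that it equals the number of
  variables is what the count in \<open>ex_subdet_simple\<close> relies on.\<close>

lemma poly_fun_subdet_cyc:
  fixes x :: "('a::{field, finite}, 'n::finite) sqmat"
  assumes ann: "is_ann x v D" and D: "D \<noteq> 0"
  shows "poly_fun (degree D) (degree D) (\<lambda>s. subdet (pe x (low_poly (degree D) s)) (cyc x v))"
proof -
  define d where "d = degree D"
  let ?S = "cyc x v"
  have "d \<le> CARD('n)"
    using is_ann_degree_le[OF ann] by (simp add: d_def)
  then obtain I :: "'n set" where I: "card I = d"
    by (metis obtain_subset_with_card_n)
  then obtain ix where ix: "bij_betw ix {..<d} I"
    using ex_bij_betw_nat_finite[of I] by (auto simp: atLeast0LessThan)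
  define L where "L = {w :: 'a ^ 'n. \<forall>j. j \<notin> I \<longrightarrow> w $ j = 0}"
  have L: "vec.subspace L"
    by (auto simp: L_def vec.subspace_def)
  have "Vector_Spaces.linear (*s) (*s) (\<lambda>w :: 'a ^ 'n. \<Sum>i<d. (w $ ix i) *s ((x ^ i) \<cdot> v))"
    by (unfold_locales)
      (simp_all add: sum.distrib vec.scale_left_distrib vec.scale_sum_right algebra_simps)
  then obtain T where T: "\<And>w. T \<cdot> w = (\<Sum>i<d. (w $ ix i) *s ((x ^ i) \<cdot> v))"
    using linear_obtains_sqmat by blast
  have T': "T \<cdot> w = pe x (low_poly d (\<lambda>i. w $ ix i)) \<cdot> v" for w
    by (simp add: T pe_low_poly) (induction d, auto)
  have TS: "T \<cdot> w \<in> ?S" for w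
    by (auto simp: T')
  have low_restrict: "low_poly d (restrict s {..<d}) = low_poly d s" for s :: "nat \<Rightarrow> 'a"
    by (auto simp: poly_eq_iff coeff_low_poly)
  have inj: "inj_on (\<lambda>w. T \<cdot> w) L"
  proof (rule inj_onI)
    fix w w' assume w: "w \<in> L" "w' \<in> L" "T \<cdot> w = T \<cdot> w'"
    then have "restrict (\<lambda>i. w $ ix i) {..<d} = restrict (\<lambda>i. w' $ ix i) {..<d}"
      unfolding T' using is_ann_inj[OF ann] low_restrict
      by (intro inj_onD[OF is_ann_inj[OF ann]]) (auto simp: d_def)
    then have "w $ ix i = w' $ ix i" if "i < d" for i
      using that by (metis lessThan_iff restrict_apply')
    then have "w $ j = w' $ j" if "j \<in> I" for j
      using that ix by (metis bij_betw_imp_surj_on imageE lessThan_iff)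
    then show "w = w'"
      using w by (auto simp: L_def vec_eq_iff) metis
  qed
  have surj: "\<exists>w\<in>L. u = T \<cdot> w" if "u \<in> ?S" for u
  proof -
    obtain s where s: "u = pe x (low_poly d s) \<cdot> v"
      using \<open>u \<in> ?S\<close> unfolding cyc_eq_low_poly[OF ann D] d_def by blast
    define w where "w = (\<chi> j. if j \<in> I then s (the_inv_into {..<d} ix j) else 0)"
    have "w \<in> L"
      by (simp add: w_def L_def)
    moreover have "w $ ix i = s i" if "i < d" for i
      using that ix by (auto simp: w_def bij_betw_def the_inv_into_f_f)
    then have "low_poly d (\<lambda>i. w $ ix i) = low_poly d s"
      by (auto simp: poly_eq_iff coeff_low_poly)
    ultimately show ?thesis
      using s by (intro bexI[of _ w]) (simp_all add: T')
  qed
  obtain G H where GH: "G * H = 1" "H * G = 1" "\<And>w. w \<in> L \<Longrightarrow> G \<cdot> w = T \<cdot> w"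
    using ex_iso_extension[OF L inj] by blast
  have HG: "H \<cdot> G \<cdot> w = w" "G \<cdot> H \<cdot> w = w" for w
    using GH by (metis act_mult act_one)+
  define P0 where "P0 = of_mat (\<chi> i j. if i = j \<and> i \<in> I then 1 else (0 :: 'a))"
  have P0: "P0 \<cdot> w = (\<chi> i. if i \<in> I then w $ i else 0)" for w
  proof -
    have "(\<Sum>j\<in>UNIV. (if i = j \<and> i \<in> I then 1 else 0) * w $ j) = (if i \<in> I then w $ i else 0)" for i
      by (cases "i \<in> I") (auto simp: if_distrib if_distribR cong: if_cong)
    then show ?thesis
      by (simp add: P0_def act.rep_eq of_mat_inverse matrix_vector_mult_def vec_eq_iff)
  qed
  have P0L: "P0 \<cdot> w \<in> L" "w \<in> L \<Longrightarrow> P0 \<cdot> w = w" for w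
    by (auto simp: P0 L_def vec_eq_iff)
  define Q where "Q = G * P0 * H"
  have Q: "is_proj Q ?S"
    unfolding is_proj_def
  proof (intro conjI allI ballI)
    show "Q \<cdot> w \<in> ?S" for w
      using GH(3)[OF P0L(1)] TS by (simp add: Q_def)
    fix u assume "u \<in> ?S"
    then obtain w where w: "w \<in> L" "u = T \<cdot> w"
      using surj by blast
    then have "u = G \<cdot> w"
      using GH(3) by simp
    then show "Q \<cdot> u = u"
      using w by (simp add: Q_def HG P0L)
  qed
  define A where "A i = mat_of (H * x ^ i * G)" for i
  define M where "M s r c = (if c \<in> I then \<Sum>i<d. s i * A i $ r $ c else if r = c then 1 else 0)" for s r c
  have sd: "subdet (pe x (low_poly d s)) ?S = det (\<chi> r c. M s r c)" for s
  proof -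
    define a where "a = pe x (low_poly d s)"
    have "subdet a ?S = dt (1 + (a - 1) * Q)"
      unfolding a_def by (rule subdet_eq[OF Q invar_pe_cyc subspace_cyc])
    also have "\<dots> = dt (H * (1 + (a - 1) * Q) * G)"
      using dt_conj[OF GH(1)] by simp
    also have "H * (1 + (a - 1) * Q) * G = 1 + (H * a * G - 1) * P0"
      by (rule sqmat_eqI) (simp add: Q_def HG)
    also have "1 + (H * a * G - 1) * P0 = of_mat (\<chi> r c. M s r c)"
    proof (rule sqmat_eqI)
      fix w
      have "(1 + (H * a * G - 1) * P0) \<cdot> w = w - P0 \<cdot> w + (\<Sum>i<d. s i *s ((H * x ^ i * G) \<cdot> P0 \<cdot> w))"
        by (simp add: a_def pe_low_poly) (induction d, auto)
      also have "\<dots> = of_mat (\<chi> r c. M s r c) \<cdot> w"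
      proof (rule vec_eq_iff[THEN iffD2], rule allI)
        fix r
        have AI: "(\<Sum>c\<in>I. A i $ r $ c * w $ c) = ((H * x ^ i * G) \<cdot> P0 \<cdot> w) $ r" for i
        proof -
          have "((H * x ^ i * G) \<cdot> P0 \<cdot> w) $ r = (\<Sum>c\<in>UNIV. A i $ r $ c * (P0 \<cdot> w) $ c)"
            by (simp add: act.rep_eq A_def matrix_vector_mult_def del: act_mult)
          also have "\<dots> = (\<Sum>c\<in>UNIV. if c \<in> I then A i $ r $ c * w $ c else 0)"
            by (intro sum.cong) (auto simp: P0)
          finally show ?thesis
            by (simp add: sum.If_cases)
        qed
        have "(of_mat (\<chi> r c. M s r c) \<cdot> w) $ r = (\<Sum>c\<in>UNIV. M s r c * w $ c)"
          by (simp add: act.rep_eq of_mat_inverse matrix_vector_mult_def)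
        also have "\<dots> = (\<Sum>c\<in>I. M s r c * w $ c) + (\<Sum>c\<in>-I. M s r c * w $ c)"
          by (metis Compl_partition Compl_disjoint finite sum.union_disjoint)
        also have "(\<Sum>c\<in>-I. M s r c * w $ c) = (w - P0 \<cdot> w) $ r"
          by (simp add: M_def P0 if_distrib if_distribR cong: if_cong)
        also have "(\<Sum>c\<in>I. M s r c * w $ c) = (\<Sum>i<d. s i * (\<Sum>c\<in>I. A i $ r $ c * w $ c))"
          by (simp add: M_def sum_distrib_left sum_distrib_right mult.assoc) (rule sum.swap)
        also have "(\<Sum>i<d. s i * (\<Sum>c\<in>I. A i $ r $ c * w $ c)) =
            (\<Sum>i<d. s i * ((H * x ^ i * G) \<cdot> P0 \<cdot> w) $ r)"
          by (simp only: AI)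
        finally show "(w - P0 \<cdot> w + (\<Sum>i<d. s i *s ((H * x ^ i * G) \<cdot> P0 \<cdot> w))) $ r =
            (of_mat (\<chi> r c. M s r c) \<cdot> w) $ r"
          by (simp add: sum_component)
      qed
      finally show "(1 + (H * a * G - 1) * P0) \<cdot> w = of_mat (\<chi> r c. M s r c) \<cdot> w" .
    qed
    finally show ?thesis
      by (simp add: a_def dt.rep_eq of_mat_inverse)
  qed
  have "poly_fun d d (\<lambda>s. det (\<chi> r c. M s r c))"
    unfolding det_def
  proof (intro poly_fun_sum poly_fun_scale)
    fix \<pi> :: "'n \<Rightarrow> 'n" assume "\<pi> \<in> {\<pi>. \<pi> permutes UNIV}"
    then have bij: "bij \<pi>"
      by (simp add: permutes_bij)
    \<comment> \<open>A permutation meets every column once, so exactly \<open>d\<close> factors of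
      its product are linear in \<open>s\<close>.\<close>
    have "(\<Sum>r\<in>UNIV. if \<pi> r \<in> I then 1 else 0 :: nat) = card {r. \<pi> r \<in> I}"
      by (simp add: sum.If_cases)
    also have "{r. \<pi> r \<in> I} = \<pi> -` I"
      by auto
    also have "card (\<pi> -` I) = d"
      using bij I by (metis bij_is_inj bij_is_surj card_vimage_inj subset_UNIV)
    finally have "(\<Sum>r\<in>UNIV. if \<pi> r \<in> I then 1 else 0 :: nat) = d" .
    moreover have "poly_fun d (\<Sum>r\<in>UNIV. if \<pi> r \<in> I then 1 else 0) (\<lambda>s. \<Prod>r\<in>UNIV. M s r (\<pi> r))"
    proof (rule poly_fun_prod)
      fix r :: 'n
      have "poly_fun d 1 (\<lambda>s. s i * A i $ r $ \<pi> r)" if "i < d" for i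
        using poly_fun.var[OF poly_fun.const[of d 0] that] by simp
      then show "poly_fun d (if \<pi> r \<in> I then 1 else 0) (\<lambda>s. M s r (\<pi> r))"
        unfolding M_def by (auto intro: poly_fun_sum poly_fun.const)
    qed
    ultimately show "poly_fun d d (\<lambda>s. \<Prod>r\<in>UNIV. (\<chi> r c. M s r c) $ r $ \<pi> r)"
      by simp
  qed
  then show ?thesis
    using sd by (simp add: d_def)
qed

text \<open>The values of \<open>subdet\<close> on the field \<open>F[x]\<close> acting on a simple module form a subgroup of
  order \<open>k\<close>. Summing the \<open>k\<close>-th power of the determinant, a polynomial function of degree
  \<open>k d\<close> in \<open>d\<close> variables, over all elements of that field gives \<open>-1\<close>, so \<open>k\<close> cannot be
  smaller than \<open>|F| - 1\<close>.\<close>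

lemma ex_subdet_simple:
  fixes x :: "('a::{field, finite}, 'n::finite) sqmat"
  assumes p: "monic_irreducible p" and v: "v \<noteq> 0" "pe x p \<cdot> v = 0" and c: "c \<noteq> 0"
  shows "\<exists>f. subdet (pe x f) (cyc x v) = c"
proof -
  let ?S = "cyc x v"
  define d where "d = degree p"
  have ann: "is_ann x v p"
    using is_ann_irreducible p v by blast
  have p0: "p \<noteq> 0" and irr: "irreducible p"
    using p by (auto simp: monic_irreducible_def)
  have d: "d > 0"
    using irr p0 unfolding d_def by (metis gr0I irreducible_not_unit is_unit_iff_degree)
  define \<phi> where "\<phi> f = subdet (pe x f) ?S" for f
  have mult: "\<phi> (f * g) = \<phi> f * \<phi> g" for f g
    unfolding \<phi>_def pe_mult by (intro subdet_mult subspace_cyc invar_pe_cyc)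
  have \<phi>1: "\<phi> f = 1" if "p dvd f - 1" for f
  proof -
    have "pe x f \<cdot> w = w" if "w \<in> ?S" for w
    proof -
      obtain g where g: "w = pe x g \<cdot> v"
        using \<open>w \<in> ?S\<close> by (auto simp: cyc_def)
      have "pe x (g * (f - 1)) \<cdot> v = 0"
        using ann \<open>p dvd f - 1\<close> by (simp add: is_ann_def)
      then have "pe x (g * f) \<cdot> v = pe x g \<cdot> v"
        by (simp add: algebra_simps pe_diff)
      then show ?thesis
        by (simp add: g mult.commute flip: act_mult pe_mult)
    qed
    then show ?thesis
      unfolding \<phi>_def by (intro subdet_trivial subspace_cyc)
  qed
  have nz: "\<phi> f \<noteq> 0" if "\<not> p dvd f" for f
  proof -
    obtain s t where st: "s * p + t * f = 1"
      using ex_bezout[OF irr \<open>\<not> p dvd f\<close>] by blast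
    have "t * f - 1 = p * (- s)"
      by (simp add: algebra_simps flip: st)
    then have "\<phi> (t * f) = 1"
      by (intro \<phi>1) simp
    then show ?thesis
      by (auto simp: mult)
  qed
  have \<phi>0: "\<phi> 0 = 0"
  proof -
    obtain Q where Q: "is_proj Q ?S"
      using ex_proj subspace_cyc by blast
    have "\<phi> 0 = dt (1 - Q)"
      using subdet_eq[OF Q invar_pe_cyc subspace_cyc, of 0] by (simp add: \<phi>_def)
    moreover have "dt (1 - Q) = 0"
    proof (rule ccontr)
      assume "dt (1 - Q) \<noteq> 0"
      then obtain B where "B * (1 - Q) = 1"
        using dt_nonzeroE by blast
      moreover have "(1 - Q) \<cdot> v = 0"
        using Q cyc_self[of v x] by (simp add: is_proj_def)
      ultimately show False
        using v by (metis act_mult act_one act_zero)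
    qed
    ultimately show ?thesis by simp
  qed
  define H where "H = \<phi> ` {f. \<not> p dvd f}"
  have prime: "prime_elem p"
    using prime_elem_monic_irreducible[OF p] .
  have H0: "0 \<notin> H"
    using nz by (auto simp: H_def)
  have H1: "1 \<in> H"
  proof -
    have "\<not> p dvd 1"
      using irr by (simp add: irreducible_not_unit)
    then show ?thesis
      using \<phi>1[of 1] by (force simp: H_def)
  qed
  have Hmult: "a * b \<in> H" if "a \<in> H" "b \<in> H" for a b
    using that prime unfolding H_def by (auto simp flip: mult simp: prime_elem_dvd_mult_iff)
  define k where "k = card H"
  have k0: "k > 0"
    using H1 by (auto simp: k_def card_gt_0_iff)
  \<comment> \<open>Lagrange's theorem for \<open>H\<close>: multiplication by \<open>h\<close>
    permutes \<open>H\<close>, so the product of all elements is unchanged by the factor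
    \<open>h ^ k\<close>.\<close>
  have pow: "h ^ k = 1" if "h \<in> H" for h
  proof -
    have h0: "h \<noteq> 0"
      using that H0 by auto
    have "(\<lambda>a. h * a) ` H = H"
    proof (rule card_subset_eq)
      show "card ((\<lambda>a. h * a) ` H) = card H"
        using h0 by (intro card_image) (auto simp: inj_on_def)
    qed (use Hmult that in auto)
    then have "(\<Prod>a\<in>H. a) = (\<Prod>a\<in>(\<lambda>a. h * a) ` H. a)"
      by simp
    also have "\<dots> = (\<Prod>a\<in>H. h * a)"
      using h0 by (subst prod.reindex) (auto simp: inj_on_def)
    also have "\<dots> = h ^ k * (\<Prod>a\<in>H. a)"
      by (simp add: prod.distrib k_def)
    finally show ?thesis
      using H0 by (auto simp: prod_zero_iff)
  qed
  have "CARD('a) - 1 \<le> k"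
  proof (rule ccontr)
    assume "\<not> ?thesis"
    then have "k * d < d * (CARD('a) - 1)"
      using d by (simp add: mult.commute)
    moreover have "poly_fun d (k * d) (\<lambda>s. \<phi> (low_poly d s) ^ k)"
      unfolding \<phi>_def d_def by (intro poly_fun_power poly_fun_subdet_cyc ann p0)
    ultimately have sum0: "(\<Sum>s\<in>PiE {..<d} (\<lambda>_. UNIV). \<phi> (low_poly d s) ^ k) = 0"
      by (intro sum_poly_fun)
    have "\<phi> (low_poly d s) ^ k = (if s = restrict (\<lambda>_. 0) {..<d} then 0 else 1)"
      if s: "s \<in> PiE {..<d} (\<lambda>_. UNIV)" for s
    proof (cases "s = restrict (\<lambda>_. 0) {..<d}")
      case True
      then have "low_poly d s = 0"
        using low_poly_eq_0_iff[OF s] by auto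
      then show ?thesis
        using True \<phi>0 k0 by simp
    next
      case False
      have "low_poly d s \<noteq> 0"
      proof
        assume "low_poly d s = 0"
        then have "s i = restrict (\<lambda>_. 0) {..<d} i" for i
          using low_poly_eq_0_iff[OF s] s by (cases "i < d") (auto simp: PiE_iff extensional_def)
        then show False
          using False by blast
      qed
      moreover have "degree (low_poly d s) < degree p"
        using degree_low_poly d by (simp add: d_def)
      ultimately have "\<not> p dvd low_poly d s"
        by (metis dvd_imp_degree_le not_less)
      then have "\<phi> (low_poly d s) \<in> H"
        by (simp add: H_def)
      then show ?thesis
        using pow False by simp
    qed
    then have "(\<Sum>s\<in>PiE {..<d} (\<lambda>_. UNIV :: 'a set). \<phi> (low_poly d s) ^ k) =
      (\<Sum>s\<in>PiE {..<d} (\<lambda>_. UNIV :: 'a set). if s = restrict (\<lambda>_. 0) {..<d} then 0 else 1)"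
      by (intro sum.cong) auto
    also have "\<dots> = (\<Sum>s\<in>PiE {..<d} (\<lambda>_. UNIV :: 'a set). 1 - (if s = restrict (\<lambda>_. 0) {..<d} then 1 else 0))"
      by (intro sum.cong) auto
    also have "\<dots> = of_nat (card (PiE {..<d} (\<lambda>_. UNIV :: 'a set))) - 1"
      by (simp add: sum_subtractf finite_PiE)
    also have "card (PiE {..<d} (\<lambda>_. UNIV :: 'a set)) = CARD('a) ^ d"
      by (simp add: card_PiE)
    also have "of_nat (CARD('a) ^ d) = (0::'a)"
    proof -
      have "of_nat CARD('a) = (0::'a)"
        using sum_power_finite_field[of 0, where ?'a = 'a] one_less_card_field[where ?'a = 'a]
          k0 \<open>\<not> CARD('a) - 1 \<le> k\<close> by simp
      then show ?thesis
        using d by (simp add: power_0_left)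
    qed
    finally show False
      using sum0 by simp
  qed
  moreover have "H \<subseteq> UNIV - {0}"
    using H0 by auto
  ultimately have "H = UNIV - {0}"
    by (intro card_seteq) (auto simp: k_def card_Diff_singleton)
  then have "c \<in> H"
    using c by simp
  then show ?thesis
    by (auto simp: H_def \<phi>_def)
qed

section \<open>Cyclic direct summands\<close>

lemma act_sum_left: "(\<Sum>i\<in>I. a i) \<cdot> v = (\<Sum>i\<in>I. a i \<cdot> v)"
  by (induction I rule: infinite_finite_induct) auto

lemma pe_act_sum_low:
  assumes "degree f < d"
  shows "pe x f \<cdot> w = (\<Sum>i<d. coeff f i *s ((x ^ i) \<cdot> w))"
proof -
  have "pe x f = (\<Sum>i<d. sc (coeff f i) * x ^ i)"
    using pe_low_poly[of x d "restrict (coeff f) {..<d}"] low_poly_coeff[OF assms] by simp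
  then show ?thesis
    by (simp add: act_sum_left)
qed

text \<open>\<open>N\<close> is the largest \<open>x\<close>-invariant subspace in the kernel of
  \<open>\<phi>\<close>. It meets \<open>cyc x u\<close> trivially, because every nonzero submodule
  of \<open>cyc x u\<close> contains the socle generator, where \<open>\<phi>\<close> is not 0. Its
  codimension is at most \<open>degree (p ^ m)\<close>, the dimension of \<open>cyc x u\<close>,
  because \<open>\<phi>\<close> kills the image of \<open>p(x) ^ m\<close>. So \<open>N\<close> is
  an invariant complement, and \<open>e\<close> is the projection along it.\<close>

lemma cyclic_projection:
  fixes x :: "('a::{field, finite}, 'n::finite) sqmat"
  assumes p: "monic_irreducible p" and m: "m > 0" and u: "(pe x p ^ m) \<cdot> u = 0"
    and add: "\<And>v w. \<phi> (v + w) = \<phi> v + \<phi> w" and scale: "\<And>c v. \<phi> (c *s v) = c * \<phi> v"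
    and \<phi>0: "\<And>v. \<phi> ((pe x p ^ m) \<cdot> v) = 0" and \<phi>1: "\<phi> ((pe x p ^ (m - 1)) \<cdot> u) \<noteq> 0"
  obtains e where "e * e = e" "e * x = x * e" "is_proj e (cyc x u)"
    "\<And>w. e \<cdot> w = 0 \<longleftrightarrow> (\<forall>f. \<phi> (pe x f \<cdot> w) = 0)"
proof -
  define N where "N = {w. \<forall>f. \<phi> (pe x f \<cdot> w) = 0}"
  define D where "D = p ^ m"
  define d where "d = degree D"
  have zero: "\<phi> 0 = 0"
    using scale[of 0 0] by simp
  have diff: "\<phi> (v - w) = \<phi> v - \<phi> w" for v w
    using add[of "v - w" w] by simp
  have sum: "\<phi> (\<Sum>i\<in>I. v i) = (\<Sum>i\<in>I. \<phi> (v i))" for I :: "nat set" and v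
    by (induction I rule: infinite_finite_induct) (auto simp: add zero)
  have "(pe x p ^ (m - 1)) \<cdot> u \<noteq> 0"
    using \<phi>1 zero by auto
  then have ann: "is_ann x u D"
    unfolding D_def by (intro is_ann_power p m u)
  have p0: "p \<noteq> 0" and irr: "irreducible p"
    using p by (auto simp: monic_irreducible_def)
  have D0: "D \<noteq> 0"
    using p0 by (simp add: D_def)
  have d0: "d > 0"
    using irr p0 m unfolding d_def D_def
    by (metis gr0I irreducible_not_unit is_unit_iff_degree is_unit_power_iff less_not_refl power_not_zero)
  have N: "vec.subspace N"
    unfolding vec.subspace_def N_def by (auto simp: zero add scale)
  have xN: "pe x f \<cdot> w \<in> N" if "w \<in> N" for f w
    using that by (simp add: N_def flip: act_mult pe_mult)
  have disj: "w = 0" if "w \<in> cyc x u" "w \<in> N" for w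
  proof (rule ccontr)
    obtain f where f: "w = pe x f \<cdot> u"
      using \<open>w \<in> cyc x u\<close> by (auto simp: cyc_def)
    assume "w \<noteq> 0"
    then have "\<not> p ^ m dvd f"
      using ann f by (simp add: is_ann_def D_def)
    then obtain g s where gs: "g * f = p ^ (m - 1) + s * p ^ m"
      using ex_mult_eq_power[OF p] by blast
    have "pe x g \<cdot> w = pe x (p ^ (m - 1) + s * p ^ m) \<cdot> u"
      by (simp only: f gs[symmetric] pe_mult act_mult)
    also have "\<dots> = (pe x p ^ (m - 1)) \<cdot> u"
      using u by (simp add: pe_add pe_mult pe_power)
    finally show False
      using \<phi>1 \<open>w \<in> N\<close> by (metis (mono_tags, lifting) N_def mem_Collect_eq)
  qed
  \<comment> \<open>As \<open>\<phi>\<close> kills the image of \<open>D(x)\<close>, reduction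
    modulo \<open>D\<close> leaves only the powers \<open>x ^ i\<close> with \<open>i < d\<close> to
    be tested.\<close>
  have NI: "w \<in> N" if w: "\<And>i. i < d \<Longrightarrow> \<phi> ((x ^ i) \<cdot> w) = 0" for w
    unfolding N_def
  proof (intro CollectI allI)
    fix f
    have "pe x f = pe x (D * (f div D) + f mod D)"
      by simp
    then have "pe x f \<cdot> w = (pe x p ^ m) \<cdot> pe x (f div D) \<cdot> w + pe x (f mod D) \<cdot> w"
      by (simp only: pe_add pe_mult pe_power D_def act_add_left act_mult)
    moreover have "degree (f mod D) < d"
      using degree_mod_less[OF D0, of f] d0 by (auto simp: d_def)
    ultimately show "\<phi> (pe x f \<cdot> w) = 0"
      by (simp add: add \<phi>0 pe_act_sum_low sum scale w)
  qed
  define \<Psi> where "\<Psi> w = restrict (\<lambda>i. \<phi> ((x ^ i) \<cdot> w)) {..<d}" for w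
  have \<Psi>_eq: "w - w' \<in> N" if "\<Psi> w = \<Psi> w'" for w w'
  proof (rule NI)
    fix i assume "i < d"
    then show "\<phi> ((x ^ i) \<cdot> (w - w')) = 0"
      using fun_cong[OF that, of i] by (simp add: \<Psi>_def diff)
  qed
  have cyc_diff: "w - w' \<in> cyc x u" if "w \<in> cyc x u" "w' \<in> cyc x u" for w w'
    using that subspace_cyc vec.subspace_diff by blast
  \<comment> \<open>Both sides have as many elements as there are functions from
    \<open>{..<d}\<close> to the field, so the injection is onto and every \<open>w\<close> is
    congruent modulo \<open>N\<close> to an element of \<open>cyc x u\<close>.\<close>
  have "inj_on \<Psi> (cyc x u)"
    using \<Psi>_eq disj cyc_diff by (intro inj_onI) (metis right_minus_eq)
  moreover have "card (cyc x u) = card (PiE {..<d} (\<lambda>_. UNIV :: 'a set))"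
    unfolding cyc_eq_low_poly[OF ann D0] using is_ann_inj[OF ann] by (simp add: card_image d_def)
  moreover have "\<Psi> ` cyc x u \<subseteq> PiE {..<d} (\<lambda>_. UNIV)"
    by (simp add: \<Psi>_def image_subset_iff)
  ultimately have surj: "\<Psi> ` cyc x u = PiE {..<d} (\<lambda>_. UNIV)"
    by (intro card_subset_eq finite_PiE) (auto simp: card_image)
  have "\<exists>c. c \<in> cyc x u \<and> w - c \<in> N" for w
  proof -
    have "\<Psi> w \<in> \<Psi> ` cyc x u"
      unfolding surj by (simp add: \<Psi>_def)
    then show ?thesis
      using \<Psi>_eq by (metis imageE)
  qed
  then obtain E where E: "\<And>w. E w \<in> cyc x u" "\<And>w. w - E w \<in> N"
    by metis
  have uniq: "E w = c" if "c \<in> cyc x u" "w - c \<in> N" for w c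
  proof -
    have "c - E w \<in> N"
      using vec.subspace_diff[OF N E(2)[of w] that(2)] by simp
    then show ?thesis
      using disj[OF cyc_diff[OF that(1) E(1)[of w]]] by simp
  qed
  have "Vector_Spaces.linear (*s) (*s) E"
  proof (unfold_locales)
    show "E (v + w) = E v + E w" for v w
    proof (rule uniq)
      show "E v + E w \<in> cyc x u"
        using E subspace_cyc vec.subspace_add by blast
      show "v + w - (E v + E w) \<in> N"
        using vec.subspace_add[OF N E(2)[of v] E(2)[of w]] by (simp add: algebra_simps)
    qed
    show "E (c *s v) = c *s E v" for c v
    proof (rule uniq)
      show "c *s E v \<in> cyc x u"
        using E subspace_cyc vec.subspace_scale by blast
      show "c *s v - c *s E v \<in> N"
        using vec.subspace_scale[OF N E(2)[of v], of c] by (simp add: vec.scale_right_diff_distrib)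
    qed
  qed
  then obtain e where e: "\<And>w. e \<cdot> w = E w"
    using linear_obtains_sqmat by blast
  have E_cyc: "E c = c" if "c \<in> cyc x u" for c
    using that vec.subspace_0[OF N] by (intro uniq) auto
  show thesis
  proof
    show "e * e = e"
      by (rule sqmat_eqI) (simp add: e E_cyc E)
    show "e * x = x * e"
    proof (rule sqmat_eqI)
      fix v
      have "E (x \<cdot> v) = x \<cdot> E v"
      proof (rule uniq)
        show "x \<cdot> E v \<in> cyc x u"
          using pe_cyc[OF E(1), of "[:0, 1:]"] by simp
        show "x \<cdot> v - x \<cdot> E v \<in> N"
          using xN[OF E(2), of "[:0, 1:]"] by simp
      qed
      then show "(e * x) \<cdot> v = (x * e) \<cdot> v"
        by (simp add: e)
    qed
    show "is_proj e (cyc x u)"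
      by (simp add: is_proj_def e E E_cyc)
    show "e \<cdot> w = 0 \<longleftrightarrow> (\<forall>f. \<phi> (pe x f \<cdot> w) = 0)" for w
    proof -
      have "E w = 0 \<longleftrightarrow> w \<in> N"
        using E(2)[of w] uniq[of 0 w] vec.subspace_0[OF subspace_cyc] by auto
      then show ?thesis
        by (simp add: e N_def)
    qed
  qed
qed


section \<open>Elementary divisors\<close>

text \<open>Relative to a subspace \<open>W\<close>, so that cyclic summands can be split off one at
  a time; for \<open>W = UNIV\<close> it is \<open>primary_cyclic_decomposition\<close>.\<close>

definition prim_dec :: "('a::field, 'n::finite) sqmat \<Rightarrow> ('a ^ 'n) set \<Rightarrow> (('a ^ 'n) \<times> 'a poly) list \<Rightarrow> bool"
  where "prim_dec x W vds \<longleftrightarrow>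
    (\<forall>(v, d)\<in>set vds. (\<exists>p m. monic_irreducible p \<and> m > 0 \<and> d = p ^ m) \<and> is_ann x v d \<and> v \<in> W) \<and>
    (\<forall>w\<in>W. \<exists>!ws. list_all2 (\<lambda>u (v, d). u \<in> cyc x v) ws vds \<and> w = sum_list ws)"

lemma list_all2_sum_list_in:
  assumes "list_all2 (\<lambda>u (v, d). u \<in> cyc x v) ws vds" "\<forall>(v, d)\<in>set vds. v \<in> W"
    "vec.subspace W" "invar x W"
  shows "sum_list ws \<in> W"
  using assms(1,2)
proof (induction ws vds rule: list_all2_induct)
  case Nil
  then show ?case
    using vec.subspace_0[OF assms(3)] by simp
next
  case (Cons u us vd vds)
  have "cyc x (fst vd) \<subseteq> W"
    using Cons.prems invar_pe[OF assms(3,4)] by (auto simp: cyc_def invar_def)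
  then show ?case
    using Cons vec.subspace_add[OF assms(3)] by (auto simp: case_prod_beta)
qed

text \<open>\<open>m\<close> is the point where the kernels of the powers of \<open>T\<close> on
  \<open>W\<close> stop growing, and \<open>u\<close> is new in the last one. If
  \<open>T ^ (m - 1)\<close> took \<open>u\<close> to \<open>T ^ m v\<close>, then \<open>v\<close>
  would be new in the kernel of \<open>T ^ (m + 1)\<close>.\<close>

lemma ex_maximal_height:
  fixes T :: "('a::{field, finite}, 'n::finite) sqmat"
  assumes W: "vec.subspace W" and T: "T \<cdot> w0 = 0" "w0 \<in> W" "w0 \<noteq> 0"
  obtains m u where "m > 0" "u \<in> W" "(T ^ m) \<cdot> u = 0" "(T ^ (m - 1)) \<cdot> u \<notin> (\<lambda>v. (T ^ m) \<cdot> v) ` W"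
proof -
  define P where "P j \<longleftrightarrow> (\<forall>w\<in>W. (T ^ Suc j) \<cdot> w = 0 \<longrightarrow> (T ^ j) \<cdot> w = 0)" for j
  obtain i j where ij: "i < j" "T ^ i = T ^ j"
    by (rule ex_power_eq)
  have "P i"
    unfolding P_def
  proof (intro ballI impI)
    fix w assume "(T ^ Suc i) \<cdot> w = 0"
    then have "(T ^ (j - Suc i)) \<cdot> (T ^ Suc i) \<cdot> w = 0"
      by simp
    then show "(T ^ i) \<cdot> w = 0"
      unfolding act_mult[symmetric] power_add[symmetric] using ij by simp
  qed
  define m where "m = (LEAST j. P j)"
  have Pm: "P m"
    unfolding m_def using \<open>P i\<close> by (rule LeastI)
  have "\<not> P 0"
    using T by (auto simp: P_def)
  then have m0: "m > 0"
    using Pm by (cases m) auto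
  then have "\<not> P (m - 1)"
    unfolding m_def by (metis diff_less less_numeral_extra(1) not_less_Least)
  then obtain u where u: "u \<in> W" "(T ^ m) \<cdot> u = 0" "(T ^ (m - 1)) \<cdot> u \<noteq> 0"
    using m0 by (auto simp: P_def)
  have "(T ^ (m - 1)) \<cdot> u \<notin> (\<lambda>v. (T ^ m) \<cdot> v) ` W"
  proof
    assume "(T ^ (m - 1)) \<cdot> u \<in> (\<lambda>v. (T ^ m) \<cdot> v) ` W"
    then obtain v where v: "v \<in> W" "(T ^ (m - 1)) \<cdot> u = (T ^ m) \<cdot> v"
      by blast
    have "(T ^ Suc m) \<cdot> v = T \<cdot> (T ^ (m - 1)) \<cdot> u"
      by (simp only: power_Suc act_mult v(2))
    also have "\<dots> = (T ^ m) \<cdot> u"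
      using m0 by (cases m) auto
    finally show False
      using u v Pm by (simp add: P_def)
  qed
  then show thesis
    using that m0 u by blast
qed

text \<open>Invariant summands are represented by idempotents commuting with \<open>x\<close>: once
  \<open>e\<close> has split off a cyclic summand of maximal height, the rest is the range of the
  idempotent \<open>e0 - e\<close>.\<close>

lemma ex_prim_dec:
  fixes x :: "('a::{field, finite}, 'n::finite) sqmat"
  assumes "e0 * e0 = e0" "e0 * x = x * e0"
  shows "\<exists>vds. prim_dec x (range (\<lambda>v. e0 \<cdot> v)) vds"
  using assms
proof (induction "card (range (\<lambda>v. e0 \<cdot> v))" arbitrary: e0 rule: less_induct)
  case less
  define W where "W = range (\<lambda>v. e0 \<cdot> v)"
  have W: "vec.subspace W"
    unfolding W_def by (intro subspace_image_act) simp
  have e0W: "e0 \<cdot> w = w" if "w \<in> W" for w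
    using that less.prems(1) by (auto simp: W_def simp flip: act_mult)
  have e0_in: "e0 \<cdot> w \<in> W" for w
    by (simp add: W_def)
  have e0pe: "e0 \<cdot> pe x f \<cdot> w = pe x f \<cdot> e0 \<cdot> w" for f w
    using pe_commute[OF less.prems(2)] by (metis act_mult)
  have xW: "invar x W"
    unfolding W_def using less.prems(2) by (intro invar_image) (auto simp: invar_def)
  have cycW: "cyc x v \<subseteq> W" if "v \<in> W" for v
    using invar_pe[OF W xW] that by (auto simp: cyc_def invar_def)
  show ?case
  proof (cases "\<exists>w\<in>W. w \<noteq> 0")
    case False
    then have "prim_dec x W []"
      using vec.subspace_0[OF W] by (auto simp: prim_dec_def)
    then show ?thesis
      unfolding W_def by blast
  next
    case True
    then obtain p w0 where p: "monic_irreducible p" and w0: "w0 \<in> W" "w0 \<noteq> 0" "pe x p \<cdot> w0 = 0"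
      using ex_irreducible_ker[OF W xW] by metis
    define T where "T = pe x p"
    obtain m u where m: "m > 0" and u: "u \<in> W" "(T ^ m) \<cdot> u = 0"
      "(T ^ (m - 1)) \<cdot> u \<notin> (\<lambda>v. (T ^ m) \<cdot> v) ` W"
      using ex_maximal_height[OF W, of T w0] w0 by (auto simp: T_def)
    have e0T: "e0 \<cdot> (T ^ j) \<cdot> w = (T ^ j) \<cdot> e0 \<cdot> w" for j w
      using e0pe[of "p ^ j" w] by (simp add: T_def pe_power)
    define s where "s = (T ^ (m - 1)) \<cdot> u"
    have sW: "s \<in> W"
      using cycW[OF u(1)] cycI[of x "p ^ (m - 1)" u] by (auto simp: s_def T_def pe_power)
    obtain P where P: "is_proj P ((\<lambda>v. (T ^ m) \<cdot> v) ` W)"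
      using ex_proj W subspace_image_act by blast
    have "(1 - P) \<cdot> s \<noteq> 0"
    proof
      assume "(1 - P) \<cdot> s = 0"
      then have "s = P \<cdot> s" by simp
      then show False
        using P u(3) unfolding is_proj_def s_def by metis
    qed
    then obtain i where i: "((1 - P) \<cdot> s) $ i \<noteq> 0"
      by (auto simp: vec_eq_iff)
    \<comment> \<open>A coordinate in which the socle generator \<open>s\<close> sticks out of
      \<open>T ^ m W\<close>, as seen by \<open>1 - P\<close>. The composition with
      \<open>e0\<close> makes the resulting \<open>e\<close> satisfy
      \<open>e * e0 = e\<close>.\<close>
    define \<phi> where "\<phi> w = ((1 - P) \<cdot> e0 \<cdot> w) $ i" for w
    obtain e where e: "e * e = e" "e * x = x * e" and ep: "is_proj e (cyc x u)"
      and ker: "\<And>w. e \<cdot> w = 0 \<longleftrightarrow> (\<forall>f. \<phi> (pe x f \<cdot> w) = 0)"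
    proof (rule cyclic_projection[of p m x u \<phi>])
      show "\<phi> (v + w) = \<phi> v + \<phi> w" "\<phi> (c *s v) = c * \<phi> v" for v w c
        by (simp_all add: \<phi>_def algebra_simps)
      show "\<phi> ((pe x p ^ m) \<cdot> v) = 0" for v
      proof -
        have "e0 \<cdot> (T ^ m) \<cdot> v \<in> (\<lambda>v. (T ^ m) \<cdot> v) ` W"
          by (simp add: e0T e0_in)
        then have "P \<cdot> e0 \<cdot> (T ^ m) \<cdot> v = e0 \<cdot> (T ^ m) \<cdot> v"
          using P unfolding is_proj_def by blast
        then show ?thesis
          by (simp add: \<phi>_def T_def)
      qed
      show "\<phi> ((pe x p ^ (m - 1)) \<cdot> u) \<noteq> 0"
        using i e0W[OF sW] unfolding \<phi>_def s_def T_def by simp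
    qed (use p m u in \<open>auto simp: T_def\<close>)
    have ee0: "e \<cdot> e0 \<cdot> w = e \<cdot> w" for w
    proof -
      have "e \<cdot> (w - e0 \<cdot> w) = 0"
        unfolding ker by (simp add: \<phi>_def e0pe e0W[OF e0_in])
      then show ?thesis by simp
    qed
    have eW: "e \<cdot> w \<in> cyc x u" for w
      using ep by (simp add: is_proj_def)
    have e0e: "e0 \<cdot> e \<cdot> w = e \<cdot> w" for w
      using e0W eW cycW[OF u(1)] by blast
    have eid: "e \<cdot> e \<cdot> w = e \<cdot> w" "e0 \<cdot> e0 \<cdot> w = e0 \<cdot> w" for w
      using e less.prems(1) by (metis act_mult)+
    define e1 where "e1 = e0 - e"
    define W1 where "W1 = range (\<lambda>v. e1 \<cdot> v)"
    have e1: "e1 * e1 = e1" "e1 * x = x * e1"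
      using e less.prems by (auto intro!: sqmat_eqI simp: e1_def eid ee0 e0e algebra_simps)
    have ee1: "e \<cdot> e1 \<cdot> w = 0" for w
      by (simp add: e1_def eid ee0)
    have W1W: "W1 \<subseteq> W"
      using W e0_in cycW[OF u(1)] eW by (auto simp: W1_def e1_def intro!: vec.subspace_diff)
    have eu: "e \<cdot> u = u"
      using ep cyc_self by (auto simp: is_proj_def)
    have u0: "u \<noteq> 0"
    proof
      assume "u = 0"
      then have "s = 0" by (simp add: s_def)
      then show False
        using i by simp
    qed
    have "u \<notin> W1"
      using ee1 eu u0 unfolding W1_def by (metis imageE)
    then have "card W1 < card W"
      using u W1W by (intro psubset_card_mono) auto
    then obtain vds where vds: "prim_dec x W1 vds"
      using less.hyps[of e1] e1 unfolding W_def W1_def by blast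
    have W1: "vec.subspace W1" "invar x W1"
      unfolding W1_def using e1(2)
      by (auto intro!: subspace_image_act invar_image[of x UNIV] simp: invar_def[of x UNIV])
    have e1W1: "w = e \<cdot> w + e1 \<cdot> w" if "w \<in> W" for w
      using e0W[OF that] by (simp add: e1_def)
    have eW1: "e \<cdot> w = 0" if "w \<in> W1" for w
      using that ee1 by (auto simp: W1_def)
    have ann: "is_ann x u (p ^ m)"
    proof (rule is_ann_power[OF p m])
      show "(pe x p ^ (m - 1)) \<cdot> u \<noteq> 0"
        using i by (auto simp: s_def T_def)
    qed (use u in \<open>simp add: T_def\<close>)
    note vds1 = vds[unfolded prim_dec_def, THEN conjunct1]
    note vds2 = vds[unfolded prim_dec_def, THEN conjunct2]
    have "prim_dec x W ((u, p ^ m) # vds)"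
      unfolding prim_dec_def
    proof (intro conjI ballI)
      show "case vd of (v, d) \<Rightarrow> (\<exists>p m. monic_irreducible p \<and> m > 0 \<and> d = p ^ m) \<and> is_ann x v d \<and> v \<in> W"
        if "vd \<in> set ((u, p ^ m) # vds)" for vd
      proof (cases "vd = (u, p ^ m)")
        case True
        then show ?thesis
          using ann p m u(1) unfolding True prod.case by (intro conjI exI[of _ p] exI[of _ m]) simp_all
      next
        case False
        then have "vd \<in> set vds"
          using that by simp
        then show ?thesis
          using bspec[OF vds1 \<open>vd \<in> set vds\<close>] W1W unfolding split_beta by blast
      qed
      fix w assume "w \<in> W"
      have "e1 \<cdot> w \<in> W1"
        by (simp add: W1_def)
      then obtain us where us: "list_all2 (\<lambda>u (v, d). u \<in> cyc x v) us vds" "e1 \<cdot> w = sum_list us"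
        and uniq: "\<And>us'. list_all2 (\<lambda>u (v, d). u \<in> cyc x v) us' vds \<Longrightarrow> e1 \<cdot> w = sum_list us' \<Longrightarrow> us' = us"
      proof -
        have "\<exists>!us. list_all2 (\<lambda>u (v, d). u \<in> cyc x v) us vds \<and> e1 \<cdot> w = sum_list us"
          using bspec[OF vds2 \<open>e1 \<cdot> w \<in> W1\<close>] .
        then show thesis
          using that by (elim ex1E) blast
      qed
      show "\<exists>!ws. list_all2 (\<lambda>u (v, d). u \<in> cyc x v) ws ((u, p ^ m) # vds) \<and> w = sum_list ws"
      proof (rule ex1I)
        show "list_all2 (\<lambda>u (v, d). u \<in> cyc x v) (e \<cdot> w # us) ((u, p ^ m) # vds) \<and> w = sum_list (e \<cdot> w # us)"
        proof (intro conjI)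
          show "w = sum_list (e \<cdot> w # us)"
            using e1W1[OF \<open>w \<in> W\<close>] us(2) by (metis sum_list.Cons)
        qed (use us eW in simp)
        fix ws assume ws: "list_all2 (\<lambda>u (v, d). u \<in> cyc x v) ws ((u, p ^ m) # vds) \<and> w = sum_list ws"
        then obtain c us' where c: "ws = c # us'" "c \<in> cyc x u" "list_all2 (\<lambda>u (v, d). u \<in> cyc x v) us' vds"
          by (auto simp: list_all2_Cons2)
        have "sum_list us' \<in> W1"
        proof (rule list_all2_sum_list_in[OF c(3) _ W1])
          show "\<forall>(v, d)\<in>set vds. v \<in> W1"
            using vds1 by auto
        qed
        moreover have "e \<cdot> c = c"
          using ep c by (simp add: is_proj_def)
        ultimately have "e \<cdot> w = c"
          using ws c eW1 by simp
        moreover have "e1 \<cdot> w = sum_list us'"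
          using ws c e1W1[OF \<open>w \<in> W\<close>] \<open>e \<cdot> w = c\<close> by (metis add_left_cancel sum_list.Cons)
        then have "us' = us"
          using uniq c by blast
        ultimately show "ws = e \<cdot> w # us"
          by (simp add: c)
      qed
    qed
    then show ?thesis
      unfolding W_def by blast
  qed
qed

section \<open>Elementary divisors recognized without a decomposition\<close>

lemma poly_act_eq: "poly_act x f v = pe (of_mat x) f \<cdot> v"
proof -
  have "((*v) x ^^ i) v = (of_mat x ^ i) \<cdot> v" for i
  proof (induction i)
    case (Suc i)
    have "x *v w = of_mat x \<cdot> w" for w
      by (simp add: act.rep_eq of_mat_inverse)
    then show ?case
      using Suc by simp
  qed simp
  then show ?thesis
    by (simp add: poly_act_def pe_eq_sum act_sum_left)
qed

lemma primary_cyclic_decomposition_iff: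
  "primary_cyclic_decomposition x vds \<longleftrightarrow> prim_dec (of_mat x) UNIV vds"
  by (simp add: primary_cyclic_decomposition_def prim_dec_def poly_act_eq is_ann_def
      cyclic_submodule_def cyc_def)

lemma sum_list_act: "sum_list (map (\<lambda>u. a \<cdot> u) ws) = a \<cdot> sum_list ws"
  by (induction ws) auto

lemma list_all2_pe_map:
  "list_all2 (\<lambda>u (v, d). u \<in> cyc x v) ws vds \<Longrightarrow>
    list_all2 (\<lambda>u (v, d). u \<in> cyc x v) (map (\<lambda>u. pe x f \<cdot> u) ws) vds"
  by (induction ws vds rule: list_all2_induct) (auto intro: pe_cyc)

lemma sum_list_in_subspace: "vec.subspace W \<Longrightarrow> (\<And>u. u \<in> set ws \<Longrightarrow> u \<in> W) \<Longrightarrow> sum_list ws \<in> W"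
  by (induction ws) (auto intro: vec.subspace_0 vec.subspace_add)

text \<open>The right-hand side does not mention the decomposition, so membership does not depend on
  the choice in \<open>elementary_divisors\<close>. Among summands \<open>F[t]/(r ^ k)\<close>, a
  vector killed by \<open>p ^ m\<close> whose multiple by \<open>p ^ (m - 1)\<close> is outside the
  image of \<open>p ^ m\<close> exists only for \<open>r = p\<close> and
  \<open>k = m\<close>.\<close>

lemma prim_dec_mem_iff:
  fixes x :: "('a::field, 'n::finite) sqmat"
  assumes dec: "prim_dec x UNIV vds" and p: "monic_irreducible p" and m: "m > 0"
  shows "p ^ m \<in> snd ` set vds \<longleftrightarrow>
    (\<exists>w. (pe x p ^ m) \<cdot> w = 0 \<and> (pe x p ^ (m - 1)) \<cdot> w \<notin> range (\<lambda>v. (pe x p ^ m) \<cdot> v))"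
    (is "?L \<longleftrightarrow> ?R")
proof
  define R where "R = (\<lambda>u (v, d :: 'a poly). u \<in> cyc x v)"
  have ex1: "\<exists>!ws. list_all2 R ws vds \<and> w = sum_list ws" for w
    using dec by (simp add: prim_dec_def R_def)
  then have ex: "\<exists>ws. list_all2 R ws vds \<and> w = sum_list ws" for w
    by (rule ex1_implies_ex)
  have uniq: "ws = ws'" if "list_all2 R ws vds" "list_all2 R ws' vds" "sum_list ws = sum_list ws'" for ws ws'
    using ex1[of "sum_list ws"] that by metis
  have map_pe: "list_all2 R (map (\<lambda>u. pe x f \<cdot> u) ws) vds" if "list_all2 R ws vds" for ws f
    using list_all2_pe_map that unfolding R_def .
  have ann: "is_ann x v d" "\<exists>r k. monic_irreducible r \<and> k > 0 \<and> d = r ^ k" if "(v, d) \<in> set vds" for v d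
    using dec that unfolding prim_dec_def by auto
  have zeros: "list_all2 R (map (\<lambda>_. 0) vds') vds'" for vds'
    by (induction vds') (auto simp: R_def vec.subspace_0 subspace_cyc)
  have sz: "sum_list (map (\<lambda>_. 0) vds') = (0 :: 'a ^ 'n)" for vds' :: "(('a ^ 'n) \<times> 'a poly) list"
    by (induction vds') auto
  have sk: "pe x (p ^ j) = pe x p ^ j" for j
    by (simp add: pe_power)
  show ?R if ?L
  proof -
    obtain v where v: "(v, p ^ m) \<in> set vds"
      using \<open>?L\<close> by auto
    then obtain A B where AB: "vds = A @ (v, p ^ m) # B"
      by (meson split_list)
    define w where "w = pe x (p ^ (m - 1)) \<cdot> v"
    have "\<not> p ^ m dvd p ^ (m - 1)"
    proof -
      have "degree p > 0"
        using p unfolding monic_irreducible_def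
        by (metis gr0I irreducible_not_unit is_unit_iff_degree not_irreducible_zero)
      then have "degree (p ^ (m - 1)) < degree (p ^ m)"
        using m degree_power_eq[of p] by fastforce
      moreover have "p ^ (m - 1) \<noteq> 0"
        using p by (auto simp: monic_irreducible_def)
      ultimately show ?thesis
        by (meson dvd_imp_degree_le not_less)
    qed
    then have w0: "w \<noteq> 0"
      using ann(1)[OF v] by (simp add: w_def is_ann_def)
    have "w \<notin> range (\<lambda>v. (pe x p ^ m) \<cdot> v)"
    proof
      assume "w \<in> range (\<lambda>v. (pe x p ^ m) \<cdot> v)"
      then obtain y where y: "w = pe x (p ^ m) \<cdot> y"
        by (auto simp: sk)
      obtain ys where ys: "list_all2 R ys vds" "y = sum_list ys"
        using ex by blast
      \<comment> \<open>The components of \<open>w\<close>: itself at the place of the chosen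
        summand, 0 elsewhere. By uniqueness the component at that place is divisible by
        \<open>p(x) ^ m\<close> within the summand, which this power kills.\<close>
      define ws where "ws = map (\<lambda>_. 0) A @ w # map (\<lambda>_. 0) B"
      have "list_all2 R ws vds"
        unfolding ws_def AB using zeros
        by (intro list_all2_appendI list_all2_Cons[THEN iffD2]) (auto simp: R_def w_def)
      moreover have "sum_list ws = sum_list (map (\<lambda>u. pe x (p ^ m) \<cdot> u) ys)"
        by (simp add: ws_def sz sum_list_act y ys)
      ultimately have eq: "ws = map (\<lambda>u. pe x (p ^ m) \<cdot> u) ys"
        using uniq map_pe ys(1) by blast
      have "length ws = length vds" "length A < length vds"
        using \<open>list_all2 R ws vds\<close> by (auto simp: AB dest: list_all2_lengthD)
      moreover have "ws ! length A = w" "vds ! length A = (v, p ^ m)"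
        by (simp_all add: ws_def AB nth_append)
      ultimately have "w = pe x (p ^ m) \<cdot> (ys ! length A)" "ys ! length A \<in> cyc x v"
        using eq ys(1) by (auto simp: R_def list_all2_conv_all_nth dest!: spec[of _ "length A"])
      then obtain f where "w = pe x (p ^ m) \<cdot> pe x f \<cdot> v"
        by (auto simp: cyc_def)
      also have "\<dots> = pe x (p ^ m * f) \<cdot> v"
        by (simp add: pe_mult)
      also have "\<dots> = 0"
        using ann(1)[OF v] by (simp add: is_ann_def del: power_Suc)
      finally show False
        using w0 by simp
    qed
    moreover have "pe x (p ^ m) \<cdot> v = 0"
      using ann(1)[OF v] by (simp add: is_ann_def)
    ultimately show ?R
      unfolding w_def sk by blast
  qed
  show ?L if ?R
  proof -
    obtain y where y: "pe x (p ^ m) \<cdot> y = 0" "pe x (p ^ (m - 1)) \<cdot> y \<notin> range (\<lambda>v. pe x (p ^ m) \<cdot> v)"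
      using \<open>?R\<close> unfolding sk by blast
    obtain ys where ys: "list_all2 R ys vds" "y = sum_list ys"
      using ex by blast
    have "map (\<lambda>u. pe x (p ^ m) \<cdot> u) ys = map (\<lambda>_. 0) vds"
      using y ys by (intro uniq map_pe zeros) (simp_all add: sum_list_act sz)
    then have y0: "pe x (p ^ m) \<cdot> u = 0" if "u \<in> set ys" for u
      using that by (metis (mono_tags, lifting) in_set_conv_nth length_map nth_map)
    have "\<exists>u\<in>set ys. pe x (p ^ (m - 1)) \<cdot> u \<notin> range (\<lambda>v. pe x (p ^ m) \<cdot> v)"
    proof (rule ccontr)
      assume "\<not> ?thesis"
      then have "sum_list (map (\<lambda>u. pe x (p ^ (m - 1)) \<cdot> u) ys) \<in> range (\<lambda>v. pe x (p ^ m) \<cdot> v)"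
        by (intro sum_list_in_subspace subspace_image_act) auto
      then show False
        using y ys by (simp add: sum_list_act)
    qed
    then obtain u where u: "u \<in> set ys" "pe x (p ^ (m - 1)) \<cdot> u \<notin> range (\<lambda>v. pe x (p ^ m) \<cdot> v)"
      by blast
    obtain v d where vd: "(v, d) \<in> set vds" "u \<in> cyc x v"
      using ys(1) u(1) unfolding R_def list_all2_conv_all_nth in_set_conv_nth
      by (metis (no_types, lifting) case_prod_beta prod.collapse)
    obtain r k where rk: "monic_irreducible r" "k > 0" "d = r ^ k"
      using ann(2)[OF vd(1)] by blast
    obtain f where f: "u = pe x f \<cdot> v"
      using vd(2) by (auto simp: cyc_def)
    have du: "pe x d \<cdot> u = 0"
      using ann(1)[OF vd(1)] by (simp add: f is_ann_def flip: act_mult pe_mult)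
    have w0: "pe x (p ^ (m - 1)) \<cdot> u \<noteq> 0"
      using u(2) by (metis act_zero rangeI)
    have "r = p"
    proof (rule ccontr)
      assume "r \<noteq> p"
      then obtain s t where "s * p ^ m + t * r ^ k = 1"
        using ex_bezout_powers p rk by metis
      then have "pe x (s * p ^ m + t * r ^ k) \<cdot> u = u"
        by simp
      then have "u = 0"
        using y0[OF u(1)] du by (simp add: pe_add pe_mult rk)
      then show False
        using w0 by simp
    qed
    moreover have "k \<ge> m"
    proof (rule ccontr)
      assume "\<not> k \<ge> m"
      then have "p ^ (m - 1) = p ^ (m - 1 - k) * d"
        using rk \<open>r = p\<close> by (simp flip: power_add)
      then have "pe x (p ^ (m - 1)) \<cdot> u = pe x (p ^ (m - 1 - k)) \<cdot> pe x d \<cdot> u"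
        by (metis act_mult pe_mult)
      then show False
        using w0 du by simp
    qed
    moreover have "k \<le> m"
    proof (rule ccontr)
      assume "\<not> k \<le> m"
      \<comment> \<open>If \<open>k > m\<close>, an element of \<open>F[t]/(p ^ k)\<close> killed by
        \<open>p ^ m\<close> is a multiple of \<open>p\<close>, so \<open>p ^ (m - 1)\<close> takes
        it into the image of \<open>p ^ m\<close>.\<close>
      have "pe x (p ^ m * f) \<cdot> v = 0"
        using y0[OF u(1)] by (simp add: f pe_mult)
      then have "p ^ k dvd p ^ m * f"
        using ann(1)[OF vd(1)] rk \<open>r = p\<close> by (simp add: is_ann_def)
      then have "p ^ m * p ^ (k - m) dvd p ^ m * f"
        using \<open>\<not> k \<le> m\<close> by (simp flip: power_add)
      then have "p ^ (k - m) dvd f"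
        using p by (auto simp: monic_irreducible_def)
      moreover have "p dvd p ^ (k - m)"
        using \<open>\<not> k \<le> m\<close> by (simp add: dvd_power)
      ultimately obtain g where "f = p * g"
        by (meson dvdE dvd_trans)
      then have "pe x (p ^ (m - 1)) \<cdot> u = pe x (p ^ m) \<cdot> pe x g \<cdot> v"
        using m by (simp add: f power_eq_if[of p m] mult.commute[of p] mult.assoc flip: act_mult pe_mult)
      then show False
        using u(2) by blast
    qed
    ultimately have "d = p ^ m"
      using rk by simp
    then show ?L
      using vd(1) by (intro image_eqI[of _ _ "(v, d)"]) simp_all
  qed
qed

lemma prim_dec_elementary_divisors:
  fixes x :: "'a::{field, finite} ^ 'n ^ 'n"
  obtains vds where "prim_dec (of_mat x) UNIV vds" "elementary_divisors x = mset (map snd vds)"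
proof -
  have "\<exists>vds. prim_dec (of_mat x) (range (\<lambda>v :: 'a ^ 'n. 1 \<cdot> v)) vds"
    by (rule ex_prim_dec) auto
  then have "\<exists>vds. primary_cyclic_decomposition x vds"
    by (simp add: primary_cyclic_decomposition_iff)
  then have "primary_cyclic_decomposition x (SOME vds. primary_cyclic_decomposition x vds)"
    by (rule someI_ex)
  then show thesis
    using that unfolding elementary_divisors_def primary_cyclic_decomposition_iff by blast
qed

lemma elementary_divisor_iff:
  fixes x :: "'a::{field, finite} ^ 'n ^ 'n"
  assumes "monic_irreducible p" "m > 0"
  shows "p ^ m \<in># elementary_divisors x \<longleftrightarrow>
    (\<exists>w. (pe (of_mat x) p ^ m) \<cdot> w = 0 \<and>
      (pe (of_mat x) p ^ (m - 1)) \<cdot> w \<notin> range (\<lambda>v. (pe (of_mat x) p ^ m) \<cdot> v))"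
proof -
  obtain vds where "prim_dec (of_mat x) UNIV vds" "elementary_divisors x = mset (map snd vds)"
    by (rule prim_dec_elementary_divisors)
  then show ?thesis
    using prim_dec_mem_iff[of "of_mat x" vds p m] assms by simp
qed

text \<open>Elementary divisors are positive powers of non-units. This keeps the exponent 0 out of
  the generalized elementary divisors.\<close>

lemma one_not_elementary_divisor:
  fixes x :: "'a::{field, finite} ^ 'n ^ 'n"
  shows "1 \<notin># elementary_divisors x"
proof
  obtain vds where vds: "prim_dec (of_mat x) UNIV vds" "elementary_divisors x = mset (map snd vds)"
    using prim_dec_elementary_divisors by blast
  assume "1 \<in># elementary_divisors x"
  then obtain v where "(v, 1) \<in> set vds"
    using vds(2) by auto
  then obtain p :: "'a poly" and m where "monic_irreducible p" "m > 0" "p ^ m = 1"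
    using bspec[OF vds(1)[unfolded prim_dec_def, THEN conjunct1]] by fastforce
  then show False
    by (metis irreducible_not_unit is_unit_power_iff less_numeral_extra(3) monic_irreducible_def one_dvd)
qed

section \<open>Adjoints with respect to a sesquilinear form\<close>

lemma power_mult_commuting:
  fixes a b :: "'b::monoid_mult"
  assumes "a * b = b * a"
  shows "(a * b) ^ k = a ^ k * b ^ k"
proof (induction k)
  case (Suc k)
  have "b * a ^ k = a ^ k * b"
    using assms by (metis power_commuting_commutes)
  then show ?case
    by (simp add: Suc) (metis mult.assoc)
qed simp

text \<open>Both cases at once: \<open>bar\<close> is the identity and \<open>h\<close> the polar
  form, or \<open>bar\<close> is the \<open>q\<close>-th power and \<open>h\<close> the hermitian
  form.\<close>

locale sesquilinear =
  fixes bar :: "'a::{field, finite} \<Rightarrow> 'a" and h :: "'a ^ 'n::finite \<Rightarrow> 'a ^ 'n \<Rightarrow> 'a"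
  assumes bar_add: "bar (a + b) = bar a + bar b"
    and bar_mult: "bar (a * b) = bar a * bar b"
    and bar_bar [simp]: "bar (bar a) = a"
    and h_add: "h (u + v) w = h u w + h v w"
    and h_scale: "h (c *s u) w = c * h u w"
    and h_sym: "h v u = bar (h u v)"
    and nondeg: "(\<And>w. h v w = 0) \<Longrightarrow> v = 0"
begin

lemma bar_0 [simp]: "bar 0 = 0"
  using bar_add[of 0 0] by (metis add.right_neutral add_left_cancel)

lemma bar_eq_0_iff [simp]: "bar a = 0 \<longleftrightarrow> a = 0"
  by (metis bar_0 bar_bar)

lemma bar_1 [simp]: "bar 1 = 1"
  using bar_mult[of 1 1] by simp

lemma bar_uminus: "bar (- a) = - bar a"
  using bar_add[of a "- a"] by (simp add: eq_neg_iff_add_eq_0 add.commute)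

lemma bar_diff: "bar (a - b) = bar a - bar b"
  using bar_add[of a "- b"] by (simp add: bar_uminus)

lemma bar_sum: "bar (\<Sum>i\<in>I. f i) = (\<Sum>i\<in>I. bar (f i))"
  by (induction I rule: infinite_finite_induct) (auto simp: bar_add)

lemma bar_prod: "bar (\<Prod>i\<in>I. f i) = (\<Prod>i\<in>I. bar (f i))"
  by (induction I rule: infinite_finite_induct) (auto simp: bar_mult)

lemma h_0 [simp]: "h 0 w = 0"
  using h_scale[of 0 0 w] by simp

lemma h_diff: "h (u - v) w = h u w - h v w"
  using h_add[of "u - v" v w] by simp

lemma h_add_right: "h u (v + w) = h u v + h u w"
  using h_sym[of u "v + w"] h_sym[of u v] h_sym[of u w] by (simp add: h_add bar_add)

lemma h_scale_right: "h u (c *s v) = bar c * h u v"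
  using h_sym[of u "c *s v"] h_sym[of u v] by (simp add: h_scale bar_mult)

lemma h_0_right [simp]: "h u 0 = 0"
  using h_sym[of u 0] by simp

lemma h_diff_right: "h u (v - w) = h u v - h u w"
  using h_add_right[of u "v - w" w] by simp

lemma h_sum_right: "h u (\<Sum>i\<in>I. f i) = (\<Sum>i\<in>I. h u (f i))"
  by (induction I rule: infinite_finite_induct) (auto simp: h_add_right)

lemma h_sum: "h (\<Sum>i\<in>I. f i) u = (\<Sum>i\<in>I. h (f i) u)"
  by (induction I rule: infinite_finite_induct) (auto simp: h_add)

lemma h_eq_0_commute: "h u v = 0 \<longleftrightarrow> h v u = 0"
  using h_sym[of u v] by simp

lemma nondeg_right: "(\<And>w. h w v = 0) \<Longrightarrow> v = 0"
  using nondeg h_eq_0_commute by blast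

definition conj_vec :: "'a ^ 'n \<Rightarrow> 'a ^ 'n" where
  "conj_vec v = (\<chi> i. bar (v $ i))"

definition gram :: "'a ^ 'n ^ 'n" where
  "gram = (\<chi> i j. h (axis i 1) (axis j 1))"

lemma h_gram: "h u v = (\<Sum>i\<in>UNIV. u $ i * (gram *v conj_vec v) $ i)"
proof -
  have "h u v = h (\<Sum>i\<in>UNIV. u $ i *s axis i 1) (\<Sum>j\<in>UNIV. v $ j *s axis j 1)"
    by (simp add: basis_expansion)
  also have "\<dots> = (\<Sum>i\<in>UNIV. u $ i * (\<Sum>j\<in>UNIV. bar (v $ j) * h (axis i 1) (axis j 1)))"
    by (simp only: h_sum h_scale) (simp add: h_sum_right h_scale_right)
  finally show ?thesis
    by (simp add: gram_def conj_vec_def matrix_vector_mult_def mult.commute)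
qed

lemma det_gram: "det gram \<noteq> 0"
proof -
  have "v = 0" if v: "transpose gram *v v = 0" for v :: "'a ^ 'n"
  proof (rule nondeg)
    fix w
    have "h v (axis j 1) = 0" for j
    proof -
      have "h v (axis j 1) = h (\<Sum>i\<in>UNIV. v $ i *s axis i 1) (axis j 1)"
        by (simp add: basis_expansion)
      also have "\<dots> = (transpose gram *v v) $ j"
        by (simp add: h_sum h_scale gram_def matrix_vector_mult_def transpose_def mult.commute
            del: transpose_matrix_vector)
      finally show ?thesis
        by (simp add: v del: transpose_matrix_vector)
    qed
    then have "h v (\<Sum>j\<in>UNIV. w $ j *s axis j 1) = 0"
      by (simp add: h_sum_right h_scale_right)
    then show "h v w = 0"
      by (simp add: basis_expansion)
  qed
  then have "inj (\<lambda>v. of_mat (transpose gram) \<cdot> v)"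
    by (intro injI) (metis act.rep_eq act_diff of_mat_inverse right_minus_eq UNIV_I)
  then have "dt (of_mat (transpose gram)) \<noteq> 0"
    by (rule inj_dt_nonzero)
  then show ?thesis
    by (simp add: dt.rep_eq of_mat_inverse)
qed

text \<open>In coordinates, \<open>h\<close> is given by the matrix \<open>gram\<close>, so the
  adjoint is the entrywise \<open>bar\<close> of \<open>gram^-1 g^T gram\<close>, a formula that
  also shows its determinant.\<close>

lemma ex_adj: "\<exists>a. (\<forall>u v. h (g \<cdot> u) v = h u (a \<cdot> v)) \<and> dt a = bar (dt g)"
proof -
  obtain K where K: "gram ** K = mat 1" "K ** gram = mat 1"
    using det_gram invertible_det_nz unfolding invertible_def by blast
  define M where "M = K ** transpose (mat_of g) ** gram"
  define A where "A = (\<chi> i j. bar (M $ i $ j))"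
  have conj: "conj_vec (A *v v) = M *v conj_vec v" for v
    by (simp add: conj_vec_def A_def matrix_vector_mult_def bar_sum bar_mult vec_eq_iff)
  have "h (g \<cdot> u) v = h u (of_mat A \<cdot> v)" for u v
  proof -
    have tr: "(transpose B *v w) $ i = (\<Sum>j\<in>UNIV. B $ j $ i * w $ j)" for B :: "'a ^ 'n ^ 'n" and w i
      by (simp add: matrix_vector_mult_def transpose_def del: transpose_matrix_vector)
    have "gram *v conj_vec (A *v v) = transpose (mat_of g) *v (gram *v conj_vec v)"
      by (simp add: conj M_def matrix_vector_mul_assoc matrix_mul_assoc K del: transpose_matrix_vector)
    then have "h u (of_mat A \<cdot> v) = (\<Sum>i\<in>UNIV. \<Sum>j\<in>UNIV. u $ i * (mat_of g $ j $ i * (gram *v conj_vec v) $ j))"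
      by (simp add: h_gram act.rep_eq of_mat_inverse tr sum_distrib_left del: transpose_matrix_vector)
    also have "\<dots> = (\<Sum>j\<in>UNIV. \<Sum>i\<in>UNIV. u $ i * (mat_of g $ j $ i * (gram *v conj_vec v) $ j))"
      by (rule sum.swap)
    also have "\<dots> = h (g \<cdot> u) v"
      by (simp add: h_gram act.rep_eq)
        (simp add: matrix_vector_mult_def[of "mat_of g"] sum_distrib_right sum_distrib_left mult_ac)
    finally show ?thesis by simp
  qed
  moreover have "dt (of_mat A) = bar (dt g)"
  proof -
    have "bar (of_int (sign \<pi>)) = of_int (sign \<pi>)" for \<pi> :: "'n \<Rightarrow> 'n"
      by (cases "evenperm \<pi>") (simp_all add: sign_def bar_uminus)
    then have "det A = bar (det M)"
      by (simp add: det_def A_def bar_sum bar_mult bar_prod)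
    also have "det M = det (mat_of g)"
    proof -
      have "det K * det gram = 1"
        using K(2) by (metis det_I det_mul)
      then show ?thesis
        by (simp add: M_def det_mul)
    qed
    finally show ?thesis
      by (simp add: dt.rep_eq of_mat_inverse)
  qed
  ultimately show ?thesis by blast
qed

definition adj :: "('a, 'n) sqmat \<Rightarrow> ('a, 'n) sqmat" where
  "adj g = (SOME a. (\<forall>u v. h (g \<cdot> u) v = h u (a \<cdot> v)) \<and> dt a = bar (dt g))"

lemma adj_spec: "(\<forall>u v. h (g \<cdot> u) v = h u (adj g \<cdot> v)) \<and> dt (adj g) = bar (dt g)"
  unfolding adj_def by (rule someI_ex[OF ex_adj])

lemma h_adj: "h (g \<cdot> u) v = h u (adj g \<cdot> v)"
  using adj_spec by blast

lemma dt_adj: "dt (adj g) = bar (dt g)"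
  using adj_spec by blast

lemma adj_eqI:
  assumes "\<And>u v. h (g \<cdot> u) v = h u (a \<cdot> v)"
  shows "adj g = a"
proof (rule sqmat_eqI)
  fix v
  have "h w (adj g \<cdot> v - a \<cdot> v) = 0" for w
    using assms h_adj by (simp add: h_diff_right)
  then show "adj g \<cdot> v = a \<cdot> v"
    using nondeg_right by (metis right_minus_eq)
qed

lemma adj_mult: "adj (a * b) = adj b * adj a"
  by (rule adj_eqI) (simp add: h_adj)

lemma adj_add: "adj (a + b) = adj a + adj b"
  by (rule adj_eqI) (simp add: h_adj h_add h_add_right)

lemma adj_diff: "adj (a - b) = adj a - adj b"
  by (rule adj_eqI) (simp add: h_adj h_diff h_diff_right)

lemma adj_1 [simp]: "adj 1 = 1"
  by (rule adj_eqI) simp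

lemma adj_0 [simp]: "adj 0 = 0"
  by (rule adj_eqI) simp

lemma adj_sc: "adj (sc c) = sc (bar c)"
  by (rule adj_eqI) (simp add: h_scale h_scale_right)

lemma adj_adj [simp]: "adj (adj a) = a"
proof (rule adj_eqI)
  show "h (adj a \<cdot> u) v = h u (a \<cdot> v)" for u v
    using h_sym[of "adj a \<cdot> u" v] h_sym[of u "a \<cdot> v"] by (simp flip: h_adj)
qed

lemma adj_power: "adj (a ^ k) = adj a ^ k"
  by (induction k) (auto simp: adj_mult power_commutes)

lemma h_adj': "h u (g \<cdot> v) = h (adj g \<cdot> u) v"
  by (simp add: h_adj)

lemma adj_pe: "adj (pe x f) = pe (adj x) (map_poly bar f)"
proof (induction f)
  case (pCons c f)
  have "map_poly bar (pCons c f) = pCons (bar c) (map_poly bar f)"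
    by (simp add: map_poly_pCons)
  moreover have "pe (adj x) (map_poly bar f) * adj x = adj x * pe (adj x) (map_poly bar f)"
    using pe_commute[of "adj x" "adj x"] by simp
  ultimately show ?case
    by (simp add: adj_add adj_mult adj_sc pCons)
qed simp

section \<open>Isometries and their adjoints\<close>

definition isom :: "('a, 'n) sqmat set" where
  "isom = {g. adj g * g = 1}"

lemma isomD:
  assumes "g \<in> isom"
  shows "adj g * g = 1" "g * adj g = 1" "adj g \<cdot> g \<cdot> v = v" "g \<cdot> adj g \<cdot> v = v" "dt g \<noteq> 0"
proof -
  show 1: "adj g * g = 1"
    using assms by (simp add: isom_def)
  show 2: "g * adj g = 1"
    using mult_eq_1_commute[OF 1] .
  show "adj g \<cdot> g \<cdot> v = v" "g \<cdot> adj g \<cdot> v = v"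
    using 1 2 by (metis act_mult act_one)+
  show "dt g \<noteq> 0"
    using dt_nonzeroI(1)[OF 2] .
qed

lemma isom_iff: "g \<in> isom \<longleftrightarrow> (\<forall>u v. h (g \<cdot> u) (g \<cdot> v) = h u v)"
proof
  assume g: "g \<in> isom"
  then show "\<forall>u v. h (g \<cdot> u) (g \<cdot> v) = h u v"
    by (simp add: h_adj isomD)
next
  assume a: "\<forall>u v. h (g \<cdot> u) (g \<cdot> v) = h u v"
  have "(adj g * g) \<cdot> v = 1 \<cdot> v" for v
  proof -
    have "h w (adj g \<cdot> g \<cdot> v - v) = 0" for w
      using a by (simp add: h_diff_right flip: h_adj)
    then show ?thesis
      using nondeg_right by fastforce
  qed
  then show "g \<in> isom"
    unfolding isom_def by (auto intro: sqmat_eqI)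
qed

lemma one_isom: "1 \<in> isom"
  by (simp add: isom_def)

lemma isom_mult: "a \<in> isom \<Longrightarrow> b \<in> isom \<Longrightarrow> a * b \<in> isom"
  by (simp add: isom_iff)

lemma adj_isom: "g \<in> isom \<Longrightarrow> adj g \<in> isom"
  by (simp add: isom_def) (metis mult_eq_1_commute)

lemma isom_power: "g \<in> isom \<Longrightarrow> g ^ k \<in> isom"
  by (induction k) (auto intro: one_isom isom_mult)

lemma commute_adj:
  assumes g: "g \<in> isom" and c: "a * g = g * a"
  shows "a * adj g = adj g * a"
proof -
  have "adj g * (a * g) * adj g = adj g * (g * a) * adj g"
    by (simp add: c)
  then have "adj g * a * (g * adj g) = (adj g * g) * a * adj g"
    by (simp add: mult.assoc)
  then show ?thesis
    using isomD[OF g] by simp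
qed

text \<open>The adjoint of an isometry is its inverse, and the isometry has finite order. Hence
  adjoints of polynomials in \<open>x\<close> are again polynomials in \<open>x\<close>, and
  negative powers never enter.\<close>

lemma adj_is_power:
  assumes g: "g \<in> isom"
  shows "\<exists>k. adj g = g ^ k"
proof -
  obtain i j where ij: "i < j" "g ^ i = g ^ j"
    by (rule ex_power_eq)
  have "g ^ j = g ^ i * g ^ (j - i)"
    using ij(1) by (simp flip: power_add)
  then have "adj (g ^ i) * g ^ i = adj (g ^ i) * (g ^ i * g ^ (j - i))"
    using ij(2) by simp
  then have "1 = g ^ (j - i)"
    using isomD(1)[OF isom_power[OF g]] by (metis mult.assoc mult_1_left)
  also have "\<dots> = g * g ^ (j - i - 1)"
    using ij by (simp add: Suc_diff_Suc flip: power_Suc)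
  finally have "adj g * 1 = adj g * (g * g ^ (j - i - 1))"
    by (rule arg_cong)
  then have "adj g = g ^ (j - i - 1)"
    using isomD(1)[OF g] by (simp flip: mult.assoc)
  then show ?thesis by blast
qed

lemma adj_pe_is_pe:
  assumes "x \<in> isom"
  shows "\<exists>f'. adj (pe x f) = pe x f'"
proof (induction f)
  case 0
  then show ?case
    by (metis adj_0 pe_0)
next
  case (pCons c f)
  then obtain f' where f': "adj (pe x f) = pe x f'" by blast
  obtain k where k: "adj x = x ^ k"
    using adj_is_power assms by blast
  have "adj (pe x (pCons c f)) = pe x ([:bar c:] + f' * monom 1 k)"
    by (simp add: adj_add adj_sc adj_mult f' k pe_add pe_mult pe_monom)
  then show ?case by blast
qed

text \<open>\<open>T\<close> and its adjoint differ by a unit commuting with \<open>T\<close>, hence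
  so do the idempotents \<open>T ^ N\<close> and \<open>adj (T ^ N)\<close>. Idempotents related in
  this way absorb each other, so they are equal.\<close>

lemma adj_idempotent_power:
  assumes adjT: "adj T = w * T" and w: "w * w' = 1" and comm: "w * T = T * w"
    and e: "T ^ N * T ^ N = T ^ N"
  shows "adj (T ^ N) = T ^ N"
proof -
  have comm': "w ^ N * T ^ N = T ^ N * w ^ N"
    using comm by (metis power_commuting_commutes)
  have "(w * T) ^ N = w ^ N * T ^ N"
    using comm by (rule power_mult_commuting)
  then have E: "adj (T ^ N) = w ^ N * T ^ N"
    by (simp add: adj_power adjT)
  have idem: "adj (T ^ N) * adj (T ^ N) = adj (T ^ N)"
    using e by (metis adj_mult)
  have ww: "w' ^ N * w ^ N = 1"
    using mult_eq_1_commute[OF w] by (metis left_right_inverse_power)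
  then have e': "T ^ N = w' ^ N * adj (T ^ N)"
    by (metis E mult.assoc mult_1_left)
  have "T ^ N = T ^ N * adj (T ^ N)"
    by (metis e' idem mult.assoc)
  also have "\<dots> = adj (T ^ N)"
    by (metis E comm' e mult.assoc)
  finally show ?thesis by simp
qed

end

text \<open>This is the Fitting decomposition: \<open>T ^ N\<close> projects onto the part where
  \<open>T\<close> is invertible, along the part where it is nilpotent.\<close>

lemma ex_idempotent_power:
  fixes T :: "('a::{field, finite}, 'n::finite) sqmat"
  obtains N where "N > 0" "T ^ N * T ^ N = T ^ N"
proof -
  obtain i j where ij: "i < j" "T ^ i = T ^ j"
    by (rule ex_power_eq)
  define k where "k = j - i"
  have k: "k > 0" "T ^ (i + k) = T ^ i"
    using ij by (simp_all add: k_def)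
  have "T ^ (n + i + l * k) = T ^ (n + i)" for n l
  proof (induction l)
    case (Suc l)
    have "T ^ (n + i + Suc l * k) = T ^ (n + l * k) * T ^ (i + k)"
      by (simp add: algebra_simps flip: power_add)
    also have "\<dots> = T ^ (n + i + l * k)"
      by (simp only: k flip: power_add) (simp add: algebra_simps)
    finally show ?case
      using Suc by simp
  qed simp
  \<comment> \<open>The exponent \<open>Suc i * k\<close> is a multiple of the period
    \<open>k\<close> and not below the preperiod \<open>i\<close>.\<close>
  note this[of "Suc i * k - i" "Suc i"]
  moreover have "Suc i * k - i + i = Suc i * k"
    using k(1) by (cases k) auto
  ultimately have "T ^ (Suc i * k + Suc i * k) = T ^ (Suc i * k)"
    by simp
  then show thesis
    using that[of "Suc i * k"] k by (simp add: power_add)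
qed

text \<open>Each step from the image of \<open>(g - 1) ^ j\<close> to the next one loses only a
  kernel of \<open>g - 1\<close>, where \<open>g\<close> is the identity. After \<open>N\<close>
  steps the part with \<open>g - 1\<close> invertible is left.\<close>

lemma dt_eq_subdet_idempotent:
  fixes g :: "('a::{field, finite}, 'n::finite) sqmat"
  assumes e: "(g - 1) ^ N * (g - 1) ^ N = (g - 1) ^ N"
  shows "dt g = dt (1 + (g - 1) * (g - 1) ^ N)"
proof -
  define T where "T = g - 1"
  have comm: "g * T = T * g"
    by (simp add: T_def algebra_simps)
  have sub: "subdet g (range (\<lambda>v. (T ^ j) \<cdot> v)) = dt g" for j
  proof (induction j)
    case 0
    then show ?case
      by (simp add: subdet_UNIV)
  next
    case (Suc j)
    define W where "W = range (\<lambda>v. (T ^ j) \<cdot> v)"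
    have W: "vec.subspace W" "invar g W"
      unfolding W_def using comm
      by (auto intro!: subspace_image_act invar_image[of g UNIV] power_commute simp: invar_def[of g UNIV])
    have "subdet g W = subdet g (W \<inter> {v. T \<cdot> v = 0}) * subdet g ((\<lambda>v. T \<cdot> v) ` W)"
      by (rule subdet_ker_image[OF W comm])
    moreover have "subdet g (W \<inter> {v. T \<cdot> v = 0}) = 1"
      by (rule subdet_trivial[OF vec.subspace_inter[OF W(1) subspace_ker]]) (simp add: T_def)
    moreover have "(\<lambda>v. T \<cdot> v) ` W = range (\<lambda>v. (T ^ Suc j) \<cdot> v)"
      by (simp add: W_def image_image)
    ultimately show ?case
      using Suc by (simp add: W_def)
  qed
  have "is_proj (T ^ N) (range (\<lambda>v. (T ^ N) \<cdot> v))"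
    using e by (auto simp: is_proj_def T_def simp flip: act_mult)
  then have "subdet g (range (\<lambda>v. (T ^ N) \<cdot> v)) = dt (1 + (g - 1) * T ^ N)"
    using comm by (intro subdet_eq subspace_image_act invar_image[of g UNIV] power_commute)
      (auto simp: invar_def[of g UNIV])
  then show ?thesis
    using sub[of N] by (simp add: T_def)
qed

section \<open>The Cayley transform\<close>

context sesquilinear
begin

text \<open>\<open>adj (g - 1) = - adj g * (g - 1)\<close> is a unit multiple of
  \<open>g - 1\<close>, so the Fitting decomposition of \<open>g - 1\<close> is orthogonal.\<close>

lemma idempotent_minus_one:
  assumes g: "g \<in> isom" and e: "(g - 1) ^ N * (g - 1) ^ N = (g - 1) ^ N"
  shows "adj ((g - 1) ^ N) = (g - 1) ^ N"
proof (rule adj_idempotent_power[OF _ _ _ e])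
  show "adj (g - 1) = - adj g * (g - 1)" "- adj g * (- g) = 1" "- adj g * (g - 1) = (g - 1) * (- adj g)"
    using isomD[OF g] by (simp_all add: adj_diff algebra_simps)
qed

text \<open>A Cayley transform: on the part of the space where \<open>g - 1\<close> is invertible, \<open>g\<close> is, up to the
  sign \<open>\<epsilon>\<close>, the quotient of \<open>\<tau> (g - 1)\<close> by its adjoint.\<close>

lemma cayley:
  assumes g: "g \<in> isom" and N: "N > 0" and e: "(g - 1) ^ N * (g - 1) ^ N = (g - 1) ^ N"
    and \<tau>: "\<tau> \<noteq> 0" "bar \<tau> = - \<epsilon> * \<tau>"
  defines "E \<equiv> (g - 1) ^ N"
  defines "y \<equiv> sc \<tau> * (g - 1) * E + (1 - E)"
  shows "dt y \<noteq> 0" "bar (dt y) = dt (sc \<epsilon> * adj g * E + (1 - E)) * dt y"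
    "dt (adj g * E + (1 - E)) * dt g = 1"
proof -
  have EE: "E \<cdot> E \<cdot> v = E \<cdot> v" for v
    using e by (simp add: E_def flip: act_mult)
  have gE: "g * E = E * g"
    unfolding E_def by (rule power_commute) (simp add: algebra_simps)
  have Eg: "E \<cdot> g \<cdot> v = g \<cdot> E \<cdot> v" for v
    using gE by (metis act_mult)
  have "E * adj g = adj g * E"
    using commute_adj[OF g] gE by simp
  then have Eag: "E \<cdot> adj g \<cdot> v = adj g \<cdot> E \<cdot> v" for v
    by (metis act_mult)
  have adjE: "adj E = E"
    unfolding E_def by (rule idempotent_minus_one[OF g e])
  \<comment> \<open>The inverse of \<open>y\<close>: on the range of \<open>E\<close> the power
    \<open>(g - 1) ^ N\<close> is the identity, so \<open>(g - 1) ^ (N - 1)\<close> inverts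
    \<open>g - 1\<close>.\<close>
  define z where "z = sc (inverse \<tau>) * (g - 1) ^ (N - 1) * E + (1 - E)"
  have "y * z = 1"
  proof (rule sqmat_eqI)
    fix v
    have c: "E \<cdot> ((g - 1) ^ j) \<cdot> v = ((g - 1) ^ j) \<cdot> E \<cdot> v" for j v
    proof -
      have "E * (g - 1) ^ j = (g - 1) ^ j * E"
        using gE by (intro power_commute) (simp add: algebra_simps)
      then show ?thesis by (metis act_mult)
    qed
    define w where "w = ((g - 1) ^ (N - 1)) \<cdot> E \<cdot> v"
    have "g \<cdot> w - w = (g - 1) \<cdot> ((g - 1) ^ (N - 1)) \<cdot> E \<cdot> v"
      by (simp add: w_def)
    also have "\<dots> = ((g - 1) ^ N) \<cdot> E \<cdot> v"
      using N by (cases N) auto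
    also have "\<dots> = E \<cdot> v"
      by (simp add: EE flip: E_def)
    finally have gw: "g \<cdot> w - w = E \<cdot> v" .
    have Ew: "E \<cdot> w = w"
      by (simp add: w_def c EE)
    have "z \<cdot> v = inverse \<tau> *s w + (v - E \<cdot> v)"
      by (simp add: z_def w_def)
    then have "y \<cdot> z \<cdot> v = (g \<cdot> w - w) + (v - E \<cdot> v)"
      using \<tau>(1) by (simp add: y_def Ew EE vec.scale_right_diff_distrib)
    then show "(y * z) \<cdot> v = 1 \<cdot> v"
      by (simp add: gw)
  qed
  then show "dt y \<noteq> 0"
    by (rule dt_nonzeroI)
  \<comment> \<open>On the range of \<open>E\<close> this is \<open>bar \<tau> * (adj g - 1) =
    \<epsilon> * \<tau> * adj g * (g - 1)\<close>, by the choice of \<open>\<tau>\<close>.\<close>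
  have "adj y = (sc \<epsilon> * adj g * E + (1 - E)) * y"
  proof (rule sqmat_eqI)
    fix v
    show "adj y \<cdot> v = ((sc \<epsilon> * adj g * E + (1 - E)) * y) \<cdot> v"
      by (simp add: y_def adj_add adj_diff adj_mult adj_sc adjE \<tau> EE Eg Eag isomD[OF g]
          vec.scale_right_diff_distrib) (simp add: algebra_simps)
  qed
  then show "bar (dt y) = dt (sc \<epsilon> * adj g * E + (1 - E)) * dt y"
    by (metis dt_adj dt_mult)
  have "(adj g * E + (1 - E)) * (1 + (g - 1) * E) = 1"
    by (rule sqmat_eqI) (simp add: EE Eg Eag isomD[OF g] algebra_simps)
  moreover have "dt g = dt (1 + (g - 1) * E)"
    unfolding E_def by (rule dt_eq_subdet_idempotent[OF e])
  ultimately show "dt (adj g * E + (1 - E)) * dt g = 1"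
    by (metis dt_mult dt_one)
qed

end

text \<open>Along the chain of images \<open>p(x) ^ i (cyc x v)\<close> the kernel of
  \<open>p(x)\<close> is always the socle, generated by \<open>p(x) ^ (m - 1) v\<close>; it is split
  off \<open>m\<close> times before the chain reaches 0.\<close>

lemma subdet_cyc:
  fixes x :: "('a::{field, finite}, 'n::finite) sqmat"
  assumes p: "monic_irreducible p" and ann: "is_ann x v (p ^ m)"
    and a: "invar a (cyc x v)" "a * x = x * a"
  shows "subdet a (cyc x v) = subdet a (cyc x ((pe x p ^ (m - 1)) \<cdot> v)) ^ m"
proof -
  define T where "T = pe x p"
  define w where "w = (T ^ (m - 1)) \<cdot> v"
  have p0: "p \<noteq> 0"
    using p by (auto simp: monic_irreducible_def)
  have Tj: "T ^ j = pe x (p ^ j)" for j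
    by (simp add: T_def pe_power)
  have w: "w = pe x (p ^ (m - 1)) \<cdot> v"
    by (simp add: w_def Tj)
  have T0: "(T ^ m) \<cdot> pe x f \<cdot> v = 0" for f
    using ann by (simp add: Tj is_ann_def flip: act_mult pe_mult)
  have image: "pe x f \<cdot> w \<in> (\<lambda>u. (T ^ i) \<cdot> u) ` cyc x v" if "i < m" for f i
  proof -
    have "f * p ^ (m - 1) = p ^ i * (f * p ^ (m - 1 - i))"
      using that by (simp add: algebra_simps flip: power_add)
    then have "pe x f \<cdot> w = (T ^ i) \<cdot> pe x (f * p ^ (m - 1 - i)) \<cdot> v"
      by (simp only: w Tj act_mult[symmetric] pe_mult[symmetric])
    then show ?thesis by blast
  qed
  have ker: "cyc x v \<inter> {u. T \<cdot> u = 0} = cyc x w" if m: "m > 0"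
  proof (intro equalityI subsetI)
    fix u assume "u \<in> cyc x v \<inter> {u. T \<cdot> u = 0}"
    then obtain f where f: "u = pe x f \<cdot> v" "pe x (p * f) \<cdot> v = 0"
      by (auto simp: cyc_def T_def pe_mult)
    then have "p ^ m dvd p * f"
      using ann by (simp add: is_ann_def)
    then have "p ^ (m - 1) dvd f"
      using m p0 by (cases m) auto
    then obtain f' where "f = f' * p ^ (m - 1)"
      by (metis dvdE mult.commute)
    then show "u \<in> cyc x w"
      by (simp add: f w pe_mult cycI)
  next
    fix u assume "u \<in> cyc x w"
    then obtain f where f: "u = pe x f \<cdot> w"
      by (auto simp: cyc_def)
    have "p * (f * p ^ (m - 1)) = p ^ m * f"
      using m by (cases m) (simp_all add: mult_ac)
    then have "T \<cdot> u = (T ^ m) \<cdot> pe x f \<cdot> v"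
      by (simp only: f w T_def pe_power[symmetric] act_mult[symmetric] pe_mult[symmetric])
    then show "u \<in> cyc x v \<inter> {u. T \<cdot> u = 0}"
      using T0 image[of 0 f] m f by auto
  qed
  have "subdet a (cyc x v) = subdet a (cyc x v \<inter> {u. T \<cdot> u = 0}) ^ m * subdet a ((\<lambda>u. (T ^ m) \<cdot> u) ` cyc x v)"
  proof (rule subdet_ker_power[OF subspace_cyc a(1)])
    show "invar T (cyc x v)"
      unfolding T_def by (rule invar_pe_cyc)
    show "a * T = T * a"
      unfolding T_def by (rule pe_commute[OF a(2)])
    fix i assume "i < m"
    then show "cyc x v \<inter> {u. T \<cdot> u = 0} \<subseteq> (\<lambda>u. (T ^ i) \<cdot> u) ` cyc x v"
      using image ker by (auto simp: cyc_def[of x w])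
  qed
  moreover have "subdet a ((\<lambda>u. (T ^ m) \<cdot> u) ` cyc x v) = 1"
  proof -
    have "(T ^ m) \<cdot> u = 0" if "u \<in> cyc x v" for u
      using that T0 by (auto simp: cyc_def)
    then show ?thesis
      by (intro subdet_trivial subspace_image_act subspace_cyc) auto
  qed
  ultimately show ?thesis
    using ker by (cases m) (simp_all add: w_def T_def)
qed

lemma ex_subdet_cyc:
  fixes x :: "('a::{field, finite}, 'n::finite) sqmat"
  assumes p: "monic_irreducible p" and ann: "is_ann x v (p ^ m)" and m: "m > 0" and c: "c \<noteq> 0"
  shows "\<exists>f. subdet (pe x f) (cyc x v) = c ^ m"
proof -
  define w where "w = (pe x p ^ (m - 1)) \<cdot> v"
  have "p \<noteq> 0" "\<not> p dvd 1"
    using p by (auto simp: monic_irreducible_def irreducible_def)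
  have "\<not> p ^ m dvd p ^ (m - 1)"
  proof
    assume "p ^ m dvd p ^ (m - 1)"
    then have "p ^ (m - 1) * p dvd p ^ (m - 1) * 1"
      using m by (cases m) (simp_all add: mult.commute)
    then show False
      using \<open>p \<noteq> 0\<close> \<open>\<not> p dvd 1\<close> by (simp only: dvd_times_left_cancel_iff power_not_zero not_False_eq_True)
  qed
  then have "w \<noteq> 0"
    using ann by (simp add: w_def is_ann_def flip: pe_power)
  moreover have "pe x p \<cdot> w = 0"
  proof -
    have "p * p ^ (m - 1) = p ^ m"
      using m by (cases m) auto
    then have "pe x p \<cdot> w = pe x (p ^ m) \<cdot> v"
      by (simp only: w_def pe_power[symmetric] act_mult[symmetric] pe_mult[symmetric])
    then show ?thesis
      using ann by (simp add: is_ann_def)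
  qed
  ultimately obtain f where "subdet (pe x f) (cyc x w) = c"
    using ex_subdet_simple[OF p] c by blast
  then have "subdet (pe x f) (cyc x v) = c ^ m"
    using subdet_cyc[OF p ann invar_pe_cyc, of f] pe_commute[of x x f] by (simp add: w_def)
  then show ?thesis by blast
qed

lemma monic_irreducible_linear:
  fixes c :: "'a::field"
  shows "monic_irreducible [:c, 1:]"
  unfolding monic_irreducible_def
proof (intro conjI irreducibleI)
  show "\<not> [:c, 1:] dvd 1"
    by (simp add: is_unit_iff_degree)
  fix a b assume ab: "[:c, 1:] = a * b"
  have "[:c, 1:] \<noteq> 0" by simp
  then have nz: "a \<noteq> 0" "b \<noteq> 0"
    unfolding ab by (metis mult_zero_left, metis mult_zero_right)
  have "degree a + degree b = 1"
    using degree_mult_eq[OF nz] by (simp flip: ab)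
  then have "degree a = 0 \<or> degree b = 0"
    by linarith
  then show "a dvd 1 \<or> b dvd 1"
    using nz is_unit_iff_degree by blast
qed simp_all

text \<open>On an eigenline, the scalars act with every possible determinant, so that
  \<open>c \<mapsto> subdet (sc c)\<close> is injective; this forces the value at \<open>-1\<close>.\<close>

lemma subdet_minus_one_line:
  fixes x :: "('a::{field, finite}, 'n::finite) sqmat"
  assumes w: "w \<noteq> 0" "x \<cdot> w = \<epsilon> *s w" and two: "(2::'a) \<noteq> 0"
  shows "subdet (- 1) (cyc x w) = - 1"
proof -
  define \<phi> where "\<phi> c = subdet (sc c) (cyc x w)" for c
  have inv: "invar (sc c) (cyc x w)" for c
    unfolding invar_def using vec.subspace_scale[OF subspace_cyc] by (metis act_sc)
  have pe: "pe x f \<cdot> w = poly f \<epsilon> *s w" for f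
  proof (induction f)
    case (pCons c f)
    have "x \<cdot> (poly f \<epsilon> *s w) = (\<epsilon> * poly f \<epsilon>) *s w"
      by (simp only: act_scale w(2) vec.scale_scale mult.commute)
    then show ?case
      using pCons by (simp only: pe_pCons act_add_left act_sc act_mult poly_pCons vec.scale_left_distrib)
  qed simp
  have pe': "pe x f \<cdot> u = sc (poly f \<epsilon>) \<cdot> u" if "u \<in> cyc x w" for f u
    using that by (auto simp: cyc_def pe mult.commute)
  have irr: "monic_irreducible [:- \<epsilon>, 1:]"
    by (rule monic_irreducible_linear)
  have w0: "pe x [:- \<epsilon>, 1:] \<cdot> w = 0"
    unfolding pe by simp
  have surj: "UNIV - {0} \<subseteq> \<phi> ` (UNIV - {0})"
  proof
    fix c :: 'a assume "c \<in> UNIV - {0}"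
    then obtain f where f: "subdet (pe x f) (cyc x w) = c"
      using ex_subdet_simple[OF irr w(1) w0] by auto
    obtain P where P: "is_proj P (cyc x w)"
      using ex_proj subspace_cyc by blast
    have PV: "P \<cdot> v \<in> cyc x w" for v
      using P by (simp add: is_proj_def)
    have "(pe x f - 1) * P = (sc (poly f \<epsilon>) - 1) * P"
      by (rule sqmat_eqI) (simp add: pe'[OF PV])
    then have "\<phi> (poly f \<epsilon>) = c"
      using f subdet_eq[OF P inv subspace_cyc] subdet_eq[OF P invar_pe_cyc subspace_cyc, of f]
      by (simp add: \<phi>_def)
    moreover have "poly f \<epsilon> \<noteq> 0"
    proof
      assume "poly f \<epsilon> = 0"
      then have "dt (1 - P) = c"
        using \<open>\<phi> (poly f \<epsilon>) = c\<close> subdet_eq[OF P inv subspace_cyc, of 0] by (simp add: \<phi>_def)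
      then obtain B where "B * (1 - P) = 1"
        using \<open>c \<in> UNIV - {0}\<close> dt_nonzeroE by (metis DiffD2 singletonI)
      moreover have "(1 - P) \<cdot> w = 0"
        using P cyc_self[of w x] by (simp add: is_proj_def)
      ultimately show False
        using w(1) by (metis act_mult act_one act_zero)
    qed
    ultimately show "c \<in> \<phi> ` (UNIV - {0})" by blast
  qed
  have "card (\<phi> ` (UNIV - {0})) = card (UNIV - {0::'a})"
    using surj card_mono[OF _ surj] card_image_le[of "UNIV - {0::'a}" \<phi>] by simp
  then have "inj_on \<phi> (UNIV - {0})"
    by (intro eq_card_imp_inj_on) auto
  moreover have "\<phi> 1 = 1"
    unfolding \<phi>_def by (intro subdet_trivial subspace_cyc) auto
  moreover have "(- 1 :: 'a) \<noteq> 1"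
    using two by (metis add_neg_numeral_special(8) eq_neg_iff_add_eq_0 one_add_one)
  ultimately have "\<phi> (- 1) \<noteq> 1"
    by (metis DiffI UNIV_I inj_onD neg_equal_0_iff_equal singletonD zero_neq_one)
  moreover have "\<phi> (- 1) * \<phi> (- 1) = 1"
    unfolding \<phi>_def using subdet_mult[OF subspace_cyc inv[of "- 1"] inv[of "- 1"]] \<open>\<phi> 1 = 1\<close>
    by (simp add: \<phi>_def flip: sc_mult)
  ultimately have "\<phi> (- 1) = - 1"
    using square_eq_1_iff by blast
  then show ?thesis
    by (simp add: \<phi>_def sc_uminus[of 1])
qed

lemma act_two [simp]: "a \<cdot> (2 * v) = 2 * (a \<cdot> v)"
  unfolding mult_2 by (rule act_add)

lemma commute_mult:
  fixes a b x :: "'b::semigroup_mult"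
  assumes "a * x = x * a" "b * x = x * b"
  shows "(a * b) * x = x * (a * b)"
proof -
  have "(a * b) * x = a * (x * b)"
    using assms(2) by (simp add: mult.assoc)
  also have "\<dots> = (x * a) * b"
    by (simp only: assms(1)[symmetric] mult.assoc)
  finally show ?thesis
    by (simp add: mult.assoc)
qed

lemma inverse_commute:
  fixes a y z :: "'b::monoid_mult"
  assumes "y * z = 1" "z * y = 1" "y * a = a * y"
  shows "z * a = a * z"
proof -
  have "z * a = z * (a * y) * z"
    using assms(1) by (simp add: mult.assoc)
  also have "\<dots> = (z * y) * a * z"
    by (simp only: assms(3)[symmetric] mult.assoc)
  finally show ?thesis
    using assms(2) by simp
qed

section \<open>Counting the classes of a normal subgroup\<close>

text \<open>Conjugacy written without inverses; \<open>conj_class_eq\<close> relates it to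
  \<open>conj_class\<close>.\<close>

definition cls :: "('a::field, 'n::finite) sqmat set \<Rightarrow> ('a, 'n) sqmat \<Rightarrow> ('a, 'n) sqmat set" where
  "cls H y = {z. \<exists>s\<in>H. z * s = s * y}"

text \<open>\<open>\<Phi>\<close> sends \<open>g\<close> to the \<open>S\<close>-class of the
  conjugate of \<open>x\<close> by \<open>g\<close>. Two elements have the same value exactly if
  their determinants differ by a factor from \<open>Z\<close>, so the fibres cut the determinants of
  \<open>G\<close> into cosets of those of \<open>Z\<close>.\<close>

lemma card_classes:
  fixes G :: "('a::{field, finite}, 'n::finite) sqmat set" and x :: "('a, 'n) sqmat"
  assumes one: "1 \<in> G" and mult: "\<And>a b. a \<in> G \<Longrightarrow> b \<in> G \<Longrightarrow> a * b \<in> G"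
    and inv: "\<And>g. g \<in> G \<Longrightarrow> \<exists>g'\<in>G. g * g' = 1"
  defines "S \<equiv> {g \<in> G. dt g = 1}" and "Z \<equiv> {g \<in> G. g * x = x * g}"
  shows "card {cls S y | y. y \<in> cls G x} * card (dt ` Z) = card (dt ` G)"
proof -
  obtain iv where iv: "\<And>g. g \<in> G \<Longrightarrow> iv g \<in> G" "\<And>g. g \<in> G \<Longrightarrow> g * iv g = 1"
    using inv by metis
  have iv': "iv g * g = 1" if "g \<in> G" for g
    using mult_eq_1_commute[OF iv(2)[OF that]] .
  have cancel: "g * (iv g * a) = a" "iv g * (g * a) = a" if "g \<in> G" for g a
    using iv(2)[OF that] iv'[OF that] by (metis mult.assoc mult_1_left)+
  have dt_nz: "dt g \<noteq> 0" if "g \<in> G" for g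
    using dt_nonzeroI(1)[OF iv(2)[OF that]] .
  have dt_iv: "dt g * dt (iv g) = 1" if "g \<in> G" for g
    using iv(2)[OF that] by (metis dt_mult dt_one)
  have iv_comm: "x * iv z = iv z * x" if z: "z \<in> G" "z * x = x * z" for z
  proof -
    have "x * iv z = iv z * ((z * x) * iv z)"
      using z(1) by (simp add: cancel mult.assoc)
    also have "\<dots> = iv z * (x * (z * iv z))"
      by (simp only: z(2) mult.assoc)
    finally show ?thesis
      using iv z(1) by simp
  qed
  define conj where "conj g = g * x * iv g" for g
  have clsG: "cls G x = conj ` G"
  proof (intro equalityI subsetI)
    fix z assume "z \<in> cls G x"
    then obtain g where g: "g \<in> G" "z * g = g * x"
      by (auto simp: cls_def)
    then have "z = g * x * iv g"
      using iv by (metis mult.assoc mult_1_right)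
    then show "z \<in> conj ` G"
      using g by (auto simp: conj_def)
  next
    fix z assume "z \<in> conj ` G"
    then obtain g where g: "g \<in> G" "z = g * x * iv g"
      by (auto simp: conj_def)
    then have "z * g = g * x"
      using iv' by (simp add: mult.assoc)
    then show "z \<in> cls G x"
      using g by (auto simp: cls_def)
  qed
  have S: "S \<subseteq> G" "1 \<in> S" and Smult: "\<And>a b. a \<in> S \<Longrightarrow> b \<in> S \<Longrightarrow> a * b \<in> S"
    and Siv: "\<And>s. s \<in> S \<Longrightarrow> iv s \<in> S"
    using one mult iv dt_iv by (auto simp: S_def) (metis mult_1_left)
  have cls_sub: "cls S y \<subseteq> cls S y'" if s: "s \<in> S" "y * s = s * y'" for s y y'
  proof
    fix z assume "z \<in> cls S y"
    then obtain t where t: "t \<in> S" "z * t = t * y"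
      by (auto simp: cls_def)
    have "z * (t * s) = (t * s) * y'"
      using s(2) t(2) by (metis mult.assoc)
    then show "z \<in> cls S y'"
      using Smult[OF t(1) s(1)] by (auto simp: cls_def)
  qed
  have cls_eq: "cls S y = cls S y'" if s: "s \<in> S" "y * s = s * y'" for s y y'
  proof
    show "cls S y \<subseteq> cls S y'"
      using cls_sub s .
    have "iv s * (y * s) * iv s = iv s * (s * y') * iv s"
      by (simp add: s)
    then have "y' * iv s = iv s * y"
      using s(1) S(1) iv(2)[of s] by (auto simp: mult.assoc cancel)
    then show "cls S y' \<subseteq> cls S y"
      using cls_sub Siv s by blast
  qed
  define \<Phi> where "\<Phi> g = cls S (conj g)" for g
  have key: "\<Phi> g = \<Phi> k \<longleftrightarrow> (\<exists>z\<in>Z. dt g = dt k * dt z)" if g: "g \<in> G" and k: "k \<in> G" for g k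
  proof
    assume "\<Phi> g = \<Phi> k"
    moreover have "conj g \<in> \<Phi> g"
      using S(2) by (auto simp: \<Phi>_def cls_def intro!: bexI[of _ 1])
    ultimately obtain s where s: "s \<in> S" "conj g * s = s * conj k"
      by (auto simp: \<Phi>_def cls_def)
    \<comment> \<open>Both \<open>g\<close> and \<open>s * k\<close> conjugate \<open>x\<close> to
      the same element, so they differ by an element of the centralizer.\<close>
    define z where "z = iv g * s * k"
    have sG: "s \<in> G" "dt s = 1"
      using s(1) by (auto simp: S_def)
    have "iv g * (conj g * s) * k = iv g * (s * conj k) * k"
      by (simp add: s)
    then have "x * z = z * x"
      using g k iv' by (simp add: conj_def z_def mult.assoc cancel)
    then have "z \<in> Z"
      using mult iv g k sG by (auto simp: Z_def z_def)
    then have "iv z \<in> Z"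
    proof -
      have zG: "z \<in> G" "z * x = x * z"
        using \<open>z \<in> Z\<close> by (auto simp: Z_def)
      then show ?thesis
        using iv iv_comm by (auto simp: Z_def)
    qed
    moreover have "dt g = dt k * dt (iv z)"
    proof -
      have zG: "z \<in> G"
        using \<open>z \<in> Z\<close> by (simp add: Z_def)
      have "dt g * dt z = dt k"
        using dt_iv[OF g] sG by (simp add: z_def flip: mult.assoc)
      then have "dt k * dt (iv z) = dt g * (dt z * dt (iv z))"
        by (simp add: mult.assoc)
      then show ?thesis
        using dt_iv[OF zG] by simp
    qed
    ultimately show "\<exists>z\<in>Z. dt g = dt k * dt z" by blast
  next
    assume "\<exists>z\<in>Z. dt g = dt k * dt z"
    then obtain z where z: "z \<in> G" "z * x = x * z" "dt g = dt k * dt z"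
      by (auto simp: Z_def)
    define s where "s = g * iv z * iv k"
    have "dt s = 1"
      using dt_iv[OF z(1)] dt_iv[OF k] by (simp add: s_def z(3) mult_ac)
    then have "s \<in> S"
      using mult iv g k z by (auto simp: S_def s_def)
    moreover have "conj g * s = s * conj k"
    proof -
      have "x * iv z = iv z * x"
        using iv_comm z by simp
      then have "x * (iv z * iv k) = iv z * (x * iv k)"
        by (metis mult.assoc)
      then show ?thesis
        using g k by (simp add: conj_def s_def mult.assoc cancel)
    qed
    ultimately show "\<Phi> g = \<Phi> k"
      unfolding \<Phi>_def by (rule cls_eq)
  qed
  have set: "{cls S y | y. y \<in> cls G x} = \<Phi> ` G"
    by (auto simp: clsG \<Phi>_def)
  define A where "A K = dt ` {g \<in> G. \<Phi> g = K}" for K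
  have Z1: "1 \<in> Z"
    using one by (simp add: Z_def)
  have cardA: "card (A K) = card (dt ` Z)" if "K \<in> \<Phi> ` G" for K
  proof -
    obtain k where k: "k \<in> G" "K = \<Phi> k"
      using \<open>K \<in> \<Phi> ` G\<close> by blast
    have "A K = (\<lambda>c. dt k * c) ` (dt ` Z)"
    proof (intro equalityI subsetI)
      fix c assume "c \<in> A K"
      then obtain g where g: "g \<in> G" "\<Phi> g = \<Phi> k" "c = dt g"
        using k by (auto simp: A_def)
      then obtain z where "z \<in> Z" "c = dt k * dt z"
        using key k(1) by auto
      then show "c \<in> (\<lambda>c. dt k * c) ` (dt ` Z)"
        by blast
    next
      fix c assume "c \<in> (\<lambda>c. dt k * c) ` (dt ` Z)"
      then obtain z where z: "z \<in> Z" "c = dt (k * z)"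
        by auto
      have "k * z \<in> G"
        using z k mult by (auto simp: Z_def)
      moreover have "\<Phi> (k * z) = \<Phi> k"
        using key[OF \<open>k * z \<in> G\<close> k(1)] z by auto
      ultimately show "c \<in> A K"
        using z k by (auto simp: A_def simp del: dt_mult)
    qed
    then show ?thesis
      using dt_nz[OF k(1)] by (simp add: card_image inj_on_def)
  qed
  have "dt ` G = (\<Union>K\<in>\<Phi> ` G. A K)"
    by (auto simp: A_def)
  then have "card (dt ` G) = (\<Sum>K\<in>\<Phi> ` G. card (A K))"
  proof (simp only:, intro card_UN_disjoint ballI impI)
    fix K L assume KL: "K \<in> \<Phi> ` G" "L \<in> \<Phi> ` G" "K \<noteq> L"
    show "A K \<inter> A L = {}"
    proof (rule ccontr)
      assume "A K \<inter> A L \<noteq> {}"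
      then obtain g k where "g \<in> G" "k \<in> G" "\<Phi> g = K" "\<Phi> k = L" "dt g = dt k"
        by (auto simp: A_def)
      then show False
        using key[of g k] Z1 KL(3) by (metis dt_one mult_1_right)
    qed
  qed auto
  also have "\<dots> = card (\<Phi> ` G) * card (dt ` Z)"
    using cardA by simp
  finally show ?thesis
    by (simp add: set)
qed

lemma conj_class_eq:
  assumes "\<And>g. g \<in> C \<Longrightarrow> invertible g"
  shows "conj_class C x = mat_of ` cls (of_mat ` C) (of_mat x)"
proof -
  have "y = g ** x ** matrix_inv g \<longleftrightarrow> y ** g = g ** x" if "g \<in> C" for y g
  proof -
    have "g ** matrix_inv g = mat 1 \<and> matrix_inv g ** g = mat 1"
      using someI_ex[OF assms[OF that, unfolded invertible_def]] unfolding matrix_inv_def .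
    then have inv: "g ** matrix_inv g = mat 1" "matrix_inv g ** g = mat 1"
      by blast+
    show ?thesis
    proof
      assume "y = g ** x ** matrix_inv g"
      then show "y ** g = g ** x"
        using inv by (metis matrix_mul_assoc matrix_mul_rid)
    next
      assume "y ** g = g ** x"
      then have "g ** x ** matrix_inv g = y ** (g ** matrix_inv g)"
        by (simp add: matrix_mul_assoc)
      then show "y = g ** x ** matrix_inv g"
        using inv by simp
    qed
  qed
  then have 1: "y \<in> conj_class C x \<longleftrightarrow> (\<exists>g\<in>C. y ** g = g ** x)" for y
    by (auto simp: conj_class_def)
  have 2: "y ** g = g ** x \<longleftrightarrow> of_mat y * of_mat g = of_mat g * of_mat x" for y g
    by (metis mat_of_inverse of_mat_inverse times_sqmat.rep_eq UNIV_I)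
  show ?thesis
  proof (intro equalityI subsetI)
    fix y assume "y \<in> conj_class C x"
    then have "of_mat y \<in> cls (of_mat ` C) (of_mat x)"
      by (auto simp: 1 2 cls_def)
    then show "y \<in> mat_of ` cls (of_mat ` C) (of_mat x)"
      by (metis UNIV_I image_eqI of_mat_inverse)
  next
    fix y assume "y \<in> mat_of ` cls (of_mat ` C) (of_mat x)"
    then obtain z g where "y = mat_of z" "g \<in> C" "z * of_mat g = of_mat g * of_mat x"
      by (auto simp: cls_def)
    then show "y \<in> conj_class C x"
      by (auto simp: 1 2 mat_of_inverse)
  qed
qed

lemma class_splits_into_iff:
  fixes C :: "('a::{field, finite} ^ 'n ^ 'n) set"
  assumes C: "\<And>g. g \<in> C \<Longrightarrow> invertible g" and G: "of_mat ` C = G"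
  shows "class_splits_into C (special_subgroup C) x r \<longleftrightarrow>
    card {cls {g \<in> G. dt g = 1} y | y. y \<in> cls G (of_mat x)} = r"
proof -
  have S: "of_mat ` special_subgroup C = {g \<in> G. dt g = 1}"
    using G by (auto simp: special_subgroup_def dt.rep_eq of_mat_inverse)
  have "{conj_class (special_subgroup C) y | y. y \<in> conj_class C x} =
    (\<lambda>K. mat_of ` K) ` {cls {g \<in> G. dt g = 1} y | y. y \<in> cls G (of_mat x)}"
  proof -
    have "conj_class (special_subgroup C) y = mat_of ` cls {g \<in> G. dt g = 1} (of_mat y)" for y
      using conj_class_eq[of "special_subgroup C"] C S by (simp add: special_subgroup_def)
    moreover have "conj_class C x = mat_of ` cls G (of_mat x)"
      using conj_class_eq[OF C] G by simp
    ultimately show ?thesis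
      by (simp add: setcompr_eq_image image_image mat_of_inverse)
  qed
  moreover have "inj (image mat_of :: ('a, 'n) sqmat set \<Rightarrow> _)"
    by (rule injI) (simp add: inj_image_eq_iff inj_def mat_of_inject)
  ultimately show ?thesis
    by (simp add: class_splits_into_def card_image inj_on_subset)
qed


section \<open>Determinants of centralizers in isometry groups\<close>

text \<open>By \<open>elementary_divisor_iff\<close>, this says that \<open>p ^ m\<close> is an elementary divisor of \<open>x\<close>; unlike the
  definition through a decomposition, it behaves well under direct summands and duality.\<close>

definition has_block :: "('a::field, 'n::finite) sqmat \<Rightarrow> 'a poly \<Rightarrow> nat \<Rightarrow> bool" where
  "has_block x p m \<longleftrightarrow>
    (\<exists>w. (pe x p ^ m) \<cdot> w = 0 \<and> (pe x p ^ (m - 1)) \<cdot> w \<notin> range (\<lambda>v. (pe x p ^ m) \<cdot> v))"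

text \<open>The absence of a block, put into the form of the divisibility hypothesis of
  \<open>subdet_is_power\<close>.\<close>

lemma not_has_block:
  assumes "\<not> has_block x p e" "e > 0" "pe x p \<cdot> w = 0" "w \<in> range (\<lambda>v. (pe x p ^ (e - 1)) \<cdot> v)"
  shows "w \<in> range (\<lambda>v. (pe x p ^ e) \<cdot> v)"
proof -
  obtain u where u: "w = (pe x p ^ (e - 1)) \<cdot> u"
    using assms(4) by blast
  have "(pe x p ^ e) \<cdot> u = 0"
    using assms(2,3) u by (cases e) simp_all
  then show ?thesis
    using assms(1) u unfolding has_block_def by blast
qed

text \<open>If \<open>p(0) = 0\<close>, then \<open>p\<close> is a scalar multiple of t, so
  \<open>p(x)\<close> is invertible and its powers kill only 0. This puts \<open>p\<close> into the
  domain where \<open>dual_poly\<close> is meaningful.\<close>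

lemma has_block_coeff:
  fixes x :: "('a::{field, finite}, 'n::finite) sqmat"
  assumes "has_block x p m" "monic_irreducible p" "dt x \<noteq> 0"
  shows "coeff p 0 \<noteq> 0"
proof
  assume "coeff p 0 = 0"
  then obtain c where c: "p = [:0, 1:] * c"
    by (cases p) simp
  have irr: "irreducible p"
    using assms(2) by (simp add: monic_irreducible_def)
  have "[:0, 1::'a:] dvd 1 \<or> c dvd 1"
    using irreducibleD[OF irr c] .
  then have "c dvd 1"
    by (simp add: is_unit_iff_degree)
  then obtain k where k: "c = [:k:]" "k \<noteq> 0"
    using is_unit_poly_iff[of c] by fastforce
  have "sc k * sc (inverse k) = (1 :: ('a, 'n) sqmat)"
    using k by (simp flip: sc_mult)
  then have "dt (sc k :: ('a, 'n) sqmat) \<noteq> 0"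
    by (rule dt_nonzeroI)
  then have "dt (pe x p) \<noteq> 0"
    using assms(3) by (simp add: c k)
  then have "dt (pe x p ^ m) \<noteq> 0"
    by simp
  then obtain b where b: "b * pe x p ^ m = 1"
    using dt_nonzeroE by blast
  obtain w where w: "(pe x p ^ m) \<cdot> w = 0" "(pe x p ^ (m - 1)) \<cdot> w \<notin> range (\<lambda>v. (pe x p ^ m) \<cdot> v)"
    using assms(1) unfolding has_block_def by blast
  have "w = 0"
    using w(1) b by (metis act_mult act_one act_zero)
  then show False
    using w(2) by (metis act_zero rangeI)
qed

section \<open>Duality of blocks, and cyclic summands adapted to the form\<close>

context sesquilinear
begin

text \<open>Non-degeneracy turns functionals into vectors: pairing with \<open>v\<close> kills the
  image of \<open>T ^ m\<close>, which means that \<open>adj T ^ m\<close> kills \<open>v\<close>,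
  but not the vector \<open>T ^ (m - 1) u\<close>. Such a functional is the input of
  \<open>cyclic_projection\<close>.\<close>

lemma ex_dual_vector:
  assumes "(T ^ (m - 1)) \<cdot> u \<notin> range (\<lambda>v. (T ^ m) \<cdot> v)"
  obtains v where "(adj T ^ m) \<cdot> v = 0" "h ((T ^ (m - 1)) \<cdot> u) v \<noteq> 0"
proof -
  obtain P where P: "is_proj P (range (\<lambda>v. (T ^ m) \<cdot> v))"
    using ex_proj subspace_image_act vec.subspace_UNIV by blast
  define s where "s = (T ^ (m - 1)) \<cdot> u"
  have "(1 - P) \<cdot> s \<noteq> 0"
  proof
    assume "(1 - P) \<cdot> s = 0"
    then have "s = P \<cdot> s" by simp
    then show False
      using P assms unfolding is_proj_def s_def by metis
  qed
  then obtain y where y: "h ((1 - P) \<cdot> s) y \<noteq> 0"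
    using nondeg by blast
  define v where "v = adj (1 - P) \<cdot> y"
  have "h w ((adj T ^ m) \<cdot> v) = 0" for w
  proof -
    have "h w ((adj T ^ m) \<cdot> v) = h ((1 - P) \<cdot> (T ^ m) \<cdot> w) y"
      by (simp only: v_def h_adj adj_power)
    also have "(1 - P) \<cdot> (T ^ m) \<cdot> w = 0"
      using P by (simp add: is_proj_def)
    finally show ?thesis by simp
  qed
  then have "(adj T ^ m) \<cdot> v = 0"
    by (rule nondeg_right)
  moreover have "h s v \<noteq> 0"
    using y unfolding v_def h_adj .
  ultimately show thesis
    using that s_def by blast
qed

text \<open>Since \<open>adj x\<close> is the inverse of \<open>x\<close>, reversing the
  coefficients of \<open>p\<close> amounts to replacing \<open>x\<close> by \<open>adj x\<close> and
  multiplying by \<open>x ^ degree p\<close>. With the scalar from \<open>dual_poly\<close>, this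
  power is the unit \<open>U\<close>.\<close>

lemma pe_dual_poly:
  assumes x: "x \<in> isom" and p: "coeff p 0 \<noteq> 0"
  obtains U where "dt U \<noteq> 0" "pe x (dual_poly bar p) = U * adj (pe x p)"
    "U * adj (pe x p) = adj (pe x p) * U"
proof
  define d where "d = degree p"
  define c where "c = inverse (bar (coeff p 0))"
  define U where "U = sc c * x ^ d"
  have "c \<noteq> 0"
    using p by (simp add: c_def)
  then have "sc c * sc (inverse c) = (1 :: ('a, 'n) sqmat)"
    by (simp flip: sc_mult)
  then have "dt (sc c :: ('a, 'n) sqmat) \<noteq> 0"
    by (rule dt_nonzeroI)
  then show "dt U \<noteq> 0"
    using isomD(5)[OF x] by (simp add: U_def)
  have xpow: "x ^ d * adj x ^ j = x ^ (d - j)" if "j \<le> d" for j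
  proof -
    have "x ^ j * adj x ^ j = 1"
      using isomD(2)[OF x] by (metis left_right_inverse_power)
    moreover have "x ^ d = x ^ (d - j) * x ^ j"
      using that by (simp flip: power_add)
    ultimately show ?thesis
      by (simp add: mult.assoc)
  qed
  define f where "f = map_poly bar (reflect_poly p)"
  have coeff_f: "coeff f i = (if i \<le> d then bar (coeff p (d - i)) else 0)" for i
    by (simp add: f_def coeff_map_poly coeff_reflect_poly d_def)
  have "degree f \<le> d"
    by (rule degree_le) (simp add: coeff_f)
  then have "f = (\<Sum>i\<le>d. monom (coeff f i) i)"
    by (simp add: poly_as_sum_of_monoms')
  then have "pe x f = (\<Sum>i\<le>d. sc (coeff f i) * x ^ i)"
    by (metis (no_types, lifting) pe_monom pe_sum sum.cong)
  also have "\<dots> = (\<Sum>i\<le>d. sc (bar (coeff p (d - i))) * x ^ i)"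
    by (simp add: coeff_f)
  also have "\<dots> = (\<Sum>j\<le>d. sc (bar (coeff p j)) * x ^ (d - j))"
    by (rule sum.reindex_bij_witness[of _ "\<lambda>i. d - i" "\<lambda>i. d - i"]) auto
  also have "\<dots> = (\<Sum>j\<le>d. x ^ d * (sc (bar (coeff p j)) * adj x ^ j))"
  proof (intro sum.cong refl)
    fix j assume "j \<in> {..d}"
    then have "x ^ (d - j) = x ^ d * adj x ^ j"
      using xpow by simp
    then have "sc (bar (coeff p j)) * x ^ (d - j) = (sc (bar (coeff p j)) * x ^ d) * adj x ^ j"
      by (simp add: mult.assoc)
    then show "sc (bar (coeff p j)) * x ^ (d - j) = x ^ d * (sc (bar (coeff p j)) * adj x ^ j)"
      by (simp only: sc_commute[of _ "x ^ d"] mult.assoc)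
  qed
  also have "\<dots> = x ^ d * pe (adj x) (map_poly bar p)"
  proof -
    have "degree (map_poly bar p) \<le> d"
      by (rule degree_le) (simp add: coeff_map_poly coeff_eq_0 d_def)
    then have "map_poly bar p = (\<Sum>i\<le>d. monom (coeff (map_poly bar p) i) i)"
      by (simp add: poly_as_sum_of_monoms')
    then have "pe (adj x) (map_poly bar p) = (\<Sum>i\<le>d. sc (coeff (map_poly bar p) i) * adj x ^ i)"
      by (metis (no_types, lifting) pe_monom pe_sum sum.cong)
    then show ?thesis
      by (simp add: coeff_map_poly sum_distrib_left)
  qed
  finally have "pe x f = x ^ d * adj (pe x p)"
    by (simp add: adj_pe)
  then show "pe x (dual_poly bar p) = U * adj (pe x p)"
    by (simp add: dual_poly_def pe_smult U_def mult.assoc flip: f_def c_def)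
  obtain f' where f': "adj (pe x p) = pe x f'"
    using adj_pe_is_pe[OF x] by blast
  have "x ^ d * pe x f' = pe x f' * x ^ d"
    by (intro pe_commute) (simp add: power_commutes)
  then show "U * adj (pe x p) = adj (pe x p) * U"
    unfolding U_def f' by (intro commute_mult sc_commute)
qed

lemma ker_adj_power:
  assumes "x \<in> isom" "coeff p 0 \<noteq> 0"
  shows "(adj (pe x p) ^ m) \<cdot> v = 0 \<longleftrightarrow> (pe x (dual_poly bar p) ^ m) \<cdot> v = 0"
proof -
  obtain U where U: "dt U \<noteq> 0" "pe x (dual_poly bar p) = U * adj (pe x p)"
    "U * adj (pe x p) = adj (pe x p) * U"
    using pe_dual_poly assms by blast
  have eq: "pe x (dual_poly bar p) ^ m = U ^ m * adj (pe x p) ^ m"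
    using U(2,3) power_mult_commuting by metis
  have "dt (U ^ m) \<noteq> 0"
    using U(1) by simp
  then obtain B where "B * U ^ m = 1"
    using dt_nonzeroE by blast
  then show ?thesis
    unfolding eq by (metis act_mult act_one act_zero)
qed

text \<open>The vector \<open>v\<close> paired with the socle of \<open>u\<close> spans the dual
  block: if \<open>adj T ^ (m - 1)\<close> took it into the image of \<open>adj T ^ m\<close>, the
  pairing would equal one with \<open>T ^ m u = 0\<close>. Hence it does not matter which factor
  \<open>SOME\<close> picks in \<open>gen_elementary_divisor_mult\<close>.\<close>

lemma has_block_dual:
  assumes x: "x \<in> isom" and p: "coeff p 0 \<noteq> 0" and block: "has_block x p m"
  shows "has_block x (dual_poly bar p) m"
proof -
  define T where "T = pe x p"
  obtain u where u: "(T ^ m) \<cdot> u = 0" "(T ^ (m - 1)) \<cdot> u \<notin> range (\<lambda>v. (T ^ m) \<cdot> v)"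
    using block unfolding has_block_def T_def by blast
  obtain v where v: "(adj T ^ m) \<cdot> v = 0" "h ((T ^ (m - 1)) \<cdot> u) v \<noteq> 0"
    using ex_dual_vector u(2) by blast
  obtain U where U: "dt U \<noteq> 0" "pe x (dual_poly bar p) = U * adj T" "U * adj T = adj T * U"
    using pe_dual_poly[OF x p] unfolding T_def by blast
  have Uj: "(U * adj T) ^ j = U ^ j * adj T ^ j" for j
    using U(3) by (rule power_mult_commuting)
  have "(pe x (dual_poly bar p) ^ (m - 1)) \<cdot> v \<notin> range (\<lambda>v. (pe x (dual_poly bar p) ^ m) \<cdot> v)"
  proof
    assume "(pe x (dual_poly bar p) ^ (m - 1)) \<cdot> v \<in> range (\<lambda>v. (pe x (dual_poly bar p) ^ m) \<cdot> v)"
    then obtain y where y: "(U ^ (m - 1)) \<cdot> (adj T ^ (m - 1)) \<cdot> v = (U ^ m) \<cdot> (adj T ^ m) \<cdot> y"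
      by (auto simp: U(2) Uj)
    have "dt (U ^ (m - 1)) \<noteq> 0"
      using U(1) by simp
    then obtain B where B: "B * U ^ (m - 1) = 1"
      using dt_nonzeroE by blast
    have "(B * U ^ m) * adj T ^ m = adj T ^ m * (B * U ^ m)"
    proof -
      have comm: "U ^ j * adj T ^ m = adj T ^ m * U ^ j" for j
        using power_commuting_commutes[OF power_commute[OF U(3)]] .
      have "B * adj T ^ m = adj T ^ m * B"
        using inverse_commute[OF mult_eq_1_commute[OF B] B comm] .
      then show ?thesis
        using comm by (rule commute_mult)
    qed
    then have "(adj T ^ (m - 1)) \<cdot> v = (adj T ^ m) \<cdot> (B * U ^ m) \<cdot> y"
    proof -
      have "(adj T ^ (m - 1)) \<cdot> v = B \<cdot> (U ^ (m - 1)) \<cdot> (adj T ^ (m - 1)) \<cdot> v"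
        using B by (metis act_mult act_one)
      also have "\<dots> = ((B * U ^ m) * adj T ^ m) \<cdot> y"
        by (simp only: y act_mult)
      also have "\<dots> = (adj T ^ m * (B * U ^ m)) \<cdot> y"
        by (simp only: \<open>B * U ^ m * adj T ^ m = _\<close>)
      finally show ?thesis
        by (simp only: act_mult)
    qed
    then have "h ((T ^ (m - 1)) \<cdot> u) v = h ((T ^ m) \<cdot> u) ((B * U ^ m) \<cdot> y)"
      by (simp only: h_adj adj_power)
    then show False
      using v u by simp
  qed
  moreover have "(pe x (dual_poly bar p) ^ m) \<cdot> v = 0"
    using ker_adj_power[OF x p] v(1) by (simp add: T_def)
  ultimately show ?thesis
    unfolding has_block_def by blast
qed

lemma ex_pairing_projection:
  assumes p: "monic_irreducible p" and m: "m > 0" and u: "(pe x p ^ m) \<cdot> u = 0"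
    and v: "(adj (pe x p) ^ m) \<cdot> v = 0" and uv: "h ((pe x p ^ (m - 1)) \<cdot> u) v \<noteq> 0"
  obtains e where "e * e = e" "e * x = x * e" "is_proj e (cyc x u)" "is_ann x u (p ^ m)"
    "\<And>w. e \<cdot> w = 0 \<longleftrightarrow> (\<forall>f. h (pe x f \<cdot> w) v = 0)"
proof -
  have ann: "is_ann x u (p ^ m)"
    using uv by (intro is_ann_power p m u) auto
  show thesis
  proof (rule cyclic_projection[of p m x u "\<lambda>w. h w v"])
    show "h ((pe x p ^ m) \<cdot> w) v = 0" for w
      by (simp add: h_adj adj_power v)
    fix e
    assume "e * e = e" "e * x = x * e" "is_proj e (cyc x u)"
      "\<And>w. (e \<cdot> w = 0) = (\<forall>f. h (pe x f \<cdot> w) v = 0)"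
    then show thesis
      using that ann by blast
  qed (use p m u uv in \<open>simp_all add: h_add h_scale\<close>)
qed

text \<open>When \<open>v\<close> is paired with its own socle generator, the kernel of the
  projection is the orthogonal complement of \<open>cyc x v\<close>, because adjoints of polynomials
  in \<open>x\<close> are polynomials in \<open>x\<close>; so the projection is orthogonal.\<close>

lemma ex_selfadjoint_projection:
  assumes x: "x \<in> isom" and p: "monic_irreducible p" and m: "m > 0" and v: "(pe x p ^ m) \<cdot> v = 0"
    and v': "(adj (pe x p) ^ m) \<cdot> v = 0" and vv: "h ((pe x p ^ (m - 1)) \<cdot> v) v \<noteq> 0"
  obtains e where "e * e = e" "e * x = x * e" "is_proj e (cyc x v)" "is_ann x v (p ^ m)" "adj e = e"
proof -
  obtain e where e: "e * e = e" "e * x = x * e" "is_proj e (cyc x v)" "is_ann x v (p ^ m)"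
    and ker: "\<And>w. e \<cdot> w = 0 \<longleftrightarrow> (\<forall>f. h (pe x f \<cdot> w) v = 0)"
    using ex_pairing_projection[OF p m v v' vv] by blast
  have orth: "h w (e \<cdot> u) = 0" if "e \<cdot> w = 0" for u w
  proof -
    obtain f where f: "e \<cdot> u = pe x f \<cdot> v"
      using e(3) by (auto simp: is_proj_def cyc_def)
    obtain f' where f': "adj (pe x f) = pe x f'"
      using adj_pe_is_pe[OF x] by blast
    have "h w (pe x f \<cdot> v) = h (pe x f' \<cdot> w) v"
      using h_adj'[of w "pe x f" v] f' by simp
    then show ?thesis
      using ker that f by simp
  qed
  have ee: "e \<cdot> (w - e \<cdot> w) = 0" for w
    using e(1) by (simp flip: act_mult)
  have "adj e = e"
  proof (rule adj_eqI)
    fix u w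
    have "h (w - e \<cdot> w) (e \<cdot> u) = 0" "h (u - e \<cdot> u) (e \<cdot> w) = 0"
      using orth[OF ee] by auto
    then have "h (e \<cdot> u) (w - e \<cdot> w) = 0" "h (u - e \<cdot> u) (e \<cdot> w) = 0"
      using h_eq_0_commute by blast+
    then show "h (e \<cdot> u) w = h u (e \<cdot> w)"
      by (simp add: h_diff h_diff_right)
  qed
  then show thesis
    using that e by blast
qed

text \<open>The isometry is \<open>y\<close> times the inverse of \<open>adj y\<close>; it is one
  because \<open>y\<close> is normal.\<close>

lemma isom_quotient:
  assumes y: "y * adj y = adj y * y" "dt y \<noteq> 0" and yx: "y * x = x * y" "adj y * x = x * adj y"
  shows "\<exists>g\<in>isom. g * x = x * g \<and> dt g * bar (dt y) = dt y"
proof -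
  have "dt (adj y) \<noteq> 0"
    using y(2) by (simp add: dt_adj)
  then obtain z where z: "adj y * z = 1" "z * adj y = 1"
    using dt_nonzeroE by blast
  have zadj: "adj z * y = 1"
    using arg_cong[OF z(1), of adj] by (simp add: adj_mult)
  define g where "g = y * z"
  have "adj g * g = adj z * (adj y * y) * z"
    by (simp add: g_def adj_mult mult.assoc)
  also have "\<dots> = (adj z * y) * (adj y * z)"
    by (simp add: mult.assoc flip: y(1))
  finally have "g \<in> isom"
    by (simp add: isom_def zadj z)
  moreover have "g * x = x * g"
    unfolding g_def using yx(1) inverse_commute[OF z yx(2)] by (rule commute_mult)
  moreover have "dt g * bar (dt y) = dt y"
  proof -
    have "dt z * dt (adj y) = 1"
      using z by (metis dt_mult dt_one)
    then show ?thesis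
      by (simp add: g_def dt_adj mult.assoc)
  qed
  ultimately show ?thesis by blast
qed

text \<open>If \<open>h (S w) w\<close> vanished on \<open>K\<close>, inserting
  \<open>c u + v\<close> would give \<open>c A + bar c B = 0\<close> for all \<open>c\<close>, where
  \<open>A\<close> is the given nonzero value. Then \<open>c = 1\<close> yields
  \<open>B = - A\<close>, and \<open>c = a\<close> yields \<open>(a - bar a) A = 0\<close>. This is
  valid in every characteristic, so even \<open>q\<close> is covered.\<close>

lemma sesquilinear_polarization:
  assumes bar: "bar a \<noteq> a" and uv: "h (S \<cdot> u) v \<noteq> 0"
    and K: "vec.subspace K" "u \<in> K" "v \<in> K"
  shows "\<exists>w\<in>K. h (S \<cdot> w) w \<noteq> 0"
proof (rule ccontr)
  assume "\<not> ?thesis"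
  then have 0: "h (S \<cdot> w) w = 0" if "w \<in> K" for w
    using that by blast
  have "c * h (S \<cdot> u) v + bar c * h (S \<cdot> v) u = 0" for c
  proof -
    have "c *s u + v \<in> K"
      using K by (simp add: vec.subspace_add vec.subspace_scale)
    then have "h (S \<cdot> (c *s u + v)) (c *s u + v) = 0"
      by (rule 0)
    moreover have "h (S \<cdot> u) u = 0" "h (S \<cdot> v) v = 0"
      using 0 K by auto
    ultimately show ?thesis
      by (simp add: h_add h_add_right h_scale h_scale_right add.commute)
  qed
  from this[of 1] this[of a] have "h (S \<cdot> v) u = - h (S \<cdot> u) v" "a * h (S \<cdot> u) v + bar a * h (S \<cdot> v) u = 0"
    by (simp_all add: eq_neg_iff_add_eq_0 add.commute)
  then have "(a - bar a) * h (S \<cdot> u) v = 0"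
    by (simp add: algebra_simps)
  then show False
    using bar uv by simp
qed

lemma monic_dual_poly:
  assumes "coeff p 0 \<noteq> 0"
  shows "lead_coeff (dual_poly bar p) = 1" "degree (dual_poly bar p) = degree p"
proof -
  define f where "f = map_poly bar (reflect_poly p)"
  have coeff_f: "coeff f i = (if i \<le> degree p then bar (coeff p (degree p - i)) else 0)" for i
    by (simp add: f_def coeff_map_poly coeff_reflect_poly)
  have "degree f \<le> degree p"
    by (rule degree_le) (simp add: coeff_f)
  moreover have "coeff f (degree p) = bar (coeff p 0)"
    by (simp add: coeff_f)
  ultimately have deg: "degree f = degree p"
    using assms by (metis bar_eq_0_iff le_antisym le_degree)
  then show "degree (dual_poly bar p) = degree p"
    using assms by (simp add: dual_poly_def flip: f_def)
  then show "lead_coeff (dual_poly bar p) = 1"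
    using assms by (simp add: dual_poly_def coeff_f flip: f_def)
qed

text \<open>Let \<open>y\<close> act as \<open>f(x)\<close> on a cyclic summand and as 1 on its
  complement, with \<open>f\<close> chosen for the determinant \<open>c ^ m\<close>. For
  \<open>isom_quotient\<close> it must commute with its adjoint. For self-dual \<open>p\<close> the
  projection \<open>e\<close> onto the summand can be chosen self-adjoint; otherwise
  \<open>e * adj e = adj e * e = 0\<close>, so that \<open>y\<close> and \<open>adj y\<close> act on
  independent summands.\<close>

lemma ex_unitary_centralizer:
  assumes bar: "bar a \<noteq> a" and x: "x \<in> isom" and p: "monic_irreducible p" and m: "m > 0"
    and block: "has_block x p m" and c: "c \<noteq> 0"
  shows "\<exists>g\<in>isom. g * x = x * g \<and> dt g * bar (c ^ m) = c ^ m"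
proof -
  define T where "T = pe x p"
  have p0: "coeff p 0 \<noteq> 0"
    using has_block_coeff[OF block p isomD(5)[OF x]] .
  obtain u where u: "(T ^ m) \<cdot> u = 0" "(T ^ (m - 1)) \<cdot> u \<notin> range (\<lambda>v. (T ^ m) \<cdot> v)"
    using block unfolding has_block_def T_def by blast
  obtain v where v: "(adj T ^ m) \<cdot> v = 0" "h ((T ^ (m - 1)) \<cdot> u) v \<noteq> 0"
    using ex_dual_vector u(2) by blast
  have pe_x: "pe x f * x = x * pe x f" for f
    using pe_commute[of x x f] by simp
  have reduce: ?thesis
    if e: "e * e = e" "e * x = x * e" "is_proj e (cyc x w)" "is_ann x w (p ^ m)"
      and ee: "\<And>f. (1 + (pe x f - 1) * e) * adj (1 + (pe x f - 1) * e) =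
        adj (1 + (pe x f - 1) * e) * (1 + (pe x f - 1) * e)" for e w
  proof -
    obtain f where f: "subdet (pe x f) (cyc x w) = c ^ m"
      using ex_subdet_cyc[OF p e(4) m c] by blast
    define y where "y = 1 + (pe x f - 1) * e"
    have "dt y = c ^ m"
      using subdet_eq[OF e(3) invar_pe_cyc subspace_cyc, of f] f by (simp add: y_def)
    moreover have "y * x = x * y"
    proof -
      have "(pe x f - 1) * x = x * (pe x f - 1)"
        using pe_x[of f] by (simp add: algebra_simps)
      from commute_mult[OF this e(2)] show ?thesis
        by (simp add: y_def distrib_left distrib_right)
    qed
    moreover have "adj y * x = x * adj y"
    proof -
      have "y * adj x = adj x * y"
        using commute_adj[OF x \<open>y * x = x * y\<close>] .
      then show ?thesis
        by (metis adj_adj adj_mult)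
    qed
    moreover have "y * adj y = adj y * y"
      unfolding y_def by (rule ee)
    ultimately show ?thesis
      using isom_quotient[of y x] c by simp
  qed
  show ?thesis
  proof (cases "dual_poly bar p = p")
    case True
    have ker: "(adj T ^ m) \<cdot> w = 0 \<longleftrightarrow> (T ^ m) \<cdot> w = 0" for w
      unfolding T_def using ker_adj_power[OF x p0] True by simp
    \<comment> \<open>Self-duality puts \<open>u\<close> and \<open>v\<close> into the same kernel,
      where polarization finds one vector paired with its own socle generator.\<close>
    obtain w where w: "(T ^ m) \<cdot> w = 0" "h ((T ^ (m - 1)) \<cdot> w) w \<noteq> 0"
      using sesquilinear_polarization[OF bar v(2) subspace_ker[of "T ^ m"]] u v ker by blast
    obtain e where e: "e * e = e" "e * x = x * e" "is_proj e (cyc x w)" "is_ann x w (p ^ m)" "adj e = e"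
      using ex_selfadjoint_projection[OF x p m, of w] w ker unfolding T_def by blast
    show ?thesis
    proof (rule reduce[OF e(1-4)])
      fix f
      obtain f' where f': "adj (pe x f) = pe x f'"
        using adj_pe_is_pe[OF x] by blast
      have ef: "e \<cdot> pe x f \<cdot> v = pe x f \<cdot> e \<cdot> v" for f v
        using pe_commute[OF e(2)] by (metis act_mult)
      have ee: "e \<cdot> e \<cdot> v = e \<cdot> v" for v
        using e(1) by (metis act_mult)
      show "(1 + (pe x f - 1) * e) * adj (1 + (pe x f - 1) * e) =
        adj (1 + (pe x f - 1) * e) * (1 + (pe x f - 1) * e)"
        by (rule sqmat_eqI)
          (simp add: adj_add adj_mult adj_diff f' e(5) ef ee pe_act_commute[of x f' f] algebra_simps)
    qed
  next
    case False
    define r where "r = dual_poly bar p"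
    have irr: "irreducible p" and pm: "lead_coeff p = 1"
      using p by (auto simp: monic_irreducible_def)
    have "\<not> p dvd r"
    proof
      assume "p dvd r"
      then obtain k where k: "r = p * k"
        by (auto elim: dvdE)
      have r: "lead_coeff r = 1" "degree r = degree p"
        using monic_dual_poly[OF p0] by (auto simp: r_def)
      then have "k \<noteq> 0" "p \<noteq> 0"
        using k by auto
      then have "degree k = 0"
        using r k by (simp add: degree_mult_eq)
      then obtain k0 where "k = [:k0:]"
        by (rule degree_eq_zeroE)
      then have "k = 1"
        using r(1) k pm by (cases "k0 = 0") (auto simp: one_pCons)
      then show False
        using False k by (simp add: r_def)
    qed
    then have "\<not> p dvd r ^ m"
      using prime_elem_monic_irreducible[OF p] prime_elem_dvd_power by blast
    then obtain s t where st: "s * p ^ m + t * r ^ m = 1"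
      using ex_bezout_power[OF irr] by blast
    define T' where "T' = pe x r"
    have split: "w = pe x s \<cdot> (T ^ m) \<cdot> w + pe x t \<cdot> (T' ^ m) \<cdot> w" for w
    proof -
      have "pe x (s * p ^ m + t * r ^ m) \<cdot> w = w"
        by (simp only: st pe_1 act_one)
      then show ?thesis
        by (simp add: pe_add pe_mult pe_power T_def T'_def)
    qed
    have ker: "(adj T ^ m) \<cdot> w = 0 \<longleftrightarrow> (T' ^ m) \<cdot> w = 0" for w
      unfolding T_def T'_def r_def by (rule ker_adj_power[OF x p0])
    obtain U where U: "pe x r = U * adj T" "U * adj T = adj T * U"
      using pe_dual_poly[OF x p0] unfolding r_def T_def by metis
    have T'm: "T' ^ m = adj T ^ m * U ^ m"
      using U power_mult_commuting[of "adj T" U] unfolding T'_def by metis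
    have comm: "pe x f \<cdot> (T' ^ m) \<cdot> w = (T' ^ m) \<cdot> pe x f \<cdot> w"
      "pe x f \<cdot> (T ^ m) \<cdot> w = (T ^ m) \<cdot> pe x f \<cdot> w" for f w
      unfolding T'_def T_def pe_power[symmetric] by (rule pe_act_commute)+
    \<comment> \<open>On the kernel of \<open>T ^ m\<close> the coprime \<open>T' ^ m\<close> is
      invertible, so this kernel lies in the image of \<open>adj T ^ m\<close>, which is orthogonal
      to it.\<close>
    have isotropic: "h w w' = 0" if "(T ^ m) \<cdot> w = 0" "(T ^ m) \<cdot> w' = 0" for w w'
    proof -
      have "w = (T' ^ m) \<cdot> pe x t \<cdot> w"
        using split[of w] that(1) by (simp add: comm)
      then obtain y where "w = (adj T ^ m) \<cdot> y"
        unfolding T'm by (metis act_mult)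
      then have "h w w' = h y ((T ^ m) \<cdot> w')"
        by (simp add: h_adj adj_power)
      then show ?thesis
        by (simp add: that)
    qed
    have isotropic': "h w w' = 0" if "(T' ^ m) \<cdot> w = 0" "(T' ^ m) \<cdot> w' = 0" for w w'
    proof -
      have "w = (T ^ m) \<cdot> pe x s \<cdot> w"
        using split[of w] that(1) by (simp add: comm)
      then have "h w w' = h (pe x s \<cdot> w) ((adj T ^ m) \<cdot> w')"
        by (metis h_adj adj_power)
      moreover have "(adj T ^ m) \<cdot> w' = 0"
        using ker that(2) by blast
      ultimately show ?thesis
        by simp
    qed
    obtain e where e: "e * e = e" "e * x = x * e" "is_proj e (cyc x u)" "is_ann x u (p ^ m)"
      by (rule ex_pairing_projection[OF p m u(1)[unfolded T_def] v[unfolded T_def]]) (rule that)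
    have Te: "T ^ m * e = 0"
    proof (rule sqmat_eqI)
      fix w
      obtain f where "e \<cdot> w = pe x f \<cdot> u"
        using e(3) by (auto simp: is_proj_def cyc_def)
      then show "(T ^ m * e) \<cdot> w = 0 \<cdot> w"
        using u(1) by (simp flip: comm)
    qed
    have "adj e * e = 0"
    proof (rule sqmat_eqI)
      fix w
      have "h w' ((adj e * e) \<cdot> w) = 0" for w'
        using isotropic[of "e \<cdot> w'" "e \<cdot> w"] Te by (simp add: h_adj flip: act_mult)
      then show "(adj e * e) \<cdot> w = 0 \<cdot> w"
        using nondeg_right by simp
    qed
    have "e * T = T * e"
      unfolding T_def by (rule pe_commute[OF e(2)])
    then have "e * T ^ m = 0"
      using Te by (metis power_commuting_commutes)
    then have "adj T ^ m * adj e = 0"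
      by (metis adj_0 adj_mult adj_power)
    then have T'e: "(T' ^ m) \<cdot> adj e \<cdot> w = 0" for w
      using ker by (metis act_mult act_zero_left)
    have "e * adj e = 0"
    proof (rule sqmat_eqI)
      fix w
      have "h w' ((e * adj e) \<cdot> w) = 0" for w'
        using isotropic'[OF T'e T'e, of w' w] by (simp add: h_adj')
      then show "(e * adj e) \<cdot> w = 0 \<cdot> w"
        using nondeg_right by simp
    qed
    show ?thesis
    proof (rule reduce[OF e])
      fix f
      obtain f' where f': "adj (pe x f) = pe x f'"
        using adj_pe_is_pe[OF x] by blast
      have ex: "e * adj x = adj x * e"
        using commute_adj[OF x e(2)] .
      have 1: "adj e * x = x * adj e"
        using ex by (metis adj_adj adj_mult)
      have ef: "e \<cdot> pe x f \<cdot> v = pe x f \<cdot> e \<cdot> v" "adj e \<cdot> pe x f \<cdot> v = pe x f \<cdot> adj e \<cdot> v" for f v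
        using pe_commute[OF e(2)] pe_commute[OF 1] by (metis act_mult)+
      have 0: "e \<cdot> adj e \<cdot> v = 0" "adj e \<cdot> e \<cdot> v = 0" for v
        using \<open>e * adj e = 0\<close> \<open>adj e * e = 0\<close> by (metis act_mult act_zero_left)+
      show "(1 + (pe x f - 1) * e) * adj (1 + (pe x f - 1) * e) =
        adj (1 + (pe x f - 1) * e) * (1 + (pe x f - 1) * e)"
        by (rule sqmat_eqI)
          (simp add: adj_add adj_mult adj_diff f' ef 0 pe_act_commute[of x f' f] algebra_simps)
    qed
  qed
qed

lemma dt_unitary_centralizer:
  assumes bar: "bar a \<noteq> a" and x: "x \<in> isom" and g: "g \<in> isom" and gx: "g * x = x * g"
    and R: "R > 0" "\<And>p m. monic_irreducible p \<Longrightarrow> m > 0 \<Longrightarrow> has_block x p m \<Longrightarrow> R dvd m"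
  shows "\<exists>z. z \<noteq> 0 \<and> dt g * bar (z ^ R) = z ^ R"
proof -
  \<comment> \<open>A nonzero scalar with \<open>bar \<tau> = - \<tau>\<close>, which makes the sign
    \<open>\<epsilon>\<close> in \<open>cayley\<close> equal to 1; it exists because
    \<open>bar\<close> is not trivial.\<close>
  define \<tau> where "\<tau> = a - bar a"
  have \<tau>: "\<tau> \<noteq> 0" "bar \<tau> = - 1 * \<tau>"
    using bar by (auto simp: \<tau>_def bar_diff)
  obtain N where N: "N > 0" "(g - 1) ^ N * (g - 1) ^ N = (g - 1) ^ N"
    using ex_idempotent_power by blast
  define E where "E = (g - 1) ^ N"
  define y where "y = sc \<tau> * (g - 1) * E + (1 - E)"
  note cayley = cayley[OF g N \<tau>, folded E_def, folded y_def]
  have gT: "(g - 1) * x = x * (g - 1)"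
    using gx by (simp add: algebra_simps)
  then have Ex: "E * x = x * E"
    unfolding E_def by (metis power_commuting_commutes)
  have yx: "y * x = x * y"
  proof (rule sqmat_eqI)
    fix v
    have "g \<cdot> x \<cdot> v = x \<cdot> g \<cdot> v" "E \<cdot> x \<cdot> v = x \<cdot> E \<cdot> v" for v
      using gx Ex by (metis act_mult)+
    then show "(y * x) \<cdot> v = (x * y) \<cdot> v"
      by (simp add: y_def)
  qed
  have "\<exists>z. subdet y UNIV = z ^ R \<and> (\<forall>k. y ^ k = 1 \<longrightarrow> z ^ k = 1)"
  proof (rule subdet_is_power[OF yx R(1)])
    fix p e w
    assume p: "monic_irreducible p" "\<not> R dvd e" "pe x p \<cdot> w = 0" "w \<in> range (\<lambda>v. (pe x p ^ (e - 1)) \<cdot> v)"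
    then have "e > 0"
      by (cases e) auto
    then show "w \<in> range (\<lambda>v. (pe x p ^ e) \<cdot> v)"
      using not_has_block[of x p e w] p R(2) by blast
  qed (auto simp: invar_def)
  then obtain z where z: "dt y = z ^ R"
    by (auto simp: subdet_UNIV)
  have "z \<noteq> 0"
    using cayley(1) z R(1) by auto
  moreover have "dt g * bar (z ^ R) = z ^ R"
    using cayley(2,3) z by (simp add: mult.commute mult.left_commute)
  ultimately show ?thesis by blast
qed

text \<open>The vectors \<open>T ^ (m - 1) w\<close> in question are eigenvectors of
  \<open>x\<close> for \<open>\<epsilon>\<close>, so moving \<open>T ^ (m - 1)\<close> to the other
  argument of \<open>h\<close> costs the sign \<open>(- 1) ^ (m - 1)\<close>. For odd
  \<open>m\<close> the form \<open>h (T ^ (m - 1) w) w'\<close> on the kernel of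
  \<open>T ^ m\<close> is thus symmetric, and as \<open>2 \<noteq> 0\<close> it is not alternating.
  A vector \<open>w\<close> with nonzero value spans a non-degenerate cyclic summand of dimension
  \<open>m\<close>, on which \<open>- 1\<close> has determinant \<open>- 1\<close>.\<close>

lemma ex_orthogonal_centralizer:
  assumes bar: "\<And>a. bar a = a" and two: "(2::'a) \<noteq> 0" and x: "x \<in> isom" and \<epsilon>: "\<epsilon> * \<epsilon> = 1"
    and m: "odd m" and block: "has_block x [:- \<epsilon>, 1:] m"
  shows "\<exists>g\<in>isom. g * x = x * g \<and> dt g = - 1"
proof -
  define p where "p = [:- \<epsilon>, 1:]"
  define T where "T = pe x p"
  have p: "monic_irreducible p"
    unfolding p_def by (rule monic_irreducible_linear)
  have T: "T \<cdot> w = x \<cdot> w - \<epsilon> *s w" for w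
    by (simp add: T_def p_def sc_uminus)
  have m0: "m > 0"
    using m by (cases m) auto
  \<comment> \<open>This is
    \<open>adj x - \<epsilon> = - \<epsilon> * adj x * (x - \<epsilon>)\<close>, by
    \<open>\<epsilon> * \<epsilon> = 1\<close>.\<close>
  have adjT: "adj T = sc (- \<epsilon>) * adj x * T"
  proof (rule sqmat_eqI)
    fix w
    have "adj T \<cdot> w = adj x \<cdot> w - \<epsilon> *s w"
      by (simp add: T_def p_def adj_add adj_diff adj_sc bar sc_uminus)
    then show "adj T \<cdot> w = (sc (- \<epsilon>) * adj x * T) \<cdot> w"
      using \<epsilon> by (simp add: T isomD[OF x] vec.scale_right_diff_distrib)
  qed
  have xT: "x * T = T * x"
    unfolding T_def by (rule pe_commute) simp
  have axT: "adj x * T = T * adj x"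
    using commute_adj[OF x, of T] xT by simp
  define W where "W = sc (- \<epsilon>) * adj x"
  have WT: "W * T = T * W"
    unfolding W_def by (rule commute_mult[OF sc_commute axT])
  have adjTj: "adj T ^ j = W ^ j * T ^ j" for j
    unfolding adjT W_def[symmetric] using WT by (rule power_mult_commuting)
  have ker: "(adj T ^ m) \<cdot> w = 0" if "(T ^ m) \<cdot> w = 0" for w
    using that by (simp add: adjTj)
  have ker': "(T ^ m) \<cdot> w = 0" if "(adj T ^ m) \<cdot> w = 0" for w
  proof -
    have "dt (sc (- \<epsilon>) :: ('a, 'n) sqmat) \<noteq> 0"
      using \<epsilon> by (intro dt_nonzeroI(1)[of _ "sc (- \<epsilon>)"]) (simp flip: sc_mult)
    then have "dt (W ^ m) \<noteq> 0"
      using isomD(5)[OF x] bar by (simp add: W_def dt_adj)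
    then obtain B where "B * W ^ m = 1"
      using dt_nonzeroE by blast
    then show ?thesis
      using that unfolding adjTj by (metis act_mult act_one act_zero)
  qed
  obtain u where u: "(T ^ m) \<cdot> u = 0" "(T ^ (m - 1)) \<cdot> u \<notin> range (\<lambda>v. (T ^ m) \<cdot> v)"
    using block unfolding has_block_def T_def p_def by blast
  obtain v where v: "(adj T ^ m) \<cdot> v = 0" "h ((T ^ (m - 1)) \<cdot> u) v \<noteq> 0"
    using ex_dual_vector u(2) by blast
  have sym: "h ((T ^ (m - 1)) \<cdot> w) w' = h ((T ^ (m - 1)) \<cdot> w') w" if "(T ^ m) \<cdot> w' = 0" for w w'
  proof -
    define s where "s = (T ^ (m - 1)) \<cdot> w'"
    have "T \<cdot> s = (T ^ m) \<cdot> w'"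
      using m0 by (cases m) (simp_all add: s_def)
    then have "x \<cdot> s = \<epsilon> *s s"
      using that T by simp
    then have "adj x \<cdot> x \<cdot> s = \<epsilon> *s (adj x \<cdot> s)"
      by simp
    then have "s = \<epsilon> *s (adj x \<cdot> s)"
      by (simp only: isomD[OF x])
    then have "\<epsilon> *s s = \<epsilon> *s (\<epsilon> *s (adj x \<cdot> s))"
      by (rule arg_cong)
    then have "\<epsilon> *s s = (\<epsilon> * \<epsilon>) *s (adj x \<cdot> s)"
      by (simp only: vec.scale_scale)
    then have "adj x \<cdot> s = \<epsilon> *s s"
      using \<epsilon> by simp
    then have Ws: "W \<cdot> s = - s"
      using \<epsilon> by (simp add: W_def)
    have "(W ^ (2 * j)) \<cdot> s = s" for j
      by (induction j) (simp_all add: Ws)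
    moreover obtain j where "m = 2 * j + 1"
      using m by (elim oddE)
    ultimately have "(W ^ (m - 1)) \<cdot> s = s"
      by simp
    then have "(adj T ^ (m - 1)) \<cdot> w' = s"
      by (simp add: adjTj s_def)
    then have "h ((T ^ (m - 1)) \<cdot> w) w' = h w s"
      by (simp add: h_adj adj_power)
    then show ?thesis
      using h_sym[of w s] bar by (simp add: s_def)
  qed
  have "\<exists>w. (T ^ m) \<cdot> w = 0 \<and> h ((T ^ (m - 1)) \<cdot> w) w \<noteq> 0"
  proof (rule ccontr)
    assume "\<not> ?thesis"
    then have 0: "h ((T ^ (m - 1)) \<cdot> w) w = 0" if "(T ^ m) \<cdot> w = 0" for w
      using that by blast
    have "h ((T ^ (m - 1)) \<cdot> (u + v)) (u + v) = 0"
      using u v ker' by (intro 0) simp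
    moreover have "h ((T ^ (m - 1)) \<cdot> u) u = 0" "h ((T ^ (m - 1)) \<cdot> v) v = 0"
      using 0 u v ker' by blast+
    ultimately have "h ((T ^ (m - 1)) \<cdot> u) v + h ((T ^ (m - 1)) \<cdot> v) u = 0"
      by (simp add: h_add h_add_right add.commute)
    then have "2 * h ((T ^ (m - 1)) \<cdot> u) v = 0"
      using sym[of v u] ker'[OF v(1)] by simp
    then show False
      using two v by simp
  qed
  then obtain w where w: "(T ^ m) \<cdot> w = 0" "h ((T ^ (m - 1)) \<cdot> w) w \<noteq> 0"
    by blast
  obtain e where e: "e * e = e" "e * x = x * e" "is_proj e (cyc x w)" "is_ann x w (p ^ m)" "adj e = e"
    using ex_selfadjoint_projection[OF x p m0, of w] w ker[OF w(1)] unfolding T_def by blast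
  have ee: "e \<cdot> e \<cdot> v = e \<cdot> v" for v
    using e(1) by (metis act_mult)
  define g where "g = 1 - (e + e)"
  have "g \<in> isom"
    unfolding isom_def g_def
    by (simp, rule sqmat_eqI) (simp add: adj_diff adj_add e(5) ee)
  moreover have "g * x = x * g"
    using e(2) by (simp add: g_def algebra_simps)
  moreover have "dt g = - 1"
  proof -
    define s where "s = (T ^ (m - 1)) \<cdot> w"
    have "s \<noteq> 0"
      using w(2) by (auto simp: s_def)
    moreover have "T \<cdot> s = (T ^ m) \<cdot> w"
      using m0 by (cases m) (simp_all add: s_def)
    then have "x \<cdot> s = \<epsilon> *s s"
      using w(1) T by simp
    ultimately have line: "subdet (- 1) (cyc x s) = - 1"
      using subdet_minus_one_line two by blast
    have inv: "invar (- 1) (cyc x w)"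
      by (auto simp: invar_def intro: vec.subspace_neg[OF subspace_cyc])
    have "subdet (- 1) (cyc x w) = (- 1) ^ m"
      using subdet_cyc[OF p e(4) inv] line by (simp add: s_def T_def)
    moreover have "subdet (- 1) (cyc x w) = dt (1 + (- 1 - 1) * e)"
      by (rule subdet_eq[OF e(3) inv subspace_cyc])
    moreover have "1 + (- 1 - 1) * e = g"
      by (simp add: g_def algebra_simps) (simp only: mult_2)
    ultimately show ?thesis
      using m by simp
  qed
  ultimately show ?thesis by blast
qed

lemma dt_orthogonal_centralizer:
  assumes bar: "\<And>a. bar a = a" and x: "x \<in> isom" and g: "g \<in> isom" and gx: "g * x = x * g"
    and block: "\<And>m. odd m \<Longrightarrow> \<not> has_block x [:- 1, 1:] m" "\<And>m. odd m \<Longrightarrow> \<not> has_block x [:1, 1:] m"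
  shows "dt g = 1"
proof -
  obtain N where N: "N > 0" "(g - 1) ^ N * (g - 1) ^ N = (g - 1) ^ N"
    using ex_idempotent_power by blast
  define e where "e = (g - 1) ^ N"
  \<comment> \<open>As \<open>bar\<close> is trivial, there is no skew scalar, and the sign moves
    into \<open>\<epsilon> = - 1\<close>. Since \<open>dt y\<close> is its own conjugate and not 0,
    the factor between the two in \<open>cayley\<close> is 1.\<close>
  have "bar 1 = - (- 1) * (1 :: 'a)"
    by simp
  note cayley = cayley[OF g N one_neq_zero this, folded e_def]
  have ee: "e \<cdot> e \<cdot> v = e \<cdot> v" for v
    using N by (simp add: e_def flip: act_mult)
  have adje: "adj e = e"
    unfolding e_def by (rule idempotent_minus_one[OF g N(2)])
  have "(g - 1) * x = x * (g - 1)"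
    using gx by (simp add: algebra_simps)
  then have ex: "e * x = x * e"
    unfolding e_def by (metis power_commuting_commutes)
  \<comment> \<open>The involution that is \<open>- 1\<close> on the range of \<open>e\<close>; it
    accounts for the sign between \<open>- adj g\<close> and \<open>adj g\<close> there, whence
    \<open>dt g = dt b\<close>.\<close>
  define b where "b = 1 - (e + e)"
  have "sc (- 1) * adj g * e + (1 - e) = (adj g * e + (1 - e)) * b"
    by (rule sqmat_eqI) (simp add: b_def ee sc_uminus[of 1])
  then have "dt (adj g * e + (1 - e)) * dt b = 1"
    using cayley(1,2) bar by simp
  then have dtb: "dt g = dt b"
    using cayley(3) by (metis mult_cancel_left mult_zero_left zero_neq_one)
  have bb: "b * b = 1"
    by (rule sqmat_eqI) (simp add: b_def ee)
  have bx: "b * x = x * b"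
    using ex by (simp add: b_def algebra_simps)
  obtain M where M: "M > 0" "(x * x - 1) ^ M * (x * x - 1) ^ M = (x * x - 1) ^ M"
    using ex_idempotent_power by blast
  \<comment> \<open>The Fitting idempotent of \<open>x * x - 1\<close>: it projects onto the part
    where neither 1 nor -1 is an eigenvalue of \<open>x\<close>.\<close>
  define d where "d = (x * x - 1) ^ M"
  have dd: "d \<cdot> d \<cdot> v = d \<cdot> v" for v
    using M by (simp add: d_def flip: act_mult)
  have adjd: "adj d = d"
    unfolding d_def
  proof (rule adj_idempotent_power[OF _ _ _ M(2)])
    note ax = isomD(1,2)[OF x]
    have ax': "adj x * (x * a) = a" "x * (adj x * a) = a" for a
      using ax by (metis mult.assoc mult_1_left)+
    show "adj (x * x - 1) = - (adj x * adj x) * (x * x - 1)"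
      by (simp add: adj_diff adj_mult algebra_simps ax ax')
    show "- (adj x * adj x) * (- (x * x)) = 1"
      by (simp add: mult.assoc ax ax')
    show "- (adj x * adj x) * (x * x - 1) = (x * x - 1) * - (adj x * adj x)"
      by (simp add: algebra_simps ax ax')
  qed
  have xx: "x * (x * x - 1) = (x * x - 1) * x"
    by (simp add: algebra_simps)
  then have xd: "x * d = d * x"
    unfolding d_def by (rule power_commute)
  have "e * (x * x - 1) = (x * x - 1) * e"
    using commute_mult[OF ex[symmetric] ex[symmetric]] by (simp add: algebra_simps)
  then have ed: "e * d = d * e"
    unfolding d_def by (rule power_commute)
  have ed': "e \<cdot> d \<cdot> v = d \<cdot> e \<cdot> v" for v
    using ed by (metis act_mult)
  define f where "f = e * d"
  have ff: "f \<cdot> f \<cdot> v = f \<cdot> v" for v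
    by (simp add: f_def ed' ee dd)
  have adjf: "adj f = f"
    by (simp add: f_def adj_mult adje adjd ed)
  have fx: "f * x = x * f"
    unfolding f_def by (rule commute_mult[OF ex xd[symmetric]])
  have fax: "f * adj x = adj x * f"
    using commute_adj[OF x fx] .
  have fx': "f \<cdot> x \<cdot> v = x \<cdot> f \<cdot> v" "f \<cdot> adj x \<cdot> v = adj x \<cdot> f \<cdot> v" for v
    using fx fax by (metis act_mult)+
  \<comment> \<open>On the range of \<open>f\<close> the map
    \<open>x - adj x = adj x * (x * x - 1)\<close> is invertible and skew-adjoint, so
    \<open>adj s = (1 - 2 f) * s\<close>. As \<open>s\<close> and \<open>adj s\<close> have the same
    nonzero determinant, \<open>1 - 2 f\<close> has determinant 1: a non-degenerate alternating form
    lives in even dimension.\<close>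
  define s where "s = (x - adj x) * f + (1 - f)"
  have "dt s \<noteq> 0"
  proof (rule dt_nonzeroI(1))
    define z where "z = x * (x * x - 1) ^ (M - 1) * f + (1 - f)"
    show "s * z = 1"
    proof (rule sqmat_eqI)
      fix v
      define w where "w = ((x * x - 1) ^ (M - 1)) \<cdot> f \<cdot> v"
      have "f * (x * x - 1) = (x * x - 1) * f"
        using commute_mult[OF fx[symmetric] fx[symmetric]] by (simp add: algebra_simps)
      then have "f * (x * x - 1) ^ (M - 1) = (x * x - 1) ^ (M - 1) * f"
        by (rule power_commute)
      then have fw: "f \<cdot> w = w"
        unfolding w_def by (metis act_mult ff)
      have "x \<cdot> x \<cdot> w - w = (x * x - 1) \<cdot> ((x * x - 1) ^ (M - 1)) \<cdot> f \<cdot> v"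
        by (simp add: w_def)
      also have "\<dots> = d \<cdot> f \<cdot> v"
        using M(1) unfolding d_def by (cases M) auto
      also have "\<dots> = f \<cdot> v"
        by (simp add: f_def ed' dd)
      finally have xw: "x \<cdot> x \<cdot> w - w = f \<cdot> v" .
      have "z \<cdot> v = x \<cdot> w + (v - f \<cdot> v)"
        by (simp add: z_def w_def)
      then have "s \<cdot> z \<cdot> v = (x \<cdot> x \<cdot> w - w) + (v - f \<cdot> v)"
        by (simp add: s_def fx' fw ff isomD[OF x])
      then show "(s * z) \<cdot> v = 1 \<cdot> v"
        by (simp add: xw)
    qed
  qed
  moreover have "adj s = (1 - (f + f)) * s"
    by (rule sqmat_eqI)
      (simp add: s_def adj_add adj_diff adj_mult adjf fx' ff algebra_simps)
  then have "dt s = dt (1 - (f + f)) * dt s"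
    using dt_adj[of s] bar by (metis dt_mult)
  ultimately have dt1: "dt (1 - (f + f)) = 1"
    by simp
  define W where "W = range (\<lambda>v. (1 - d) \<cdot> v)"
  have W: "vec.subspace W"
    unfolding W_def by (intro subspace_image_act) simp
  have W_iff: "w \<in> W \<longleftrightarrow> d \<cdot> w = 0" for w
  proof
    assume "w \<in> W"
    then show "d \<cdot> w = 0"
      by (auto simp: W_def dd)
  next
    assume "d \<cdot> w = 0"
    then have "w = (1 - d) \<cdot> w" by simp
    then show "w \<in> W"
      unfolding W_def by blast
  qed
  have proj: "is_proj (1 - d) W"
    unfolding is_proj_def by (simp add: W_iff dd)
  have bd: "b * d = d * b"
    using ed by (simp add: b_def algebra_simps)
  have xW: "invar x W" and bW: "invar b W"
    by (simp_all add: invar_def W_iff flip: commutesD[OF xd] commutesD[OF bd])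
  \<comment> \<open>On \<open>W\<close> the map \<open>x * x - 1\<close> is nilpotent, so only the
    primes t - 1 and t + 1 can have a kernel, and these have no blocks of odd exponent.\<close>
  have "\<exists>z. subdet b W = z ^ 2 \<and> (\<forall>k. b ^ k = 1 \<longrightarrow> z ^ k = 1)"
  proof (rule subdet_is_power[OF bx _ W xW bW])
    fix p :: "'a poly" and j w
    assume p: "monic_irreducible p" and j: "\<not> 2 dvd j" and w0: "pe x p \<cdot> w = 0"
      and w: "w \<in> (\<lambda>v. (pe x p ^ (j - 1)) \<cdot> v) ` W"
    have dpe: "d \<cdot> (pe x p ^ i) \<cdot> v = (pe x p ^ i) \<cdot> d \<cdot> v" for i v
      using pe_commute[of d x "p ^ i"] xd by (metis act_mult pe_power)
    have wW: "d \<cdot> w = 0"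
      using w by (auto simp: dpe W_iff)
    show "w \<in> (\<lambda>v. (pe x p ^ j) \<cdot> v) ` W"
    proof (cases "p = [:- 1, 1:] \<or> p = [:1, 1:]")
      case True
      then have "\<not> has_block x p j"
        using block j by auto
      moreover have "j > 0"
        using j by (cases j) auto
      ultimately obtain y where y: "w = (pe x p ^ j) \<cdot> y"
        using not_has_block[of x p j w] w0 w by blast
      then have "w = (pe x p ^ j) \<cdot> (1 - d) \<cdot> y"
        using wW by (simp add: dpe)
      then show ?thesis
        unfolding W_def by blast
    next
      case False
      define r where "r = [:- 1, 1:] * [:1, 1 :: 'a:]"
      have pr: "prime_elem p"
        using prime_elem_monic_irreducible[OF p] .
      have "\<not> p dvd r"
        using pr False p monic_irreducible_dvd_eq monic_irreducible_linear
        unfolding r_def by (metis prime_elem_dvd_mult_iff)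
      then have "\<not> p dvd r ^ M"
        using pr prime_elem_dvd_power by blast
      then obtain s t where st: "s * p + t * r ^ M = 1"
        using ex_bezout p unfolding monic_irreducible_def by blast
      have "pe x r = x * x - 1"
        by (simp add: r_def algebra_simps sc_uminus[of 1])
      then have "pe x (r ^ M) \<cdot> w = 0"
        using wW by (simp add: pe_power d_def)
      then have "pe x (s * p + t * r ^ M) \<cdot> w = 0"
        by (simp add: pe_add pe_mult w0)
      then have "w = 0"
        by (simp only: st pe_1 act_one)
      then show ?thesis
        using vec.subspace_0[OF W] by (intro image_eqI[of _ _ 0]) auto
    qed
  qed simp
  then obtain z where "subdet b W = z ^ 2" "\<And>k. b ^ k = 1 \<Longrightarrow> z ^ k = 1"
    by blast
  then have "subdet b W = 1"
    using bb by (metis power2_eq_square)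
  then have dt2: "dt (1 + (b - 1) * (1 - d)) = 1"
    using subdet_eq[OF proj bW W] by simp
  have "(1 - (f + f)) * (1 + (b - 1) * (1 - d)) = b"
    by (rule sqmat_eqI) (simp add: b_def f_def ed' ee dd algebra_simps)
  then have "dt b = 1"
    using dt1 dt2 by (metis dt_mult mult_1_left)
  then show ?thesis
    by (simp add: dtb)
qed

end

section \<open>Conjugation on a field of square order\<close>

text \<open>If \<open>|F| = P m\<close> with \<open>P\<close> a power of the characteristic and \<open>m\<close> prime to it, then
  \<open>x \<mapsto> x ^ m\<close> is the inverse of the \<open>P\<close>-th power Frobenius map, hence additive. Thus
  \<open>(x + 1) ^ m - x ^ m - 1\<close> has more roots than its degree unless \<open>m = 1\<close>.\<close>

lemma card_field_power_CHAR: "\<exists>k. CARD('a::{field, finite}) = CHAR('a) ^ k"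
proof -
  define p where "p = CHAR('a)"
  have p: "prime p"
    using finite_imp_CHAR_pos[where ?'a = 'a] prime_CHAR_semidom[where ?'a = 'a] by (simp add: p_def)
  have N0: "CARD('a) \<noteq> 0" by simp
  have "\<not> is_unit p"
    using p by auto
  then obtain m where m: "CARD('a) = p ^ multiplicity p CARD('a) * m" "\<not> p dvd m"
    using multiplicity_decompose'[OF N0] by metis
  define P where "P = p ^ multiplicity p CARD('a)"
  have frob: "(x + y) ^ P = x ^ P + y ^ P" for x y :: 'a
    using p by (intro freshmans_dream') (auto simp: P_def p_def)
  have inj: "z = w" if "z ^ P = w ^ P" for z w :: 'a
  proof -
    have "(z - w) ^ P = 0"
      using frob[of "z - w" w] that by simp
    then show ?thesis by simp
  qed
  have add: "(x + y) ^ m = x ^ m + y ^ m" for x y :: 'a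
  proof (rule inj)
    have pow: "(z ^ m) ^ P = z" for z :: 'a
      using finite_field_power_card[of z] m(1) by (simp add: P_def mult.commute flip: power_mult)
    show "((x + y) ^ m) ^ P = (x ^ m + y ^ m) ^ P"
      by (simp add: frob pow)
  qed
  have "p dvd CARD('a)"
  proof -
    have "(\<Sum>c\<in>UNIV. (c::'a) ^ 0) = 0"
      using one_less_card_field[where ?'a = 'a] by (intro sum_power_finite_field) simp
    then have "of_nat CARD('a) = (0 :: 'a)"
      by simp
    then show ?thesis
      by (simp add: p_def of_nat_eq_0_iff_char_dvd)
  qed
  then have "multiplicity p CARD('a) > 0"
    using m by (metis gr0I mult_1 power_0)
  then have "p dvd P"
    by (simp add: P_def)
  moreover have "P > 0"
    using p by (simp add: P_def prime_gt_0_nat)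
  ultimately have "P \<ge> p"
    by (rule dvd_imp_le)
  then have P2: "P \<ge> 2"
    using prime_ge_2_nat[OF p] by linarith
  have "m = 1"
  proof (rule ccontr)
    assume "m \<noteq> 1"
    moreover have "m > 0"
      using m(1) N0 by (metis gr0I mult_0_right)
    ultimately have m2: "m \<ge> 2" by simp
    define f where "f = [:1, 1::'a:] ^ m - monom 1 m - 1"
    have "poly f x = 0" for x
      using add[of 1 x] by (simp add: f_def poly_monom)
    \<comment> \<open>The linear coefficient of \<open>f\<close> is \<open>m\<close>, which is prime
      to the characteristic; the subtracted terms do not touch it because
      \<open>m \<ge> 2\<close>.\<close>
    moreover have "f \<noteq> 0"
    proof
      assume "f = 0"
      then have "poly (pderiv f) 0 = 0" by simp
      moreover have "poly (pderiv f) 0 = of_nat m"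
        using m2 by (simp add: f_def pderiv_diff pderiv_power pderiv_monom poly_monom pderiv_pCons)
      ultimately show False
        using m(2) by (simp add: p_def of_nat_eq_0_iff_char_dvd)
    qed
    then have "card {x. poly f x = 0} \<le> degree f"
      by (rule card_poly_roots_bound)
    ultimately have "CARD('a) \<le> degree f" by simp
    moreover have "degree f \<le> m"
      unfolding f_def
    proof (intro degree_diff_le)
      show "degree ([:1, 1::'a:] ^ m) \<le> m"
        using degree_power_le[of "[:1, 1::'a:]" m] by simp
    qed (auto simp: degree_monom_le)
    moreover have "CARD('a) \<ge> 2 * m"
      using m(1) P2 by (simp flip: P_def)
    ultimately show False
      using m2 by linarith
  qed
  then show ?thesis
    using m(1) by (auto simp: p_def)
qed

text \<open>As a divisor of the order of the field, \<open>q\<close> is a power of the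
  characteristic, so the \<open>q\<close>-th power is an iterate of the Frobenius map.\<close>

lemma power_sqrt_card_add:
  fixes a b :: "'a::{field, finite}"
  assumes "CARD('a) = q\<^sup>2"
  shows "(a + b) ^ q = a ^ q + b ^ q"
proof -
  have p: "prime CHAR('a)"
    using finite_imp_CHAR_pos[where ?'a = 'a] prime_CHAR_semidom[where ?'a = 'a] by simp
  obtain k where "CARD('a) = CHAR('a) ^ k"
    using card_field_power_CHAR by blast
  then have "q dvd CHAR('a) ^ k"
    using assms by (metis dvd_triv_left power2_eq_square)
  then obtain i where "q = CHAR('a) ^ i"
    using p by (auto simp: divides_primepow_nat)
  then show ?thesis
    using p by (intro freshmans_dream')
qed

section \<open>The two kinds of forms as instances of the locale\<close>

lemma sesquilinear_hermitian:
  fixes h :: "'a::{field, finite} ^ 'n \<Rightarrow> 'a ^ 'n \<Rightarrow> 'a"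
  assumes card: "CARD('a) = q\<^sup>2" and h: "nondegenerate_hermitian_form (\<lambda>a. a ^ q) h"
  shows "sesquilinear (\<lambda>a. a ^ q) h"
proof
  show "(a + b) ^ q = a ^ q + b ^ q" for a b :: 'a
    using power_sqrt_card_add[OF card] .
  show "(a * b) ^ q = a ^ q * b ^ q" for a b :: 'a
    by (rule power_mult_distrib)
  show "(a ^ q) ^ q = a" for a :: 'a
    using finite_field_power_card[of a] card by (simp add: power2_eq_square flip: power_mult)
  have "Vector_Spaces.linear (*s) (*) (\<lambda>u. h u w)" for w
    using h unfolding nondegenerate_hermitian_form_def by blast
  then show "h (u + v) w = h u w + h v w" "h (c *s u) w = c * h u w" for u v w c
    by (simp_all add: Vector_Spaces.linear_iff)
  show "h v u = h u v ^ q" for u v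
    using h unfolding nondegenerate_hermitian_form_def by blast
  show "v = 0" if "\<And>w. h v w = 0" for v
    using h that unfolding nondegenerate_hermitian_form_def by blast
qed

lemma polar_self:
  assumes "quadratic_form Q"
  shows "polar Q v v = 2 * Q v"
proof -
  have "Q (2 *s v) = 2\<^sup>2 * Q v"
    using assms by (simp add: quadratic_form_def)
  moreover have "2 *s v = v + v"
    by (simp add: vec_eq_iff)
  ultimately have "Q (v + v) = 2\<^sup>2 * Q v"
    by metis
  then show ?thesis
    by (simp add: polar_def)
qed

lemma sesquilinear_polar:
  fixes Q :: "'a::{field, finite} ^ 'n \<Rightarrow> 'a"
  assumes two: "(2::'a) \<noteq> 0" and Q: "nonsingular_quadratic_form Q"
  shows "sesquilinear (\<lambda>a. a) (polar Q)"
proof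
  have qf: "quadratic_form Q"
    using Q by (simp add: nonsingular_quadratic_form_def)
  then have "Vector_Spaces.linear (*s) (*) (\<lambda>u. polar Q u w)" for w
    by (simp add: quadratic_form_def)
  then show lin: "polar Q (u + v) w = polar Q u w + polar Q v w" "polar Q (c *s u) w = c * polar Q u w" for u v w c
    by (simp_all add: Vector_Spaces.linear_iff)
  show "polar Q v u = polar Q u v" for u v
    by (simp add: polar_def add.commute)
  show "v = 0" if v: "\<And>w. polar Q v w = 0" for v
  proof (rule ccontr)
    assume "v \<noteq> 0"
    then have "Q v \<noteq> 0"
      using Q v by (simp add: nonsingular_quadratic_form_def)
    then show False
      using v[of v] two by (simp add: polar_self[OF qf])
  qed
qed auto

lemma of_mat_unitary_group:
  assumes "sesquilinear bar h"
  shows "of_mat ` unitary_group h = sesquilinear.isom bar h"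
proof -
  interpret sesquilinear bar h by fact
  have "g \<in> unitary_group h \<longleftrightarrow> of_mat g \<in> isom" for g
  proof -
    have "invertible g" if "of_mat g \<in> isom"
      using isomD(5)[OF that] by (simp add: dt.rep_eq of_mat_inverse invertible_det_nz)
    then show ?thesis
      using isom_iff[of "of_mat g"] by (auto simp: unitary_group_def act.rep_eq of_mat_inverse)
  qed
  then show ?thesis
    by (auto simp: image_iff) (metis mat_of_inverse)
qed

text \<open>As \<open>2 \<noteq> 0\<close>, the identity \<open>polar Q v v = 2 * Q v\<close>
  recovers \<open>Q\<close> from its polar form.\<close>

lemma orthogonal_group_eq_unitary_group:
  fixes Q :: "'a::{field, finite} ^ 'n \<Rightarrow> 'a"
  assumes two: "(2::'a) \<noteq> 0" and qf: "quadratic_form Q"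
  shows "orthogonal_group Q = unitary_group (polar Q)"
proof -
  have "(\<forall>v. Q (g *v v) = Q v) \<longleftrightarrow> (\<forall>u v. polar Q (g *v u) (g *v v) = polar Q u v)" for g
  proof
    assume "\<forall>v. Q (g *v v) = Q v"
    then show "\<forall>u v. polar Q (g *v u) (g *v v) = polar Q u v"
      by (simp add: polar_def flip: matrix_vector_right_distrib)
  next
    assume "\<forall>u v. polar Q (g *v u) (g *v v) = polar Q u v"
    then have "2 * Q (g *v v) = 2 * Q v" for v
      by (simp flip: polar_self[OF qf])
    then show "\<forall>v. Q (g *v v) = Q v"
      using two by simp
  qed
  then show ?thesis
    by (simp add: orthogonal_group_def unitary_group_def)
qed


section \<open>Splitting of classes\<close>

text \<open>The identity has a block of exponent 1, so the results on centralizers, taken at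
  \<open>x = 1\<close>, give all determinants of the isometry group.\<close>

lemma has_block_one:
  "has_block (1 :: ('a::{field, finite}, 'n::finite) sqmat) [:- 1, 1:] 1"
proof -
  have "pe (1 :: ('a, 'n) sqmat) [:- 1, 1:] = 0"
    by (simp add: sc_uminus[of 1])
  moreover have "axis undefined 1 \<noteq> (0 :: 'a ^ 'n)"
    by (simp add: axis_eq_0_iff)
  ultimately show ?thesis
    unfolding has_block_def by (intro exI[of _ "axis undefined 1"]) auto
qed

text \<open>\<open>J\<close> behaves like an ideal of the integers, with cancellation in place of
  subtraction: it consists of the multiples of its least positive element, which therefore divides
  the gcd.\<close>

lemma Gcd_mem_of_closed:
  fixes J :: "nat set"
  assumes add: "\<And>i j. i \<in> J \<Longrightarrow> j \<in> J \<Longrightarrow> i + j \<in> J"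
    and cancel: "\<And>i j. i \<in> J \<Longrightarrow> i + j \<in> J \<Longrightarrow> j \<in> J"
    and X: "X \<subseteq> J" "n \<in> X" "n > 0"
  shows "Gcd X \<in> J"
proof -
  have "0 \<in> J"
    using cancel[of n 0] X by auto
  define d where "d = (LEAST d. d \<in> J \<and> d > 0)"
  have "n \<in> J \<and> n > 0"
    using X by auto
  then have d: "d \<in> J" "d > 0"
    using LeastI[of "\<lambda>d. d \<in> J \<and> d > 0" n] by (auto simp: d_def)
  have mult: "d * k \<in> J" for k
    by (induction k) (auto simp: \<open>0 \<in> J\<close> intro: add d)
  have "d dvd j" if "j \<in> J" for j
  proof -
    have "d * (j div d) + j mod d \<in> J"
      using that by simp
    then have "j mod d \<in> J"
      using cancel mult by blast
    moreover have "j mod d < d"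
      using d by simp
    ultimately have "j mod d = 0"
      using not_less_Least[of "j mod d" "\<lambda>d. d \<in> J \<and> d > 0"] by (auto simp: d_def)
    then show ?thesis by auto
  qed
  then have "d dvd Gcd X"
    using X by (intro Gcd_greatest) auto
  then show ?thesis
    using mult by (auto elim: dvdE)
qed

section \<open>Determinants of centralizers and the number of classes\<close>

context sesquilinear
begin

definition centralizer :: "('a, 'n) sqmat \<Rightarrow> ('a, 'n) sqmat set" where
  "centralizer x = {g \<in> isom. g * x = x * g}"

lemma card_isom_classes:
  "card {cls {g \<in> isom. dt g = 1} y | y. y \<in> cls isom x} * card (dt ` centralizer x) = card (dt ` centralizer 1)"
proof -
  have "centralizer 1 = isom"
    by (simp add: centralizer_def)
  moreover have "\<exists>g'\<in>isom. g * g' = 1" if "g \<in> isom" for g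
    using isomD(2)[OF that] adj_isom[OF that] by blast
  ultimately show ?thesis
    using card_classes[of isom x] one_isom isom_mult by (simp add: centralizer_def)
qed

lemma centralizer_mult:
  "a \<in> centralizer x \<Longrightarrow> b \<in> centralizer x \<Longrightarrow> a * b \<in> centralizer x"
  unfolding centralizer_def using isom_mult commute_mult by blast

lemma centralizer_inverse:
  assumes "a \<in> centralizer x"
  shows "adj a \<in> centralizer x"
proof -
  have a: "a \<in> isom" "a * x = x * a"
    using assms by (auto simp: centralizer_def)
  then show ?thesis
    using adj_isom inverse_commute[OF isomD(2,1)[OF a(1)] a(2)] by (simp add: centralizer_def)
qed

lemma card_dt_orthogonal_centralizer:
  assumes bar: "\<And>a. bar a = a" and two: "(2::'a) \<noteq> 0" and x: "x \<in> isom"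
  shows "card (dt ` centralizer x) =
    (if \<exists>m. odd m \<and> (has_block x [:- 1, 1:] m \<or> has_block x [:1, 1:] m) then 2 else 1)"
proof (cases "\<exists>m. odd m \<and> (has_block x [:- 1, 1:] m \<or> has_block x [:1, 1:] m)")
  case True
  have "1 \<in> centralizer x"
    using one_isom by (simp add: centralizer_def)
  then have "1 \<in> dt ` centralizer x"
    by (metis dt_one image_eqI)
  moreover have "- 1 \<in> dt ` centralizer x"
  proof -
    obtain m \<epsilon> where "odd m" "\<epsilon> * \<epsilon> = 1" "has_block x [:- \<epsilon>, 1:] m"
    proof -
      obtain m where m: "odd m" "has_block x [:- 1, 1:] m \<or> has_block x [:1, 1:] m"
        using True by blast
      from m(2) show thesis
      proof
        assume "has_block x [:- 1, 1:] m"
        then show thesis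
          using that[of m 1] m(1) by simp
      next
        assume "has_block x [:1, 1:] m"
        then show thesis
          using that[of m "- 1"] m(1) by simp
      qed
    qed
    then obtain g where "g \<in> isom" "g * x = x * g" "dt g = - 1"
      using ex_orthogonal_centralizer[OF bar two x] by blast
    then show ?thesis
      unfolding centralizer_def by force
  qed
  moreover have "dt g = 1 \<or> dt g = - 1" if "g \<in> centralizer x" for g
  proof -
    have "g \<in> isom"
      using that by (simp add: centralizer_def)
    then have "dt g * dt g = 1"
      using arg_cong[OF isomD(1), of g dt] bar by (simp add: dt_adj)
    then show ?thesis
      by (simp add: square_eq_1_iff)
  qed
  ultimately have "dt ` centralizer x = {1, - 1}"
    by auto
  moreover have "(1::'a) \<noteq> - 1"
    using two by (metis eq_neg_iff_add_eq_0 one_add_one)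
  ultimately show ?thesis
    using True by simp
next
  case False
  have "dt g = 1" if "g \<in> centralizer x" for g
    using dt_orthogonal_centralizer[OF bar x, of g] that False unfolding centralizer_def by blast
  moreover have "1 \<in> centralizer x"
    using one_isom by (simp add: centralizer_def)
  ultimately have "dt ` centralizer x = {1}"
    by (metis (no_types, lifting) dt_one image_cong image_constant)
  then show ?thesis
    using False by simp
qed

text \<open>With \<open>r\<close> the gcd and \<open>b = (q + 1) / r\<close>, both bounds give the
  same group: every determinant satisfies \<open>c ^ b = 1\<close>, and the solutions are exactly
  the \<open>(q - 1) r\<close>-th powers, which are reached by combining the single exponents.
  \<open>M\<close> is kept abstract so that it can be the given list of exponents or, for
  \<open>x = 1\<close>, the set \<open>{1}\<close>.\<close>

lemma card_dt_unitary_centralizer: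
  fixes q :: nat
  assumes card: "CARD('a) = q\<^sup>2" and bar: "\<And>a. bar a = a ^ q" and x: "x \<in> isom"
    and M: "\<And>m. m \<in> M \<Longrightarrow> m > 0 \<and> (\<exists>p. monic_irreducible p \<and> has_block x p m)"
    and M': "\<And>p m. monic_irreducible p \<Longrightarrow> m > 0 \<Longrightarrow> has_block x p m \<Longrightarrow> Gcd (M \<union> {q + 1}) dvd m"
  shows "card (dt ` centralizer x) * Gcd (M \<union> {q + 1}) = q + 1"
proof -
  define r where "r = Gcd (M \<union> {q + 1})"
  have r: "r dvd q + 1"
    unfolding r_def by (rule Gcd_dvd) simp
  then have r0: "r > 0"
    by (auto intro!: Nat.gr0I)
  define b where "b = (q + 1) div r"
  have br: "b * r = q + 1"
    using r by (simp add: b_def)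
  have q2: "q > 1"
    using one_less_card_field[where ?'a = 'a] card by (metis gr0I less_one nat_neq_iff one_power2 zero_power2 not_less0)
  have field: "b * ((q - 1) * r) = CARD('a) - 1"
  proof -
    have "b * ((q - 1) * r) = (q - 1) * (b * r)"
      by (simp add: mult_ac)
    also have "\<dots> = (q - 1) * (q + 1)"
      by (simp only: br)
    also have "\<dots> = CARD('a) - 1"
      by (simp add: card power2_eq_square algebra_simps)
    finally show ?thesis .
  qed
  note pow = power_map_finite_field[OF field]
  \<comment> \<open>A trivial \<open>bar\<close> would make all \<open>q * q - 1\<close> nonzero
    elements roots of \<open>c ^ (q - 1) = 1\<close>.\<close>
  have "\<exists>a::'a. bar a \<noteq> a"
  proof (rule ccontr)
    assume "\<not> ?thesis"
    then have "UNIV - {0} \<subseteq> {c::'a. c ^ (q - 1) = 1}"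
    proof safe
      fix c :: 'a assume "c \<noteq> 0" "\<nexists>a::'a. bar a \<noteq> a"
      then have "c ^ (q - 1) * c = 1 * c"
        using q2 bar by (metis Suc_pred' less_trans mult_1 power_Suc2 zero_less_one)
      then show "c ^ (q - 1) = 1"
        using \<open>c \<noteq> 0\<close> by simp
    qed
    then have "card (UNIV - {0::'a}) \<le> card {c::'a. c ^ (q - 1) = 1}"
      by (intro card_mono) auto
    also have "\<dots> \<le> q - 1"
      using q2 by (intro card_power_eq_le) simp
    finally have "q * q - 1 \<le> q - 1"
      by (simp add: card_Diff_singleton card power2_eq_square)
    moreover have "2 * q \<le> q * q"
      using q2 by simp
    ultimately show False
      using q2 by arith
  qed
  then obtain a where a: "bar a \<noteq> a" by blast
  define D where "D = dt ` centralizer x"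
  have "1 \<in> centralizer x"
    using one_isom by (simp add: centralizer_def)
  then have D1: "1 \<in> D"
    unfolding D_def by (metis dt_one imageI)
  have Dmult: "c * d \<in> D" if "c \<in> D" "d \<in> D" for c d
  proof -
    obtain a b where "a \<in> centralizer x" "c = dt a" "b \<in> centralizer x" "d = dt b"
      using \<open>c \<in> D\<close> \<open>d \<in> D\<close> by (auto simp: D_def)
    then show ?thesis
      unfolding D_def by (intro image_eqI[of _ _ "a * b"] centralizer_mult) auto
  qed
  have Dinv: "\<exists>d\<in>D. c * d = 1" if "c \<in> D" for c
  proof -
    obtain g where g: "g \<in> centralizer x" "c = dt g"
      using \<open>c \<in> D\<close> by (auto simp: D_def)
    then have "c * dt (adj g) = 1"
      using isomD(2)[of g] by (simp add: centralizer_def flip: dt_mult)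
    then show ?thesis
      using centralizer_inverse[OF g(1)] by (auto simp: D_def)
  qed
  have q3: "q + q * q = q + 1 + (CARD('a) - 1)"
    using q2 by (simp add: card power2_eq_square)
  have "D \<subseteq> {c. c ^ b = 1}"
  proof
    fix c assume "c \<in> D"
    then obtain g where g: "g \<in> isom" "g * x = x * g" "c = dt g"
      by (auto simp: D_def centralizer_def)
    then obtain z where z: "z \<noteq> 0" "c * bar (z ^ r) = z ^ r"
      using dt_unitary_centralizer[OF a x g(1,2) r0] M' unfolding r_def by blast
    have "(c * bar (z ^ r)) ^ b = (z ^ r) ^ b"
      using z(2) by simp
    then have "c ^ b * z ^ ((q + 1) * q) = z ^ (q + 1)"
      unfolding br[symmetric] by (simp add: bar power_mult_distrib mult_ac flip: power_mult)
    \<comment> \<open>The norm \<open>z ^ (q + 1)\<close> is fixed by \<open>bar\<close>: the two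
      exponents differ by \<open>q * q - 1\<close>.\<close>
    moreover have "z ^ ((q + 1) * q) = z ^ (q + 1)"
    proof -
      have "z ^ ((q + 1) * q) = z ^ (q + 1) * z ^ (CARD('a) - 1)"
      proof -
        have "(q + 1) * q = (q + 1) + (CARD('a) - 1)"
          using q3 by simp
        then show ?thesis
          by (simp only: power_add)
      qed
      then show ?thesis
        using finite_field_power_card_minus_one[OF z(1)] by simp
    qed
    ultimately show "c \<in> {c. c ^ b = 1}"
      using z(1) by simp
  qed
  moreover have "{c. c ^ b = 1} \<subseteq> D"
  proof -
    \<comment> \<open>The exponents \<open>j\<close> for which every \<open>(q - 1) j\<close>-th
      power is a determinant. As \<open>D\<close> is a group, \<open>J\<close> is closed as
      \<open>Gcd_mem_of_closed\<close> requires.\<close>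
    define J where "J = {j. \<forall>y::'a. y \<noteq> 0 \<longrightarrow> y ^ ((q - 1) * j) \<in> D}"
    have "Gcd (M \<union> {q + 1}) \<in> J"
    proof (rule Gcd_mem_of_closed)
      show "i + j \<in> J" if "i \<in> J" "j \<in> J" for i j
        using that Dmult by (simp add: J_def distrib_left power_add)
      show "j \<in> J" if ij: "i \<in> J" "i + j \<in> J" for i j
        unfolding J_def
      proof (intro CollectI allI impI)
        fix y :: 'a assume y: "y \<noteq> 0"
        obtain d where d: "d \<in> D" "y ^ ((q - 1) * i) * d = 1"
          using Dinv ij(1) y by (auto simp: J_def)
        have "y ^ ((q - 1) * (i + j)) \<in> D"
          using ij(2) y by (simp add: J_def)
        then have "y ^ ((q - 1) * (i + j)) * d \<in> D"
          using Dmult d by blast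
        moreover have "y ^ ((q - 1) * (i + j)) * d = y ^ ((q - 1) * j)"
        proof -
          have "y ^ ((q - 1) * (i + j)) * d = y ^ ((q - 1) * j) * (y ^ ((q - 1) * i) * d)"
            by (simp only: distrib_left power_add mult_ac)
          then show ?thesis
            by (simp only: d(2) mult_1_right)
        qed
        ultimately show "y ^ ((q - 1) * j) \<in> D"
          by simp
      qed
      show "M \<union> {q + 1} \<subseteq> J"
      proof
        fix m assume "m \<in> M \<union> {q + 1}"
        then consider "m \<in> M" | "m = q + 1"
          by blast
        then show "m \<in> J"
        proof cases
          case 1
          then obtain p where p: "monic_irreducible p" "m > 0" "has_block x p m"
            using M by blast
          show ?thesis
            unfolding J_def
          proof (intro CollectI allI impI)
            fix y :: 'a assume y: "y \<noteq> 0"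
            \<comment> \<open>The determinant obtained from \<open>c\<close> is
              \<open>c ^ m / bar (c ^ m)\<close>, with exponent \<open>(1 - q) m\<close>; the
              inverse turns this into \<open>(q - 1) m\<close>.\<close>
            then have "inverse y \<noteq> 0" by simp
            then obtain g where g: "g \<in> isom" "g * x = x * g"
              "dt g * bar (inverse y ^ m) = inverse y ^ m"
              using ex_unitary_centralizer[OF a x p] by blast
            have "y ^ (q * m) = y ^ ((q - 1) * m) * y ^ m"
              using q2 by (simp add: diff_mult_distrib flip: power_add)
            moreover have "dt g * inverse (y ^ (q * m)) = inverse (y ^ m)"
              using g(3) by (simp add: bar power_inverse mult.commute flip: power_mult)
            ultimately have "dt g = y ^ ((q - 1) * m)"
              using y by (simp add: field_simps)
            then show "y ^ ((q - 1) * m) \<in> D"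
              unfolding D_def centralizer_def using g(1,2) by (intro image_eqI[of _ _ g]) auto
          qed
        next
          case 2
          have "(q - 1) * (q + 1) = CARD('a) - 1"
            by (simp add: card power2_eq_square algebra_simps)
          then show ?thesis
            unfolding J_def 2 using D1 finite_field_power_card_minus_one[where ?'a = 'a] by simp
        qed
      qed
    qed auto
    then show ?thesis
      unfolding pow(2) by (auto simp: J_def r_def)
  qed
  ultimately have "card D = b"
    using pow(1) by auto
  then show ?thesis
    using br by (simp add: D_def r_def)
qed

lemma class_splits_into_orthogonal:
  assumes bar: "\<And>a. bar a = a" and two: "(2::'a) \<noteq> 0"
    and inv: "\<And>g. g \<in> C \<Longrightarrow> invertible g" and G: "of_mat ` C = isom" and x: "x \<in> C"
  shows "class_splits_into C (special_subgroup C) x 2 \<longleftrightarrow>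
    \<not> (\<exists>m. odd m \<and> ([:- 1, 1:] ^ m \<in># elementary_divisors x \<or> [:1, 1:] ^ m \<in># elementary_divisors x))"
proof -
  have xC: "of_mat x \<in> isom"
    using x G by blast
  define B where "B \<longleftrightarrow> (\<exists>m. odd m \<and> (has_block (of_mat x) [:- 1, 1:] m \<or> has_block (of_mat x) [:1, 1:] m))"
  have "class_splits_into C (special_subgroup C) x 2 \<longleftrightarrow>
    card {cls {g \<in> isom. dt g = 1} y | y. y \<in> cls isom (of_mat x)} = 2"
    by (rule class_splits_into_iff[OF inv G])
  moreover have "card (dt ` centralizer (of_mat x)) = (if B then 2 else 1)"
    unfolding B_def by (rule card_dt_orthogonal_centralizer[OF bar two xC])
  moreover have "card (dt ` centralizer 1) = 2"
    using card_dt_orthogonal_centralizer[OF bar two one_isom] has_block_one odd_one by metis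
  ultimately have "class_splits_into C (special_subgroup C) x 2 \<longleftrightarrow> \<not> B"
    using card_isom_classes[of "of_mat x"] by (auto split: if_splits)
  moreover have "[:c, 1:] ^ m \<in># elementary_divisors x \<longleftrightarrow> has_block (of_mat x) [:c, 1:] m" if "odd m" for c m
    unfolding has_block_def using odd_pos[OF that] by (rule elementary_divisor_iff[OF monic_irreducible_linear])
  ultimately show ?thesis
    unfolding B_def by blast
qed

text \<open>Only the set of exponents counts for the gcd: every listed \<open>m i\<close> is the
  exponent of a block of \<open>x\<close>, and every block exponent for \<open>p\<close> is listed,
  under \<open>p\<close> or under the product of \<open>p\<close> and its dual.\<close>

lemma class_splits_into_unitary:
  assumes card: "CARD('a) = q\<^sup>2" and bar: "\<And>a. bar a = a ^ q"
    and inv: "\<And>g. g \<in> C \<Longrightarrow> invertible g" and G: "of_mat ` C = isom" and x: "x \<in> C"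
    and ged: "gen_elementary_divisors bar x k f m"
  shows "class_splits_into C (special_subgroup C) x (Gcd (m ` {1..k} \<union> {q + 1}))"
proof -
  have xC: "of_mat x \<in> isom"
    using x G by blast
  have block: "p ^ m \<in># elementary_divisors x \<longleftrightarrow> has_block (of_mat x) p m"
    if "monic_irreducible p" "m > 0" for p m
    unfolding has_block_def using elementary_divisor_iff[OF that] .
  let ?mult = "gen_elementary_divisor_mult bar x"
  define r where "r = Gcd (m ` {1..k} \<union> {q + 1})"
  have mult_mem: "e \<in> m ` {1..k}" if "?mult p e > 0" for p e
  proof -
    have "card {i \<in> {1..k}. f i = p \<and> m i = e} > 0"
      using ged that by (simp add: gen_elementary_divisors_def)
    then show ?thesis
      by (auto simp: card_gt_0_iff)
  qed
  have SOME_factor: "Phi2_factor bar p (SOME g. Phi2_factor bar p g)"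
    if "p \<in> Phi2 bar" for p
    using that unfolding Phi2_def by (auto intro: someI)
  have M: "e > 0 \<and> (\<exists>p. monic_irreducible p \<and> has_block (of_mat x) p e)" if "e \<in> m ` {1..k}" for e
  proof -
    obtain i where i: "i \<in> {1..k}" "m i = e"
      using \<open>e \<in> m ` {1..k}\<close> by blast
    have "card {j \<in> {1..k}. f j = f i \<and> m j = e} > 0"
      using i by (subst card_gt_0_iff) auto
    then have pos: "?mult (f i) e > 0"
      using ged by (simp add: gen_elementary_divisors_def)
    obtain g where g: "monic_irreducible g" "g ^ e \<in># elementary_divisors x"
    proof (cases "f i \<in> Phi1 bar \<union> Phi3 bar")
      case True
      then show thesis
        using that[of "f i"] pos by (auto simp: gen_elementary_divisor_mult_def Phi1_def Phi3_def)
    next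
      case False
      then have Phi2: "f i \<in> Phi2 bar"
        using pos by (auto simp: gen_elementary_divisor_mult_def split: if_splits)
      show thesis
      proof (rule that)
        show "monic_irreducible (SOME g. Phi2_factor bar (f i) g)"
          using SOME_factor[OF Phi2] unfolding Phi2_factor_def[of bar "f i" "Eps _"] by blast
        show "(SOME g. Phi2_factor bar (f i) g) ^ e \<in># elementary_divisors x"
          using pos False by (simp add: gen_elementary_divisor_mult_def split: if_splits)
      qed
    qed
    moreover have "e > 0"
      using g(2) one_not_elementary_divisor by (cases e) auto
    ultimately show ?thesis
      using block by blast
  qed
  have M': "r dvd e" if p: "monic_irreducible p" "e > 0" "has_block (of_mat x) p e" for p e
  proof -
    have p0: "coeff p 0 \<noteq> 0"
      using has_block_coeff[OF p(3,1) isomD(5)[OF xC]] .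
    define p' where "p' = dual_poly bar p"
    have "\<exists>P. ?mult P e > 0"
    proof (cases "p = p'")
      case True
      have "degree p = 1 \<or> degree p > 1"
        using degree_monic_irreducible[OF p(1)] by linarith
      moreover have "p = dual_poly bar p"
        using True unfolding p'_def .
      ultimately have "p \<in> Phi1 bar \<union> Phi3 bar"
        unfolding Phi1_def Phi3_def using p(1) p0 by blast
      moreover have "p ^ e \<in># elementary_divisors x"
        using block p by blast
      ultimately show ?thesis
        by (auto simp: gen_elementary_divisor_mult_def intro!: exI[of _ p])
    next
      case False
      define P where "P = p * p'"
      have factor: "Phi2_factor bar P p"
        using p(1) p0 False by (simp add: Phi2_factor_def P_def p'_def)
      then have P2: "P \<in> Phi2 bar"
        by (auto simp: Phi2_def)
      define g where "g = (SOME g. Phi2_factor bar P g)"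
      have g: "monic_irreducible g" "coeff g 0 \<noteq> 0" "P = g * dual_poly bar g"
        using SOME_factor[OF P2, folded g_def] unfolding Phi2_factor_def by blast+
      have deg: "degree p > 0"
        by (rule degree_monic_irreducible[OF p(1)])
      have p': "lead_coeff p' = 1" "degree p' = degree p"
        using monic_dual_poly[OF p0] by (auto simp: p'_def)
      \<comment> \<open>\<open>P\<close> is reducible, so the second branch of
        \<open>gen_elementary_divisor_mult\<close> is the one that applies to it.\<close>
      have "P \<notin> Phi1 bar \<union> Phi3 bar"
      proof
        assume "P \<in> Phi1 bar \<union> Phi3 bar"
        then have "irreducible P"
          by (auto simp: Phi1_def Phi3_def monic_irreducible_def)
        then have "p dvd 1 \<or> p' dvd 1"
          using irreducibleD P_def by blast
        then show False
          using deg p'(2) by (metis degree_1 dvd_imp_degree_le not_le zero_neq_one)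
      qed
      then have mult: "?mult P e = count (elementary_divisors x) (g ^ e)"
        using P2 by (simp add: gen_elementary_divisor_mult_def g_def)
      \<comment> \<open>By unique factorization the chosen factor \<open>g\<close> is
        \<open>p\<close> or its dual, and \<open>has_block_dual\<close> settles the latter.\<close>
      have "has_block (of_mat x) g e"
      proof (cases "g = p")
        case True
        then show ?thesis
          using p by simp
      next
        case False
        have "g dvd p * p'"
          using g(3) P_def by (metis dvd_triv_left)
        then have "g dvd p \<or> g dvd p'"
          using prime_elem_monic_irreducible[OF g(1)] prime_elem_dvd_multD by blast
        then have "g dvd p'"
          using False monic_irreducible_dvd_eq[OF g(1) p(1)] by blast
        then obtain c where c: "p' = g * c"
          by (auto elim: dvdE)
        have "p dvd g * dual_poly bar g"
          using g(3) P_def by (metis dvd_triv_left)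
        then have "p dvd g \<or> p dvd dual_poly bar g"
          using prime_elem_monic_irreducible[OF p(1)] prime_elem_dvd_multD by blast
        then have "p dvd dual_poly bar g"
          using False monic_irreducible_dvd_eq[OF p(1) g(1)] by blast
        moreover have "dual_poly bar g \<noteq> 0"
          using monic_dual_poly(1)[OF g(2)] by auto
        ultimately have "degree p \<le> degree g"
          using monic_dual_poly(2)[OF g(2)] by (metis dvd_imp_degree_le)
        have c0: "c \<noteq> 0" "g \<noteq> 0"
          using c p'(1) by auto
        then have "degree p' = degree g + degree c"
          by (simp add: c degree_mult_eq)
        then have "degree c = 0"
          using \<open>degree p \<le> degree g\<close> p'(2) by simp
        then obtain c1 where c1: "c = [:c1:]"
          by (rule degree_eq_zeroE)
        have "lead_coeff p' = lead_coeff g * c1"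
          using c0 by (simp add: c c1 lead_coeff_mult)
        then have "c = 1"
          using p'(1) g(1) by (simp add: monic_irreducible_def c1 one_pCons)
        then have "g = p'"
          by (simp add: c)
        then show ?thesis
          using has_block_dual[OF xC p0 p(3)] by (simp add: p'_def)
      qed
      then have "g ^ e \<in># elementary_divisors x"
        using block[OF g(1) p(2)] by simp
      then have "?mult P e > 0"
        by (simp add: mult)
      then show ?thesis by blast
    qed
    then have "e \<in> m ` {1..k}"
      using mult_mem by blast
    then show ?thesis
      unfolding r_def by (intro Gcd_dvd) simp
  qed
  have cx: "card (dt ` centralizer (of_mat x)) * r = q + 1"
    unfolding r_def by (rule card_dt_unitary_centralizer[OF card bar xC M]) (use M' r_def in auto)
  \<comment> \<open>At \<open>x = 1\<close> the exponent 1 makes the gcd trivial, so the isometry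
    group has \<open>q + 1\<close> determinants.\<close>
  have c1: "card (dt ` centralizer 1) = q + 1"
  proof -
    have "Gcd ({1} \<union> {q + 1}) = (1::nat)"
      by simp
    moreover have "card (dt ` centralizer 1) * Gcd ({1} \<union> {q + 1}) = q + 1"
    proof (rule card_dt_unitary_centralizer[OF card bar one_isom])
      fix j :: nat assume "j \<in> {1}"
      then show "0 < j \<and> (\<exists>p. monic_irreducible p \<and> has_block (1 :: ('a, 'n) sqmat) p j)"
        using has_block_one monic_irreducible_linear by auto
    qed simp
    ultimately show ?thesis by simp
  qed
  have "card {cls {g \<in> isom. dt g = 1} y | y. y \<in> cls isom (of_mat x)} *
    card (dt ` centralizer (of_mat x)) = r * card (dt ` centralizer (of_mat x))"
    using card_isom_classes[of "of_mat x"] cx c1 by (simp only: mult.commute)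
  moreover have "card (dt ` centralizer (of_mat x)) \<noteq> 0"
    using cx by (intro notI) simp
  ultimately have "card {cls {g \<in> isom. dt g = 1} y | y. y \<in> cls isom (of_mat x)} = r"
    by (simp only: mult_cancel_right) simp
  then show ?thesis
    using class_splits_into_iff[OF inv G] by (simp add: r_def)
qed

end

theorem theorem6p1p6:
  fixes x :: "'a::{field, finite}^'n^'n"
  shows
    "(\<forall>\<epsilon> (Q :: 'a^'n \<Rightarrow> 'a).
        odd CARD('a) \<and> nonsingular_quadratic_form Q \<and> has_type Q \<epsilon> \<and>
        x \<in> special_subgroup (orthogonal_group Q) \<longrightarrow>
        (class_splits_into (orthogonal_group Q) (special_subgroup (orthogonal_group Q)) x 2 \<longleftrightarrow>
         \<not> (\<exists>m. odd m \<and> ([:- 1, 1:] ^ m \<in># elementary_divisors x \<or>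
                          [:1, 1:] ^ m \<in># elementary_divisors x)))) \<and>
     (\<forall>(q :: nat) (h :: 'a^'n \<Rightarrow> 'a^'n \<Rightarrow> 'a) k f m.
        CARD('a) = q\<^sup>2 \<and> nondegenerate_hermitian_form (\<lambda>a. a ^ q) h \<and>
        x \<in> special_subgroup (unitary_group h) \<and>
        gen_elementary_divisors (\<lambda>a. a ^ q) x k f m \<longrightarrow>
        class_splits_into (unitary_group h) (special_subgroup (unitary_group h)) x
          (Gcd (m ` {1..k} \<union> {q + 1})))"
proof (intro conjI allI impI; elim conjE)
  fix \<epsilon> and Q :: "'a ^ 'n \<Rightarrow> 'a"
  assume odd: "odd CARD('a)" and Q: "nonsingular_quadratic_form Q"
    and xS: "x \<in> special_subgroup (orthogonal_group Q)"
  \<comment> \<open>The order of the field is a power of its characteristic, so an odd order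
    excludes characteristic 2.\<close>
  have two: "(2::'a) \<noteq> 0"
  proof
    assume "(2::'a) = 0"
    then have "CHAR('a) dvd 2"
      by (metis of_nat_eq_0_iff_char_dvd of_nat_numeral)
    then have "CHAR('a) = 2"
      using CHAR_not_1'[where ?'a = 'a] two_is_prime_nat by (auto simp: prime_nat_iff)
    moreover obtain k where k: "CARD('a) = CHAR('a) ^ k"
      using card_field_power_CHAR by blast
    moreover have "k \<noteq> 0"
      using k one_less_card_field[where ?'a = 'a] by (metis less_irrefl power_0)
    ultimately show False
      using odd by simp
  qed
  have S: "sesquilinear (\<lambda>a. a) (polar Q)"
    by (rule sesquilinear_polar[OF two Q])
  have "quadratic_form Q"
    using Q by (simp add: nonsingular_quadratic_form_def)
  then have C: "orthogonal_group Q = unitary_group (polar Q)"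
    by (rule orthogonal_group_eq_unitary_group[OF two])
  show "class_splits_into (orthogonal_group Q) (special_subgroup (orthogonal_group Q)) x 2 \<longleftrightarrow>
      \<not> (\<exists>m. odd m \<and> ([:- 1, 1:] ^ m \<in># elementary_divisors x \<or>
                       [:1, 1:] ^ m \<in># elementary_divisors x))"
  proof (rule sesquilinear.class_splits_into_orthogonal[OF S refl two])
    show "invertible g" if "g \<in> orthogonal_group Q" for g
      using that by (simp add: orthogonal_group_def)
    show "of_mat ` orthogonal_group Q = sesquilinear.isom (\<lambda>a. a) (polar Q)"
      unfolding C by (rule of_mat_unitary_group[OF S])
    show "x \<in> orthogonal_group Q"
      using xS by (simp add: special_subgroup_def)
  qed
next
  fix q :: nat and h :: "'a ^ 'n \<Rightarrow> 'a ^ 'n \<Rightarrow> 'a" and k f m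
  assume card: "CARD('a) = q\<^sup>2" and h: "nondegenerate_hermitian_form (\<lambda>a. a ^ q) h"
    and xS: "x \<in> special_subgroup (unitary_group h)"
    and ged: "gen_elementary_divisors (\<lambda>a. a ^ q) x k f m"
  have S: "sesquilinear (\<lambda>a. a ^ q) h"
    by (rule sesquilinear_hermitian[OF card h])
  show "class_splits_into (unitary_group h) (special_subgroup (unitary_group h)) x
      (Gcd (m ` {1..k} \<union> {q + 1}))"
  proof (rule sesquilinear.class_splits_into_unitary[OF S card refl _ _ _ ged])
    show "invertible g" if "g \<in> unitary_group h" for g
      using that by (simp add: unitary_group_def)
    show "of_mat ` unitary_group h = sesquilinear.isom (\<lambda>a. a ^ q) h"
      by (rule of_mat_unitary_group[OF S])
    show "x \<in> unitary_group h"
      using xS by (simp add: special_subgroup_def)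
  qed
qed

end
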